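(* Let $\Gamma$ be a countable discrete group. If $L$ is the universal minimal $\Gamma$-space and $Y$ is an $X$-boundary for a minimal finite $\Gamma$-space $X$, then $I_\Gamma(C(Y))\ncong C(L)$.
   Context: A $\Gamma$-space is a compact Hausdorff space with an action of $\Gamma$ by homeomorphisms; $\Gamma$ acts on $C(X)$ by $(sf)(x)=f(s^{-1}x)$ and on the set $\mathrm{Prob}(X)$ of probability measures on $X$ by $s\nu(E)=\nu(s^{-1}E)$. A $\Gamma$-space is minimal if every orbit is dense. The universal minimal $\Gamma$-space $L$ is the minimal $\Gamma$-space (unique up to homeomorphism of $\Gamma$-spaces) that maps onto every minimal $\Gamma$-space by a continuous $\Gamma$-equivariant surjection; it can be realized as a minimal left ideal of the Stone-Čech compactification $\beta\Gamma$. For a minimal $\Gamma$-space $X$, an $X$-boundary (or $(\Gamma,X)$-boundary) is a pair $(Y,\varphi)$ (or simply $Y$) where $Y$ is a minimal $\Gamma$-space and $\varphi:Y\to X$ is a continuous $\Gamma$-equivariant surjection such that for every $\nu\in\mathrm{Prob}(Y)$ with $\mathrm{supp}(\nu)\subseteq\varphi^{-1}(x)$ for some $x\in X$, the weak* closure of $\Gamma\nu=\{s\nu : s\in\Gamma\}$ contains the point mass $\delta_y$ for some $y\in Y$. A $\Gamma$-operator system is an operator system (unital self-adjoint subspace of a unital $C^*$-algebra) with an action of $\Gamma$ by order isomorphisms; a $\Gamma$-map between such is a unital completely positive $\Gamma$-equivariant map; an extension of $\mathcal V$ is a pair $(\mathcal W,\phi)$ with $\phi:\mathcal V\to\mathcal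 W$ a completely isometric $\Gamma$-map. A $\Gamma$-operator system $\mathcal U$ is $\Gamma$-injective if for every $\Gamma$-map $\phi:\mathcal V\to\mathcal U$ and every extension $\iota:\mathcal V\to\mathcal W$ there is a $\Gamma$-map $\psi:\mathcal W\to\mathcal U$ with $\psi\iota=\phi$. The $\Gamma$-injective envelope $I_\Gamma(\mathcal V)$ of $\mathcal V$ is the minimal $\Gamma$-injective extension $(\mathcal I,\kappa)$ of $\mathcal V$: $\mathcal I$ is $\Gamma$-injective and any $\Gamma$-injective $\mathcal I_1$ with $\kappa(\mathcal V)\subseteq\mathcal I_1\subseteq\mathcal I$ equals $\mathcal I$. It exists and is unique up to completely isometric $\Gamma$-equivariant isomorphism; for a $\Gamma$-space $Y$, $I_\Gamma(C(Y))$ is a commutative $\Gamma$-$C^*$-algebra. The symbol $\cong$ denotes $\Gamma$-equivariant $*$-isomorphism.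
   Formalization: The group Γ is assumed countably infinite: for every finite Γ the claim fails as stated, since with X = Y = L = Γ the algebra C(Γ) is already Γ-injective and so I_Γ(C(Y)) ≅ C(L). *)

theory Defs
  imports
    "HOL-Probability.Probability"
    "HOL-Algebra.Module"
    "HOL-Algebra.Group_Action"
    "HOL-Algebra.QuotRing"
begin

section \<open>Minimal \<open>\<Gamma>\<close>-spaces\<close>

record ('g, 'x) gspace =
  gtop :: "'x topology"
  move :: "'g \<Rightarrow> 'x \<Rightarrow> 'x"

abbreviation points :: "('g, 'x) gspace \<Rightarrow> 'x set"
  where "points X \<equiv> topspace (gtop X)"

definition gamma_space :: "('g, 'm) monoid_scheme \<Rightarrow> ('g, 'x) gspace \<Rightarrow> bool"
  where "gamma_space \<Gamma> X \<longleftrightarrow>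
    compact_space (gtop X) \<and> Hausdorff_space (gtop X) \<and>
    group_action \<Gamma> (points X) (move X) \<and>
    (\<forall>s\<in>carrier \<Gamma>. homeomorphic_map (gtop X) (gtop X) (move X s))"

text \<open>A minimal space is required to be nonempty, as usual; otherwise the empty space would be
  minimal vacuously.\<close>

definition minimal_gamma_space :: "('g, 'm) monoid_scheme \<Rightarrow> ('g, 'x) gspace \<Rightarrow> bool"
  where "minimal_gamma_space \<Gamma> X \<longleftrightarrow>
    gamma_space \<Gamma> X \<and> points X \<noteq> {} \<and>
    (\<forall>x\<in>points X. gtop X closure_of orbit \<Gamma> (move X) x = points X)"

definition factor_map ::
    "('g, 'm) monoid_scheme \<Rightarrow> ('g, 'y) gspace \<Rightarrow> ('g, 'x) gspace \<Rightarrow> ('y \<Rightarrow> 'x) \<Rightarrow> bool"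
  where "factor_map \<Gamma> Y X \<phi> \<longleftrightarrow>
    continuous_map (gtop Y) (gtop X) \<phi> \<and> \<phi> ` points Y = points X \<and>
    (\<forall>s\<in>carrier \<Gamma>. \<forall>y\<in>points Y. \<phi> (move Y s y) = move X s (\<phi> y))"

text \<open>HOL cannot quantify over all types inside a formula. Nothing is lost by letting \<open>Z\<close> range over
  the minimal spaces whose points are families of subsets of \<open>\<Gamma>\<close>: every minimal \<open>\<Gamma>\<close>-space is an
  equivariant continuous image of the space of ultrafilters on \<open>\<Gamma>\<close> (extend an orbit map), hence is
  isomorphic to a \<open>\<Gamma>\<close>-space carried by a set of ultrafilters, one chosen in each fibre.\<close>

definition universal_minimal_gamma_space ::
    "('g, 'm) monoid_scheme \<Rightarrow> ('g, 'l) gspace \<Rightarrow> bool"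
  where "universal_minimal_gamma_space \<Gamma> L \<longleftrightarrow>
    minimal_gamma_space \<Gamma> L \<and>
    (\<forall>Z :: ('g, 'g set set) gspace.
       minimal_gamma_space \<Gamma> Z \<longrightarrow> (\<exists>p. factor_map \<Gamma> L Z p))"


section \<open>Unital \<open>C\<^sup>*\<close>-algebras and their matrix algebras\<close>

definition complex_ring :: "complex ring"
  where "complex_ring =
    \<lparr>carrier = UNIV, monoid.mult = (*), one = 1, ring.zero = 0, add = (+)\<rparr>"

record 'a cstar = "(complex, 'a) module" +
  adj :: "'a \<Rightarrow> 'a"
  nrm :: "'a \<Rightarrow> real"

locale unital_cstar_algebra = ring A + module complex_ring A for A :: "'a cstar" (structure) +
  assumes smult_mult_left: "\<And>c x y. x \<in> carrier A \<Longrightarrow> y \<in> carrier A \<Longrightarrow>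
      (c \<odot> x) \<otimes> y = c \<odot> (x \<otimes> y)"
    and smult_mult_right: "\<And>c x y. x \<in> carrier A \<Longrightarrow> y \<in> carrier A \<Longrightarrow>
      x \<otimes> (c \<odot> y) = c \<odot> (x \<otimes> y)"
    and adj_closed: "\<And>x. x \<in> carrier A \<Longrightarrow> adj A x \<in> carrier A"
    and adj_adj: "\<And>x. x \<in> carrier A \<Longrightarrow> adj A (adj A x) = x"
    and adj_add: "\<And>x y. x \<in> carrier A \<Longrightarrow> y \<in> carrier A \<Longrightarrow>
      adj A (x \<oplus> y) = adj A x \<oplus> adj A y"
    and adj_smult: "\<And>c x. x \<in> carrier A \<Longrightarrow> adj A (c \<odot> x) = cnj c \<odot> adj A x"
    and adj_mult: "\<And>x y. x \<in> carrier A \<Longrightarrow> y \<in> carrier A \<Longrightarrow>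
      adj A (x \<otimes> y) = adj A y \<otimes> adj A x"
    and nrm_nonneg: "\<And>x. x \<in> carrier A \<Longrightarrow> 0 \<le> nrm A x"
    and nrm_eq_0: "\<And>x. x \<in> carrier A \<Longrightarrow> nrm A x = 0 \<longleftrightarrow> x = \<zero>"
    and nrm_add: "\<And>x y. x \<in> carrier A \<Longrightarrow> y \<in> carrier A \<Longrightarrow>
      nrm A (x \<oplus> y) \<le> nrm A x + nrm A y"
    and nrm_smult: "\<And>c x. x \<in> carrier A \<Longrightarrow> nrm A (c \<odot> x) = cmod c * nrm A x"
    and nrm_mult: "\<And>x y. x \<in> carrier A \<Longrightarrow> y \<in> carrier A \<Longrightarrow>
      nrm A (x \<otimes> y) \<le> nrm A x * nrm A y"
    and cstar_identity: "\<And>x. x \<in> carrier A \<Longrightarrow> nrm A (adj A x \<otimes> x) = (nrm A x)\<^sup>2"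
    and complete: "\<And>f :: nat \<Rightarrow> 'a. (\<And>n. f n \<in> carrier A) \<Longrightarrow>
      (\<And>e. 0 < e \<Longrightarrow> \<exists>N. \<forall>m\<ge>N. \<forall>n\<ge>N. nrm A (f m \<ominus> f n) < e) \<Longrightarrow>
      \<exists>x\<in>carrier A. (\<lambda>n. nrm A (f n \<ominus> x)) \<longlonglongrightarrow> 0"

definition cstar_pos :: "'a cstar \<Rightarrow> 'a \<Rightarrow> bool"
  where "cstar_pos A a \<longleftrightarrow> (\<exists>b\<in>carrier A. a = adj A b \<otimes>\<^bsub>A\<^esub> b)"

text \<open>The \<open>C\<^sup>*\<close>-algebra \<open>M\<^sub>n(A)\<close>. Matrices are functions of two indices, equal to zero outside
  \<open>{..<n} \<times> {..<n}\<close>. The norm is the operator norm for the action by left multiplication on the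
  Hilbert \<open>A\<close>-module \<open>A\<^sup>n\<close>, with \<open>\<parallel>y\<parallel>\<^sup>2 = \<parallel>\<Sum>i. y\<^sub>i\<^sup>* y\<^sub>i\<parallel>\<close>; it is the unique \<open>C\<^sup>*\<close>-norm
  on \<open>M\<^sub>n(A)\<close>.\<close>

definition mat_of :: "'a cstar \<Rightarrow> nat \<Rightarrow> (nat \<Rightarrow> nat \<Rightarrow> 'a) \<Rightarrow> nat \<Rightarrow> nat \<Rightarrow> 'a"
  where "mat_of A n a = (\<lambda>i j. if i < n \<and> j < n then a i j else \<zero>\<^bsub>A\<^esub>)"

definition column_nrm :: "'a cstar \<Rightarrow> nat \<Rightarrow> (nat \<Rightarrow> 'a) \<Rightarrow> real"
  where "column_nrm A n y = sqrt (nrm A (\<Oplus>\<^bsub>A\<^esub>i\<in>{..<n}. adj A (y i) \<otimes>\<^bsub>A\<^esub> y i))"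

definition mat_cstar :: "nat \<Rightarrow> 'a cstar \<Rightarrow> (nat \<Rightarrow> nat \<Rightarrow> 'a) cstar"
  where "mat_cstar n A =
    \<lparr>carrier = {a. (\<forall>i<n. \<forall>j<n. a i j \<in> carrier A) \<and> mat_of A n a = a},
     monoid.mult = (\<lambda>a b. mat_of A n (\<lambda>i j. \<Oplus>\<^bsub>A\<^esub>k\<in>{..<n}. a i k \<otimes>\<^bsub>A\<^esub> b k j)),
     one = mat_of A n (\<lambda>i j. if i = j then \<one>\<^bsub>A\<^esub> else \<zero>\<^bsub>A\<^esub>),
     ring.zero = (\<lambda>i j. \<zero>\<^bsub>A\<^esub>),
     add = (\<lambda>a b. mat_of A n (\<lambda>i j. a i j \<oplus>\<^bsub>A\<^esub> b i j)),
     smult = (\<lambda>c a. mat_of A n (\<lambda>i j. c \<odot>\<^bsub>A\<^esub> a i j)),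
     adj = (\<lambda>a. mat_of A n (\<lambda>i j. adj A (a j i))),
     nrm = (\<lambda>a. Sup {column_nrm A n (\<lambda>i. \<Oplus>\<^bsub>A\<^esub>j\<in>{..<n}. a i j \<otimes>\<^bsub>A\<^esub> y j) | y.
                     (\<forall>j<n. y j \<in> carrier A) \<and> column_nrm A n y \<le> 1})\<rparr>"


section \<open>\<open>\<Gamma>\<close>-operator systems\<close>

text \<open>An operator system is given together with the \<open>C\<^sup>*\<close>-algebra containing it.\<close>

record ('g, 'a) gsystem =
  alg :: "'a cstar"
  sys :: "'a set"
  act :: "'g \<Rightarrow> 'a \<Rightarrow> 'a"

definition operator_system :: "'a cstar \<Rightarrow> 'a set \<Rightarrow> bool"
  where "operator_system A S \<longleftrightarrow>
    unital_cstar_algebra A \<and> submodule S complex_ring A \<and> \<one>\<^bsub>A\<^esub> \<in> S \<and> (\<forall>x\<in>S. adj A x \<in> S)"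

definition unital_linear ::
    "'a cstar \<Rightarrow> 'a set \<Rightarrow> 'b cstar \<Rightarrow> 'b set \<Rightarrow> ('a \<Rightarrow> 'b) \<Rightarrow> bool"
  where "unital_linear A S B T \<phi> \<longleftrightarrow>
    \<phi> \<in> S \<rightarrow> T \<and>
    (\<forall>x\<in>S. \<forall>y\<in>S. \<phi> (x \<oplus>\<^bsub>A\<^esub> y) = \<phi> x \<oplus>\<^bsub>B\<^esub> \<phi> y) \<and>
    (\<forall>c. \<forall>x\<in>S. \<phi> (c \<odot>\<^bsub>A\<^esub> x) = c \<odot>\<^bsub>B\<^esub> \<phi> x) \<and>
    \<phi> \<one>\<^bsub>A\<^esub> = \<one>\<^bsub>B\<^esub>"

text \<open>Order isomorphisms are those of operator systems, so they preserve the unit; their bijectivity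
  is part of \<^const>\<open>group_action\<close>.\<close>

definition gamma_operator_system :: "('g, 'm) monoid_scheme \<Rightarrow> ('g, 'a) gsystem \<Rightarrow> bool"
  where "gamma_operator_system \<Gamma> V \<longleftrightarrow>
    operator_system (alg V) (sys V) \<and>
    group_action \<Gamma> (sys V) (act V) \<and>
    (\<forall>s\<in>carrier \<Gamma>.
       unital_linear (alg V) (sys V) (alg V) (sys V) (act V s) \<and>
       (\<forall>x\<in>sys V. cstar_pos (alg V) (act V s x) \<longleftrightarrow> cstar_pos (alg V) x))"

definition mat_sys :: "nat \<Rightarrow> ('g, 'a) gsystem \<Rightarrow> (nat \<Rightarrow> nat \<Rightarrow> 'a) set"
  where "mat_sys n V = {a \<in> carrier (mat_cstar n (alg V)). \<forall>i<n. \<forall>j<n. a i j \<in> sys V}"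

definition completely_positive ::
    "('g, 'a) gsystem \<Rightarrow> ('g, 'b) gsystem \<Rightarrow> ('a \<Rightarrow> 'b) \<Rightarrow> bool"
  where "completely_positive V W \<phi> \<longleftrightarrow>
    (\<forall>n. \<forall>a\<in>mat_sys n V. cstar_pos (mat_cstar n (alg V)) a \<longrightarrow>
       cstar_pos (mat_cstar n (alg W)) (mat_of (alg W) n (\<lambda>i j. \<phi> (a i j))))"

definition completely_isometric ::
    "('g, 'a) gsystem \<Rightarrow> ('g, 'b) gsystem \<Rightarrow> ('a \<Rightarrow> 'b) \<Rightarrow> bool"
  where "completely_isometric V W \<phi> \<longleftrightarrow>
    (\<forall>n. \<forall>a\<in>mat_sys n V.
       nrm (mat_cstar n (alg W)) (mat_of (alg W) n (\<lambda>i j. \<phi> (a i j))) =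
       nrm (mat_cstar n (alg V)) a)"

definition gamma_map ::
    "('g, 'm) monoid_scheme \<Rightarrow> ('g, 'a) gsystem \<Rightarrow> ('g, 'b) gsystem \<Rightarrow> ('a \<Rightarrow> 'b) \<Rightarrow> bool"
  where "gamma_map \<Gamma> V W \<phi> \<longleftrightarrow>
    unital_linear (alg V) (sys V) (alg W) (sys W) \<phi> \<and>
    completely_positive V W \<phi> \<and>
    (\<forall>s\<in>carrier \<Gamma>. \<forall>x\<in>sys V. \<phi> (act V s x) = act W s (\<phi> x))"

definition gamma_extension ::
    "('g, 'm) monoid_scheme \<Rightarrow> ('g, 'a) gsystem \<Rightarrow> ('g, 'b) gsystem \<Rightarrow> ('a \<Rightarrow> 'b) \<Rightarrow> bool"
  where "gamma_extension \<Gamma> V W \<iota> \<longleftrightarrow>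
    gamma_operator_system \<Gamma> W \<and> gamma_map \<Gamma> V W \<iota> \<and> completely_isometric V W \<iota>"

text \<open>As for universal minimal spaces, the systems \<open>V\<close> and \<open>W\<close> have to be taken on a fixed type, which
  must be large enough. Let \<open>U\<close> lie in a \<open>C\<^sup>*\<close>-algebra \<open>A\<close> with elements of type \<open>'a\<close>. Summing
  GNS representations, one for each element of \<open>A\<close>, gives a faithful representation of \<open>A\<close> on a
  Hilbert space \<open>H\<close> with an orthonormal basis indexed by a subset of \<open>'a\<close>, so operators on \<open>H\<close>
  are matrices of type \<open>'a \<Rightarrow> 'a \<Rightarrow> complex\<close> and \<open>\<ell>\<^sup>\<infinity>(\<Gamma>, B(H))\<close> lives on the type
  \<open>'g \<Rightarrow> 'a \<Rightarrow> 'a \<Rightarrow> complex\<close> used below. The latter algebra is \<open>\<Gamma>\<close>-injective (against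
  systems of any size), and \<open>u \<mapsto> (s \<mapsto> s\<^sup>-\<^sup>1u)\<close> embeds \<open>U\<close> in it when the order isomorphisms of
  the action are complete, which is automatic if \<open>A\<close> is commutative. Hence the single extension
  problem with \<open>V = U\<close> and \<open>W = \<ell>\<^sup>\<infinity>(\<Gamma>, B(H))\<close> decides \<open>\<Gamma>\<close>-injectivity. For the envelope
  of \<open>C(Y)\<close> with \<open>Y\<close> minimal, even \<open>W = \<ell>\<^sup>\<infinity>(\<Gamma>)\<close> suffices, as \<open>C(Y)\<close> embeds in it by
  restriction to an orbit.\<close>

definition gamma_injective :: "('g, 'm) monoid_scheme \<Rightarrow> ('g, 'a) gsystem \<Rightarrow> bool"
  where "gamma_injective \<Gamma> U \<longleftrightarrow>
    gamma_operator_system \<Gamma> U \<and>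
    (\<forall>(V :: ('g, 'g \<Rightarrow> 'a \<Rightarrow> 'a \<Rightarrow> complex) gsystem)
      (W :: ('g, 'g \<Rightarrow> 'a \<Rightarrow> 'a \<Rightarrow> complex) gsystem) \<phi> \<iota>.
       gamma_operator_system \<Gamma> V \<and> gamma_map \<Gamma> V U \<phi> \<and> gamma_extension \<Gamma> V W \<iota> \<longrightarrow>
       (\<exists>\<psi>. gamma_map \<Gamma> W U \<psi> \<and> (\<forall>v\<in>sys V. \<psi> (\<iota> v) = \<phi> v)))"

definition subsystem :: "('g, 'a) gsystem \<Rightarrow> 'a set \<Rightarrow> ('g, 'a) gsystem"
  where "subsystem U S = U\<lparr>sys := S, act := (\<lambda>s. restrict (act U s) S)\<rparr>"

definition gamma_injective_envelope ::
    "('g, 'm) monoid_scheme \<Rightarrow> ('g, 'a) gsystem \<Rightarrow> ('g, 'b) gsystem \<Rightarrow> ('a \<Rightarrow> 'b) \<Rightarrow> bool"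
  where "gamma_injective_envelope \<Gamma> V I \<kappa> \<longleftrightarrow>
    gamma_injective \<Gamma> I \<and> gamma_extension \<Gamma> V I \<kappa> \<and>
    (\<forall>S. \<kappa> ` sys V \<subseteq> S \<and> S \<subseteq> sys I \<and> gamma_injective \<Gamma> (subsystem I S) \<longrightarrow> S = sys I)"

text \<open>\<open>\<Gamma>\<close>-\<open>C\<^sup>*\<close>-algebras are the systems with \<open>sys U = carrier (alg U)\<close>.\<close>

definition gamma_star_isomorphic ::
    "('g, 'm) monoid_scheme \<Rightarrow> ('g, 'a) gsystem \<Rightarrow> ('g, 'b) gsystem \<Rightarrow> bool"
  where "gamma_star_isomorphic \<Gamma> U W \<longleftrightarrow>
    (\<exists>h \<in> ring_iso (alg U) (alg W).
       (\<forall>c. \<forall>x\<in>carrier (alg U). h (c \<odot>\<^bsub>alg U\<^esub> x) = c \<odot>\<^bsub>alg W\<^esub> h x) \<and>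
       (\<forall>x\<in>carrier (alg U). h (adj (alg U) x) = adj (alg W) (h x)) \<and>
       (\<forall>s\<in>carrier \<Gamma>. \<forall>x\<in>carrier (alg U). h (act U s x) = act W s (h x)))"


section \<open>The \<open>\<Gamma>\<close>-\<open>C\<^sup>*\<close>-algebra of continuous functions\<close>

text \<open>Functions on the space are represented by functions vanishing outside it.\<close>

definition cfun_alg :: "'x topology \<Rightarrow> ('x \<Rightarrow> complex) cstar"
  where "cfun_alg T =
    \<lparr>carrier = {f. continuous_map T euclidean f \<and> (\<forall>x. x \<notin> topspace T \<longrightarrow> f x = 0)},
     monoid.mult = (\<lambda>f g x. f x * g x),
     one = indicator (topspace T),
     ring.zero = (\<lambda>x. 0),
     add = (\<lambda>f g x. f x + g x),
     smult = (\<lambda>c f x. c * f x),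
     adj = (\<lambda>f x. cnj (f x)),
     nrm = (\<lambda>f. Sup (insert 0 ((\<lambda>x. cmod (f x)) ` topspace T)))\<rparr>"

definition cfun :: "('g, 'm) monoid_scheme \<Rightarrow> ('g, 'x) gspace \<Rightarrow> ('g, 'x \<Rightarrow> complex) gsystem"
  where "cfun \<Gamma> X =
    \<lparr>alg = cfun_alg (gtop X),
     sys = carrier (cfun_alg (gtop X)),
     act = (\<lambda>s. \<lambda>f\<in>carrier (cfun_alg (gtop X)).
              \<lambda>x. if x \<in> points X then f (move X (inv\<^bsub>\<Gamma>\<^esub> s) x) else 0)\<rparr>"


section \<open>Boundaries\<close>

definition borel_of :: "'x topology \<Rightarrow> 'x measure"
  where "borel_of T = sigma (topspace T) {U. openin T U}"

text \<open>Probability measures on a compact Hausdorff space are regular Borel measures, so that they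
  correspond to the states of \<open>C(X)\<close> and have well-behaved supports.\<close>

definition Prob :: "'x topology \<Rightarrow> 'x measure set"
  where "Prob T = {\<nu>. prob_space \<nu> \<and> sets \<nu> = sets (borel_of T) \<and>
    (\<forall>E\<in>sets \<nu>. emeasure \<nu> E = (SUP K\<in>{K. compactin T K \<and> K \<subseteq> E}. emeasure \<nu> K))}"

definition supp :: "'x topology \<Rightarrow> 'x measure \<Rightarrow> 'x set"
  where "supp T \<nu> = {x \<in> topspace T. \<forall>U. openin T U \<and> x \<in> U \<longrightarrow> 0 < emeasure \<nu> U}"

definition weak_star :: "'x topology \<Rightarrow> 'x measure topology"
  where "weak_star T = topology_generated_by
    {{\<nu> \<in> Prob T. (\<integral>x. f x \<partial>\<nu>) \<in> U} | f U. f \<in> carrier (cfun_alg T) \<and> open U}"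

definition translate :: "('g, 'x) gspace \<Rightarrow> 'g \<Rightarrow> 'x measure \<Rightarrow> 'x measure"
  where "translate X s \<nu> = distr \<nu> (borel_of (gtop X)) (move X s)"

definition gamma_boundary ::
    "('g, 'm) monoid_scheme \<Rightarrow> ('g, 'x) gspace \<Rightarrow> ('g, 'y) gspace \<Rightarrow> ('y \<Rightarrow> 'x) \<Rightarrow> bool"
  where "gamma_boundary \<Gamma> X Y \<phi> \<longleftrightarrow>
    minimal_gamma_space \<Gamma> Y \<and> factor_map \<Gamma> Y X \<phi> \<and>
    (\<forall>\<nu>\<in>Prob (gtop Y).
       (\<exists>x\<in>points X. supp (gtop Y) \<nu> \<subseteq> {y \<in> points Y. \<phi> y = x}) \<longrightarrow>
       (\<exists>y\<in>points Y. return (borel_of (gtop Y)) y \<in>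
          weak_star (gtop Y) closure_of {translate Y s \<nu> | s. s \<in> carrier \<Gamma>}))"

end

theory Submission
  imports Defs
begin

text \<open>
  Suppose that \<open>I\<^sub>\<Gamma>(C(Y))\<close> were isomorphic to \<open>C(L)\<close>. The envelope is rigid over \<open>C(Y)\<close>, and
  \<open>L\<close> is too large for that.

  \<^emph>\<open>Rigidity.\<close> Restriction to the orbit of a point \<open>l\<^sub>0\<close> embeds \<open>C(L)\<close> in \<open>\<ell>\<^sup>\<infinity>(\<Gamma>)\<close>, and since \<open>C(L)\<close>
  is now \<open>\<Gamma>\<close>-injective, there is a \<open>\<Gamma>\<close>-map \<open>p\<close> from \<open>\<ell>\<^sup>\<infinity>(\<Gamma>)\<close> back onto \<open>C(L)\<close>. The \<open>\<Gamma>\<close>-maps of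
  \<open>\<ell>\<^sup>\<infinity>(\<Gamma>)\<close> into itself are the Poisson transforms of states, and the states whose transforms fix
  \<open>C(Y)\<close> form a compact semigroup under convolution. In it \<open>p\<close> corresponds to an idempotent \<open>e\<close>. An
  idempotent \<open>f\<close> with \<open>e f = f e = f\<close> gives a \<open>\<Gamma>\<close>-projection of \<open>C(L)\<close> that fixes \<open>C(Y)\<close>. Its
  range is \<open>\<Gamma>\<close>-injective, hence everything by minimality of the envelope, and so \<open>f = e\<close>. By
  Ellis' lemma every state \<open>n\<close> in the semigroup with \<open>n e = n\<close> then has a left inverse: \<open>x n = e\<close>
  (\<open>state_left_invertible\<close>). Now let \<open>l\<^sub>1\<close> be a point that no function in \<open>C(Y)\<close> distinguishes from
  \<open>l\<^sub>0\<close>, and let \<open>n\<close> be the average of the states \<open>u \<mapsto> p(u)(l\<^sub>0)\<close> and \<open>u \<mapsto> p(u)(l\<^sub>1)\<close>. If a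
  positive \<open>f \<in> C(L)\<close> had \<open>f(l\<^sub>0) = 1\<close> and \<open>f(s l\<^sub>0) + f(s l\<^sub>1) \<le> 1\<close> for all \<open>s\<close>, then the Poisson
  transform of \<open>f\<close> by \<open>n\<close> would be at most \<open>1/2\<close>, so \<open>1 = e(f) = (x n)(f) \<le> 1/2\<close>. Hence two points
  of \<open>L\<close> that \<open>C(Y)\<close> does not distinguish are close to being proximal
  (\<open>proximality_of_undistinguished_points\<close>).

  \<^emph>\<open>Size of \<open>L\<close>.\<close> For every \<open>m\<close> there is a minimal subshift of \<open>{0..<m}\<^sup>\<Gamma>\<close> that is invariant under
  the rotation of the \<open>m\<close> colours. The \<open>m\<close> rotations of one element have different colours at the
  identity, and keep having them after every translation
  (\<open>minimal_space_with_separated_points\<close>). The subshift is the intersection of a decreasing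
  sequence of strongly irreducible ones. In each step all patterns seen through a finite window of the
  group are collected in one long word, and this word is required to occur, up to rotation, along
  a net in \<open>\<Gamma>\<close> (\<open>refine_flexible_subshift\<close>). Room for the long word exists because \<open>\<Gamma>\<close> is infinite, and
  countably many windows suffice because \<open>\<Gamma>\<close> is countable.

  \<^emph>\<open>Conclusion.\<close> An isometric \<open>\<Gamma>\<close>-map \<open>C(Y) \<rightarrow> C(L)\<close> is composition with a map \<open>L \<rightarrow> Y\<close>
  (\<open>kappa_is_evaluation\<close>). Take \<open>m\<close> larger than the number of points of \<open>X\<close>, map \<open>L\<close> onto the
  subshift by universality, and lift the \<open>m\<close> rotations to \<open>L\<close>. Two of them have images in \<open>Y\<close> in the
  same fibre over \<open>X\<close>. The boundary property, applied to the average of the two point masses, moves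
  these images together (\<open>boundary_contracts_pairs\<close>). A cluster point of the corresponding pairs in
  \<open>L \<times> L\<close> consists of two points with the same image in \<open>Y\<close> whose colours differ all along the orbit.
  The indicator function of the colour of the first one contradicts rigidity.
\<close>

section \<open>Idempotents in compact right topological semigroups\<close>

lemma compact_functions_imp_closed:
  fixes K :: "('a \<Rightarrow> 'b::t2_space) set"
  assumes "compact K"
  shows "closed K"
proof -
  have "Hausdorff_space (product_topology (\<lambda>_::'a. euclidean :: 'b topology) UNIV)"
  proof -
    have "Hausdorff_space (euclidean :: 'b topology)"
      unfolding Hausdorff_space_def disjnt_def using hausdorff by auto
    then show ?thesis by (simp add: Hausdorff_space_product_topology)
  qed
  then have "Hausdorff_space (euclidean :: ('a \<Rightarrow> 'b) topology)"
    by (simp only: euclidean_product_topology)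
  then have "closedin euclidean K"
    using assms by (intro compactin_imp_closedin) simp_all
  then show ?thesis by simp
qed

text \<open>Ellis' lemma, with continuity in the left factor. In a minimal compact subsemigroup \<open>T\<close> and for
  \<open>t \<in> T\<close>, both \<open>T t\<close> and the set of \<open>x \<in> T\<close> with \<open>x t = t\<close> are compact subsemigroups, hence equal
  to \<open>T\<close>; so \<open>t t = t\<close>. The points are functions because the semigroup used later consists of states.\<close>

lemma compact_semigroup_has_idempotent:
  fixes m :: "('i \<Rightarrow> 'b::t2_space) \<Rightarrow> ('i \<Rightarrow> 'b) \<Rightarrow> 'i \<Rightarrow> 'b"
  assumes K: "compact K" "K \<noteq> {}"
    and closed: "\<And>x y. x \<in> K \<Longrightarrow> y \<in> K \<Longrightarrow> m x y \<in> K"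
    and assoc: "\<And>x y z. x \<in> K \<Longrightarrow> y \<in> K \<Longrightarrow> z \<in> K \<Longrightarrow> m (m x y) z = m x (m y z)"
    and cont: "\<And>y. y \<in> K \<Longrightarrow> continuous_on K (\<lambda>x. m x y)"
  obtains f where "f \<in> K" "m f f = f"
proof -
  define S where "S = {T. T \<subseteq> K \<and> T \<noteq> {} \<and> compact T \<and> (\<forall>x\<in>T. \<forall>y\<in>T. m x y \<in> T)}"
  have "\<exists>M\<in>uminus ` S. \<forall>X\<in>uminus ` S. M \<subseteq> X \<longrightarrow> X = M"
  proof (rule subset_Zorn_nonempty)
    show "uminus ` S \<noteq> {}" using K closed unfolding S_def by auto
    fix \<C> assume ne: "\<C> \<noteq> {}" and ch: "subset.chain (uminus ` S) \<C>"
    define \<D> where "\<D> = uminus ` \<C>"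
    have D: "\<D> \<subseteq> S" "\<D> \<noteq> {}" using ne ch unfolding \<D>_def subset.chain_def by auto
    have chD: "X \<subseteq> Y \<or> Y \<subseteq> X" if "X \<in> \<D>" "Y \<in> \<D>" for X Y
      using that ch unfolding \<D>_def subset.chain_def by blast
    have fin: "\<exists>X\<in>\<D>. \<forall>Y\<in>F. X \<subseteq> Y" if "finite F" "F \<subseteq> \<D>" "F \<noteq> {}" for F
      using that(1,3,2)
    proof (induction F rule: finite_ne_induct)
      case (insert x F)
      then obtain X where X: "X \<in> \<D>" "\<forall>Y\<in>F. X \<subseteq> Y" by blast
      moreover have x: "x \<in> \<D>" using insert by blast
      ultimately consider "X \<subseteq> x" | "x \<subseteq> X" using chD[OF X(1) x] by blast
      then show ?case
      proof cases
        case 1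
        then show ?thesis using X by (intro bexI[of _ X]) simp_all
      next
        case 2
        then show ?thesis using X x by (intro bexI[of _ x]) (auto intro: order_trans)
      qed
    qed blast
    have "K \<inter> (\<Inter>X\<in>\<D>. X) \<noteq> {}"
    proof (rule compact_imp_fip_image[OF K(1)])
      show "closed X" if "X \<in> \<D>" for X using that D by (auto simp: S_def compact_functions_imp_closed)
      fix I' assume "finite I'" "I' \<subseteq> \<D>"
      show "K \<inter> (\<Inter>X\<in>I'. X) \<noteq> {}"
      proof (cases "I' = {}")
        case False
        then obtain X where X: "X \<in> \<D>" "\<forall>Y\<in>I'. X \<subseteq> Y"
          using fin[OF \<open>finite I'\<close> \<open>I' \<subseteq> \<D>\<close> False] by blast
        then obtain x where "x \<in> X" "x \<in> K" using D(1) unfolding S_def by blast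
        then show ?thesis using X(2) by blast
      qed (use K(2) in simp)
    qed
    moreover have "compact (\<Inter>\<D>)"
    proof -
      obtain X where X: "X \<in> \<D>" using D(2) by blast
      have "closed (\<Inter>\<D>)"
        using D(1) by (intro closed_Inter) (auto simp: S_def compact_functions_imp_closed)
      moreover have "compact X" using X D(1) by (auto simp: S_def)
      moreover have "\<Inter>\<D> = X \<inter> \<Inter>\<D>" using X by blast
      ultimately show ?thesis using compact_Int_closed by metis
    qed
    ultimately have "\<Inter>\<D> \<in> S" using D unfolding S_def by auto blast+
    moreover have "\<Union>\<C> = - \<Inter>\<D>" unfolding \<D>_def by auto
    ultimately show "\<Union>\<C> \<in> uminus ` S" by blast
  qed
  then obtain M where M: "M \<in> uminus ` S" "\<forall>X\<in>uminus ` S. M \<subseteq> X \<longrightarrow> X = M" by (rule bexE)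
  from M(1) obtain T where T: "T \<in> S" "M = - T" by (rule imageE)
  have min: "X = T" if "X \<in> S" "X \<subseteq> T" for X
  proof -
    have "- X = M" using bspec[OF M(2) imageI[OF that(1)]] that(2) T(2) by simp
    then show ?thesis using T(2) by simp
  qed
  have TK: "T \<subseteq> K" and cT: "compact T" and mT: "\<And>x y. x \<in> T \<Longrightarrow> y \<in> T \<Longrightarrow> m x y \<in> T"
    using T unfolding S_def by auto
  obtain t where t: "t \<in> T" using T unfolding S_def by auto
  have contT: "continuous_on T (\<lambda>x. m x t)" using cont TK t continuous_on_subset by blast
  have "(\<lambda>x. m x t) ` T \<in> S"
    unfolding S_def
  proof (intro CollectI conjI ballI)
    fix x y assume "x \<in> (\<lambda>x. m x t) ` T" "y \<in> (\<lambda>x. m x t) ` T"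
    then obtain a b where ab: "a \<in> T" "b \<in> T" "x = m a t" "y = m b t" by auto
    then have "m x y = m (m (m a t) b) t" using assoc TK t mT by (metis subsetD)
    then show "m x y \<in> (\<lambda>x. m x t) ` T" using ab t mT by blast
  qed (use t TK mT contT cT compact_continuous_image in \<open>auto intro: mT\<close>)
  then have "(\<lambda>x. m x t) ` T = T" using min mT t by blast
  then obtain s where s: "s \<in> T" "m s t = t" using t by (metis imageE)
  have "{x \<in> T. m x t = t} \<in> S"
    unfolding S_def
  proof (intro CollectI conjI ballI)
    have "closedin (top_of_set T) {x \<in> T. m x t = t}"
      using continuous_closedin_preimage[OF contT compact_functions_imp_closed[of "{t}"]]
      by (simp add: vimage_def Int_def)
    then show "compact {x \<in> T. m x t = t}" using closedin_compact cT by blast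
  qed (use s t TK mT assoc in \<open>auto simp: subset_iff\<close>)
  then have "{x \<in> T. m x t = t} = T" using min by blast
  then have "m t t = t" using t by blast
  then show thesis using that t TK by blast
qed

text \<open>The left ideal \<open>K n\<close> is a compact semigroup, so it contains an idempotent \<open>f\<close>. Since \<open>n e = n\<close>,
  also \<open>f e = f\<close>, and \<open>e f\<close> is an idempotent below \<open>e\<close> that lies in \<open>K n\<close>. By minimality it is \<open>e\<close>.\<close>

lemma left_invertible_if_idempotent_minimal:
  fixes m :: "('i \<Rightarrow> 'b::t2_space) \<Rightarrow> ('i \<Rightarrow> 'b) \<Rightarrow> 'i \<Rightarrow> 'b"
  assumes K: "compact K"
    and closed: "\<And>x y. x \<in> K \<Longrightarrow> y \<in> K \<Longrightarrow> m x y \<in> K"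
    and assoc: "\<And>x y z. x \<in> K \<Longrightarrow> y \<in> K \<Longrightarrow> z \<in> K \<Longrightarrow> m (m x y) z = m x (m y z)"
    and cont: "\<And>y. y \<in> K \<Longrightarrow> continuous_on K (\<lambda>x. m x y)"
    and e: "e \<in> K" "m e e = e"
    and minimal: "\<And>f. f \<in> K \<Longrightarrow> m f f = f \<Longrightarrow> m e f = f \<Longrightarrow> m f e = f \<Longrightarrow> f = e"
    and n: "n \<in> K" "m n e = n"
  obtains x where "x \<in> K" "m x n = e"
proof -
  let ?N = "(\<lambda>x. m x n) ` K"
  have NK: "?N \<subseteq> K" using closed n by auto
  obtain f where f: "f \<in> ?N" "m f f = f"
  proof (rule compact_semigroup_has_idempotent[of ?N m])
    show "compact ?N" using K cont n compact_continuous_image by blast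
    show "?N \<noteq> {}" using n by auto
    show "m x y \<in> ?N" if "x \<in> ?N" "y \<in> ?N" for x y
    proof -
      from that obtain b where "b \<in> K" "y = m b n" by auto
      then have "m x y = m (m x b) n" "m x b \<in> K" using assoc closed that NK n by auto
      then show ?thesis by blast
    qed
    show "continuous_on ?N (\<lambda>x. m x y)" if "y \<in> ?N" for y
      using cont that NK continuous_on_subset by blast
  qed (use NK assoc in \<open>auto simp: subset_iff\<close>)
  then obtain a where a: "a \<in> K" "f = m a n" by auto
  have fK: "f \<in> K" using f NK by auto
  have fe: "m f e = f" using a n e assoc by auto
  have "m e f = e"
  proof (rule minimal)
    show "m e f \<in> K" using e fK closed by blast
    show "m (m e f) (m e f) = m e f" using assoc closed e fK fe f by metis
    show "m e (m e f) = m e f" using assoc e fK by metis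
    show "m (m e f) e = m e f" using assoc e fK fe by metis
  qed
  then have "m (m e a) n = e" using a e n assoc by auto
  then show thesis using that closed e a by blast
qed

section \<open>Minimal subshifts that are invariant under rotation of the colours\<close>

definition colourings :: "('g, 'm) monoid_scheme \<Rightarrow> nat \<Rightarrow> ('g \<Rightarrow> nat) set"
  where "colourings G m =
    {z. (\<forall>g\<in>carrier G. z g < m) \<and> (\<forall>g. g \<notin> carrier G \<longrightarrow> z g = 0)}"

text \<open>The translation is on the right, which makes it a left action.\<close>

definition shift_colouring :: "('g, 'm) monoid_scheme \<Rightarrow> 'g \<Rightarrow> ('g \<Rightarrow> nat) \<Rightarrow> 'g \<Rightarrow> nat"
  where "shift_colouring G s z = (\<lambda>g. if g \<in> carrier G then z (g \<otimes>\<^bsub>G\<^esub> s) else 0)"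

definition rotate_colours :: "('g, 'm) monoid_scheme \<Rightarrow> nat \<Rightarrow> nat \<Rightarrow> ('g \<Rightarrow> nat) \<Rightarrow> 'g \<Rightarrow> nat"
  where "rotate_colours G m a z = (\<lambda>g. if g \<in> carrier G then (z g + a) mod m else 0)"

text \<open>Strong irreducibility of \<open>T\<close>: any two elements can be combined on sets that \<open>D\<close> keeps apart.\<close>

definition gluing_window :: "('g, 'm) monoid_scheme \<Rightarrow> 'g set \<Rightarrow> ('g \<Rightarrow> nat) set \<Rightarrow> bool"
  where "gluing_window G D T \<longleftrightarrow> finite D \<and> D \<subseteq> carrier G \<and> \<one>\<^bsub>G\<^esub> \<in> D \<and>
    (\<forall>x\<in>T. \<forall>y\<in>T. \<forall>E E'. E \<subseteq> carrier G \<and> E' \<subseteq> carrier G \<and> (D <#>\<^bsub>G\<^esub> E) \<inter> (D <#>\<^bsub>G\<^esub> E') = {} \<longrightarrow>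
       (\<exists>z\<in>T. (\<forall>g\<in>E. z g = x g) \<and> (\<forall>g\<in>E'. z g = y g)))"

definition flexible_subshift :: "('g, 'm) monoid_scheme \<Rightarrow> nat \<Rightarrow> ('g \<Rightarrow> nat) set \<Rightarrow> bool"
  where "flexible_subshift G m T \<longleftrightarrow>
    T \<subseteq> colourings G m \<and> T \<noteq> {} \<and> closed T \<and>
    (\<forall>z\<in>T. \<forall>s\<in>carrier G. shift_colouring G s z \<in> T) \<and>
    (\<forall>z\<in>T. \<forall>a. rotate_colours G m a z \<in> T) \<and>
    (\<exists>D. gluing_window G D T)"

text \<open>Maximality is expressed by \<open>C\<close> being a net: no translate of \<open>U\<close> avoids all those based in \<open>C\<close>.\<close>

definition separated_net :: "('g, 'm) monoid_scheme \<Rightarrow> 'g set \<Rightarrow> 'g set \<Rightarrow> bool"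
  where "separated_net G U C \<longleftrightarrow> C \<subseteq> carrier G \<and>
    (\<forall>c\<in>C. \<forall>c'\<in>C. (U #>\<^bsub>G\<^esub> c) \<inter> (U #>\<^bsub>G\<^esub> c') \<noteq> {} \<longrightarrow> c = c') \<and>
    (\<forall>g\<in>carrier G. \<exists>c\<in>C. (U #>\<^bsub>G\<^esub> g) \<inter> (U #>\<^bsub>G\<^esub> c) \<noteq> {})"

lemma continuous_on_eval_fst: "continuous_on UNIV (\<lambda>p. fst p c :: nat)"
  by (rule continuous_on_product_then_coordinatewise) (intro continuous_intros)

lemma continuous_on_eval_snd: "continuous_on UNIV (\<lambda>p. snd p c :: nat)"
  by (rule continuous_on_product_then_coordinatewise) (intro continuous_intros)

lemma compact_bounded_nat_functions: "compact {z :: 'g \<Rightarrow> nat. \<forall>g. z g \<le> m}"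
proof -
  have "compactin (product_topology (\<lambda>i. euclidean) UNIV) (PiE UNIV (\<lambda>_::'g. {..m}))"
    by (subst compactin_PiE) (auto intro: finite_imp_compact)
  then show ?thesis
    by (simp add: euclidean_product_topology PiE_def Pi_def)
qed

lemma compact_colourings:
  assumes "closed T" "T \<subseteq> colourings G m"
  shows "compact T"
proof -
  have "T = {z. \<forall>g. z g \<le> m} \<inter> T"
  proof (intro equalityI subsetI IntI CollectI allI)
    fix z g assume "z \<in> T"
    then have "z \<in> colourings G m" using assms(2) by auto
    then show "z g \<le> m" by (cases "g \<in> carrier G") (auto simp: colourings_def less_imp_le)
  qed auto
  then show ?thesis
    using compact_Int_closed[OF compact_bounded_nat_functions assms(1)] by metis
qed

context group begin

lemma in_rcos: "U \<subseteq> carrier G \<Longrightarrow> y \<in> U #> c \<longleftrightarrow> (\<exists>u\<in>U. y = u \<otimes> c)"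
  by (auto simp: r_coset_def)

lemma shift_colouring_mem:
  assumes "z \<in> colourings G m" "s \<in> carrier G"
  shows "shift_colouring G s z \<in> colourings G m"
  using assms by (auto simp: colourings_def shift_colouring_def)

lemma shift_shift_colouring:
  assumes "s \<in> carrier G" "t \<in> carrier G"
  shows "shift_colouring G s (shift_colouring G t z) = shift_colouring G (s \<otimes> t) z"
  using assms by (auto simp: shift_colouring_def m_assoc)

lemma flexible_subshiftD:
  assumes "flexible_subshift G m T"
  shows "T \<subseteq> colourings G m" "T \<noteq> {}" "closed T" "compact T"
    "\<And>z s. z \<in> T \<Longrightarrow> s \<in> carrier G \<Longrightarrow> shift_colouring G s z \<in> T"
    "\<And>z a. z \<in> T \<Longrightarrow> rotate_colours G m a z \<in> T"
  using assms compact_colourings by (auto simp: flexible_subshift_def)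

lemma gluing_windowD:
  assumes "gluing_window G D T"
  shows "finite D" "D \<subseteq> carrier G" "\<one> \<in> D"
  using assms unfolding gluing_window_def by auto

lemma gluing:
  assumes "gluing_window G D T" "x \<in> T" "y \<in> T" "E \<subseteq> carrier G" "E' \<subseteq> carrier G"
    "\<And>d d' e e'. d \<in> D \<Longrightarrow> d' \<in> D \<Longrightarrow> e \<in> E \<Longrightarrow> e' \<in> E' \<Longrightarrow> d \<otimes> e \<noteq> d' \<otimes> e'"
  obtains z where "z \<in> T" "\<And>g. g \<in> E \<Longrightarrow> z g = x g" "\<And>g. g \<in> E' \<Longrightarrow> z g = y g"
proof -
  have "(D <#> E) \<inter> (D <#> E') = {}" using assms(6) by (auto simp: set_mult_def)
  then show ?thesis using assms that unfolding gluing_window_def by metis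
qed

text \<open>Only finitely many patterns of \<open>T\<close> can be seen through \<open>F\<close>. As the group is infinite, there are
  translates of \<open>F\<close> that are far apart from each other, one for each pattern, and gluing places all
  patterns in one element.\<close>

lemma universal_word:
  assumes T: "flexible_subshift G m T" and inf: "infinite (carrier G)"
    and F: "finite F" "F \<subseteq> carrier G"
  obtains w V where "w \<in> T" "finite V" "V \<subseteq> carrier G" "V \<noteq> {}"
    "\<And>x. x \<in> T \<Longrightarrow> \<exists>g\<in>carrier G. \<forall>f\<in>F. f \<otimes> g \<in> V \<and> w (f \<otimes> g) = x f"
proof -
  note TD = flexible_subshiftD[OF T]
  obtain D where D: "gluing_window G D T" using T unfolding flexible_subshift_def by auto
  note DD = gluing_windowD[OF D]
  have *: "\<exists>w\<in>T. \<exists>V. finite V \<and> V \<subseteq> carrier G \<and>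
      (\<forall>x\<in>X. \<exists>g\<in>carrier G. \<forall>f\<in>F. f \<otimes> g \<in> V \<and> w (f \<otimes> g) = x f)"
    if "finite X" "X \<subseteq> T" for X
    using that
  proof (induction X rule: finite_induct)
    case empty
    then show ?case using TD(2) by auto
  next
    case (insert x X)
    then obtain w V where w: "w \<in> T" and V: "finite V" "V \<subseteq> carrier G"
      and wV: "\<And>x. x \<in> X \<Longrightarrow> \<exists>g\<in>carrier G. \<forall>f\<in>F. f \<otimes> g \<in> V \<and> w (f \<otimes> g) = x f"
      by auto
    let ?bad = "(\<lambda>(d, f, d', v). inv (d \<otimes> f) \<otimes> (d' \<otimes> v)) ` (D \<times> F \<times> D \<times> V)"
    have "finite ?bad" using DD F V by auto
    then obtain g where g: "g \<in> carrier G" "g \<notin> ?bad"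
      using inf by (meson finite_subset subsetI)
    let ?x = "shift_colouring G (inv g) x"
    have xT: "?x \<in> T" using TD(5) insert g by auto
    have Fg: "F #> g \<subseteq> carrier G" using F g r_coset_subset_G by auto
    have "d \<otimes> v \<noteq> d' \<otimes> h" if "d \<in> D" "d' \<in> D" "v \<in> V" "h \<in> F #> g" for d d' v h
    proof
      assume eq: "d \<otimes> v = d' \<otimes> h"
      from that(4) F(2) obtain f where f: "f \<in> F" "h = f \<otimes> g" by (auto simp: in_rcos)
      have c: "d \<in> carrier G" "d' \<in> carrier G" "v \<in> carrier G" "f \<in> carrier G"
        using that f DD F V by auto
      have "d \<otimes> v = (d' \<otimes> f) \<otimes> g" using eq f c g by (simp add: m_assoc)
      then have "inv (d' \<otimes> f) \<otimes> (d \<otimes> v) = (inv (d' \<otimes> f) \<otimes> (d' \<otimes> f)) \<otimes> g"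
        using c g by (simp only: m_assoc inv_closed m_closed)
      then have "inv (d' \<otimes> f) \<otimes> (d \<otimes> v) = g" using c g by simp
      then show False using g(2) that f by force
    qed
    from gluing[OF D w xT V(2) Fg this] obtain z where z: "z \<in> T"
      "\<And>h. h \<in> V \<Longrightarrow> z h = w h" "\<And>h. h \<in> F #> g \<Longrightarrow> z h = ?x h" by blast
    let ?V = "V \<union> (F #> g)"
    have xs: "\<forall>f\<in>F. f \<otimes> g \<in> ?V \<and> z (f \<otimes> g) = x f"
    proof
      fix f assume f: "f \<in> F"
      then have 1: "f \<otimes> g \<in> F #> g" "f \<in> carrier G" using F by (auto simp: in_rcos)
      then have "z (f \<otimes> g) = x (f \<otimes> g \<otimes> inv g)"
        using z g by (auto simp: shift_colouring_def)
      also have "f \<otimes> g \<otimes> inv g = f" using 1 g by (simp add: m_assoc)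
      finally show "f \<otimes> g \<in> ?V \<and> z (f \<otimes> g) = x f" using 1 by blast
    qed
    have "\<exists>g\<in>carrier G. \<forall>f\<in>F. f \<otimes> g \<in> ?V \<and> z (f \<otimes> g) = y f" if y: "y \<in> insert x X" for y
    proof (cases "y = x")
      case True
      then show ?thesis using xs g(1) by blast
    next
      case False
      then obtain g' where "g' \<in> carrier G" "\<forall>f\<in>F. f \<otimes> g' \<in> V \<and> w (f \<otimes> g') = y f"
        using wV[of y] y by blast
      then show ?thesis using z(2) by (intro bexI[of _ g']) simp_all
    qed
    moreover have "finite ?V" using V F by (auto simp: r_coset_def)
    moreover have "?V \<subseteq> carrier G" using V Fg by blast
    ultimately show ?case
      using z(1) by (intro bexI[of _ z] exI[of _ ?V] conjI ballI)
  qed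
  have "(\<lambda>x. restrict x F) ` T \<subseteq> PiE F (\<lambda>_. {..<m})"
  proof (intro image_subsetI PiE_I)
    fix x g assume "x \<in> T" "g \<in> F"
    then have "x \<in> colourings G m" "g \<in> carrier G" using TD(1) F(2) by blast+
    then show "restrict x F g \<in> {..<m}" using \<open>g \<in> F\<close> by (simp add: colourings_def)
  qed auto
  then have "finite ((\<lambda>x. restrict x F) ` T)"
    using F by (meson finite_PiE finite_lessThan finite_subset)
  then obtain X where X: "X \<subseteq> T" "finite X" "(\<lambda>x. restrict x F) ` T = (\<lambda>x. restrict x F) ` X"
    by (metis finite_subset_image order_refl)
  obtain w V where w: "w \<in> T" and V: "finite V" "V \<subseteq> carrier G"
      and wV: "\<And>x. x \<in> X \<Longrightarrow> \<exists>g\<in>carrier G. \<forall>f\<in>F. f \<otimes> g \<in> V \<and> w (f \<otimes> g) = x f"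
    using *[OF X(2,1)] by auto
  show ?thesis
  proof (rule that[of w "insert \<one> V"])
    fix x assume "x \<in> T"
    then obtain y where y: "y \<in> X" "restrict x F = restrict y F" using X(3) by (metis imageE imageI)
    then have "x f = y f" if "f \<in> F" for f using that by (metis restrict_apply')
    then show "\<exists>g\<in>carrier G. \<forall>f\<in>F. f \<otimes> g \<in> insert \<one> V \<and> w (f \<otimes> g) = x f"
      using wV[OF y(1)] by auto
  qed (use w V in auto)
qed

lemma extend_to_separated_net:
  assumes U: "U \<subseteq> carrier G" "U \<noteq> {}" and C0: "C0 \<subseteq> carrier G"
    "\<And>c c'. c \<in> C0 \<Longrightarrow> c' \<in> C0 \<Longrightarrow> (U #> c) \<inter> (U #> c') \<noteq> {} \<Longrightarrow> c = c'"
  obtains C where "C0 \<subseteq> C" "separated_net G U C"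
proof -
  define S where "S = {C. C0 \<subseteq> C \<and> C \<subseteq> carrier G \<and>
    (\<forall>c\<in>C. \<forall>c'\<in>C. (U #> c) \<inter> (U #> c') \<noteq> {} \<longrightarrow> c = c')}"
  have SI: "C \<in> S" if "C0 \<subseteq> C" "C \<subseteq> carrier G"
    "\<And>c c'. c \<in> C \<Longrightarrow> c' \<in> C \<Longrightarrow> (U #> c) \<inter> (U #> c') \<noteq> {} \<Longrightarrow> c = c'" for C
    using that unfolding S_def by blast
  have SD: "C0 \<subseteq> C" "C \<subseteq> carrier G"
    "\<And>c c'. c \<in> C \<Longrightarrow> c' \<in> C \<Longrightarrow> (U #> c) \<inter> (U #> c') \<noteq> {} \<Longrightarrow> c = c'" if "C \<in> S" for C
    using that unfolding S_def by blast+
  have "\<exists>M\<in>S. \<forall>X\<in>S. M \<subseteq> X \<longrightarrow> X = M"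
  proof (rule subset_Zorn_nonempty)
    show "S \<noteq> {}" using SI[of C0] C0 by blast
    fix \<C> assume ne: "\<C> \<noteq> {}" and ch: "subset.chain S \<C>"
    have sub: "\<C> \<subseteq> S" and cmp: "\<And>X Y. X \<in> \<C> \<Longrightarrow> Y \<in> \<C> \<Longrightarrow> X \<subseteq> Y \<or> Y \<subseteq> X"
      using ch unfolding subset_chain_def by blast+
    show "\<Union>\<C> \<in> S"
    proof (rule SI)
      show "C0 \<subseteq> \<Union>\<C>" using ne sub SD(1) by blast
      show "\<Union>\<C> \<subseteq> carrier G" using sub SD(2) by blast
      fix c c' assume c: "c \<in> \<Union>\<C>" "c' \<in> \<Union>\<C>" "(U #> c) \<inter> (U #> c') \<noteq> {}"
      from c(1,2) obtain A B where AB: "A \<in> \<C>" "c \<in> A" "B \<in> \<C>" "c' \<in> B" by blast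
      from cmp[OF AB(1,3)] obtain Q where "Q \<in> \<C>" "c \<in> Q" "c' \<in> Q" using AB by blast
      then show "c = c'" using SD(3)[of Q c c'] c(3) sub by blast
    qed
  qed
  then obtain M where M: "M \<in> S" and max: "\<And>X. X \<in> S \<Longrightarrow> M \<subseteq> X \<Longrightarrow> X = M" by blast
  have "\<exists>c\<in>M. (U #> g) \<inter> (U #> c) \<noteq> {}" if g: "g \<in> carrier G" for g
  proof (rule ccontr)
    assume no: "\<not> ?thesis"
    have "insert g M \<in> S"
    proof (rule SI)
      show "C0 \<subseteq> insert g M" "insert g M \<subseteq> carrier G" using SD(1,2)[OF M] g by blast+
      fix c c' assume "c \<in> insert g M" "c' \<in> insert g M" "(U #> c) \<inter> (U #> c') \<noteq> {}"
      then show "c = c'" using no SD(3)[OF M, of c c'] by blast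
    qed
    then have "g \<in> M" using max[of "insert g M"] by blast
    moreover have "U #> g \<noteq> {}" using U by (auto simp: r_coset_def)
    ultimately show False using no by blast
  qed
  then have "separated_net G U M" using SD[OF M] unfolding separated_net_def by blast
  then show ?thesis using SD(1)[OF M] that by blast
qed

text \<open>Finitely many copies of the word are inserted one at a time by gluing; compactness of \<open>T\<close> extends
  this to all points of \<open>C\<close> at once.\<close>

lemma fill_with_word:
  assumes T: "flexible_subshift G m T" and D: "gluing_window G D T"
    and w: "w \<in> T" and V: "V \<subseteq> carrier G" and x: "x \<in> T" and E: "E \<subseteq> carrier G"
    and C: "C \<subseteq> carrier G"
    and sep: "\<And>c c'. c \<in> C \<Longrightarrow> c' \<in> C \<Longrightarrow> ((D <#> V) #> c) \<inter> ((D <#> V) #> c') \<noteq> {} \<Longrightarrow> c = c'"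
    and far: "\<And>c. c \<in> C \<Longrightarrow> ((D <#> V) #> c) \<inter> (D <#> E) = {}"
  obtains z where "z \<in> T" "\<And>g. g \<in> E \<Longrightarrow> z g = x g"
    "\<And>c v. c \<in> C \<Longrightarrow> v \<in> V \<Longrightarrow> z (v \<otimes> c) = w v"
proof -
  note TD = flexible_subshiftD[OF T]
  note DD = gluing_windowD[OF D]
  have DVc: "d \<otimes> (v \<otimes> c) \<in> (D <#> V) #> c" if "d \<in> D" "v \<in> V" "c \<in> carrier G" for d v c
    using that DD V by (force simp: r_coset_def set_mult_def m_assoc)
  have fin: "\<exists>z\<in>T. (\<forall>g\<in>E. z g = x g) \<and> (\<forall>c\<in>B. \<forall>v\<in>V. z (v \<otimes> c) = w v)"
    if "finite B" "B \<subseteq> C" for B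
    using that
  proof (induction B rule: finite_induct)
    case empty
    then show ?case using x by auto
  next
    case (insert c B)
    then obtain z where z: "z \<in> T" "\<And>g. g \<in> E \<Longrightarrow> z g = x g"
      "\<And>c v. c \<in> B \<Longrightarrow> v \<in> V \<Longrightarrow> z (v \<otimes> c) = w v" by auto
    have c: "c \<in> carrier G" "c \<in> C" "B \<subseteq> carrier G" using insert C by auto
    let ?w = "shift_colouring G (inv c) w"
    have wT: "?w \<in> T" using TD(5) w c by auto
    let ?E = "E \<union> (V <#> B)"
    have sub: "?E \<subseteq> carrier G" "V #> c \<subseteq> carrier G"
      using E V c by (auto simp: set_mult_def r_coset_def)
    have "d \<otimes> e \<noteq> d' \<otimes> h" if "d \<in> D" "d' \<in> D" "e \<in> ?E" "h \<in> V #> c" for d d' e h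
    proof
      assume eq: "d \<otimes> e = d' \<otimes> h"
      from that obtain v where v: "v \<in> V" "h = v \<otimes> c" using V by (auto simp: in_rcos)
      have in1: "d' \<otimes> h \<in> (D <#> V) #> c" using DVc v c that by auto
      show False
      proof (cases "e \<in> E")
        case True
        then have "d' \<otimes> h \<in> D <#> E" unfolding eq[symmetric] using that by (auto simp: set_mult_def)
        then show False using far[OF c(2)] in1 by blast
      next
        case False
        with that(3) obtain v' b where b: "v' \<in> V" "b \<in> B" "e = v' \<otimes> b" by (auto simp: set_mult_def)
        then have "d' \<otimes> h \<in> (D <#> V) #> b" unfolding eq[symmetric] using DVc that c by auto
        then have "b = c" using sep in1 b insert c by blast
        then show False using insert b by auto
      qed
    qed
    from gluing[OF D z(1) wT sub this] obtain y where y: "y \<in> T"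
      "\<And>g. g \<in> ?E \<Longrightarrow> y g = z g" "\<And>g. g \<in> V #> c \<Longrightarrow> y g = ?w g" by blast
    have "y (v \<otimes> b) = w v" if "v \<in> V" "b \<in> insert c B" for v b
    proof (cases "b = c")
      case True
      have "v \<otimes> c \<in> V #> c" "v \<in> carrier G" using that V by (auto simp: in_rcos)
      then show ?thesis using y(3) True c by (auto simp: shift_colouring_def m_assoc)
    next
      case False
      then have "v \<otimes> b \<in> ?E" using that by (auto simp: set_mult_def)
      then show ?thesis using y(2) z(3) that False by auto
    qed
    then show ?case using y z by (intro bexI[of _ y]) auto
  qed
  have cl: "closed {z. (\<forall>g\<in>E. z g = x g) \<and> (\<forall>v\<in>V. z (v \<otimes> c) = w v)}" for c
    unfolding Ball_def
    by (intro closed_Collect_conj closed_Collect_all closed_Collect_imp closed_Collect_eq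
        continuous_on_const continuous_on_product_coordinates) auto
  have clE: "closed {z. \<forall>g\<in>E. z g = x g}"
    unfolding Ball_def
    by (intro closed_Collect_all closed_Collect_imp closed_Collect_eq
        continuous_on_const continuous_on_product_coordinates) auto
  have "(T \<inter> {z. \<forall>g\<in>E. z g = x g}) \<inter>
      (\<Inter>c\<in>C. {z. (\<forall>g\<in>E. z g = x g) \<and> (\<forall>v\<in>V. z (v \<otimes> c) = w v)}) \<noteq> {}"
  proof (rule compact_imp_fip_image)
    show "compact (T \<inter> {z. \<forall>g\<in>E. z g = x g})" using TD(4) clE by blast
    fix B assume "finite B" "B \<subseteq> C"
    from fin[OF this] show "(T \<inter> {z. \<forall>g\<in>E. z g = x g}) \<inter>
      (\<Inter>c\<in>B. {z. (\<forall>g\<in>E. z g = x g) \<and> (\<forall>v\<in>V. z (v \<otimes> c) = w v)}) \<noteq> {}" by auto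
  qed (use cl in auto)
  then show ?thesis using that by auto
qed

end

lemma closed_Collect_finite_bex:
  assumes "finite A" "\<And>a. a \<in> A \<Longrightarrow> closed {x. P a x}"
  shows "closed {x. \<exists>a\<in>A. P a x}"
proof -
  have "{x. \<exists>a\<in>A. P a x} = (\<Union>a\<in>A. {x. P a x})" by auto
  then show ?thesis using assms by (simp add: closed_UN)
qed

context group begin

lemma rcos_conflictE:
  assumes "U \<subseteq> carrier G" "(U #> c) \<inter> (U #> c') \<noteq> {}"
  obtains u u' where "u \<in> U" "u' \<in> U" "u \<otimes> c = u' \<otimes> c'"
proof -
  obtain y where "y \<in> U #> c" "y \<in> U #> c'" using assms(2) by blast
  then obtain u u' where "u \<in> U" "u' \<in> U" "y = u \<otimes> c" "y = u' \<otimes> c'"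
    using assms(1) by (auto simp: in_rcos)
  then show ?thesis using that[of u u'] by simp
qed

lemma rcos_conflictI:
  assumes "u \<in> U" "u' \<in> U" "u \<otimes> c = u' \<otimes> c'"
  shows "(U #> c) \<inter> (U #> c') \<noteq> {}"
proof -
  have "u \<otimes> c \<in> U #> c" "u \<otimes> c \<in> U #> c'"
    using assms unfolding r_coset_def by blast+
  then show ?thesis by blast
qed

lemma separated_netD:
  assumes "separated_net G U C"
  shows "C \<subseteq> carrier G"
    "\<And>c c'. c \<in> C \<Longrightarrow> c' \<in> C \<Longrightarrow> (U #> c) \<inter> (U #> c') \<noteq> {} \<Longrightarrow> c = c'"
    "\<And>g. g \<in> carrier G \<Longrightarrow> \<exists>c\<in>C. (U #> g) \<inter> (U #> c) \<noteq> {}"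
  using assms unfolding separated_net_def by blast+

lemma separated_net_translate:
  assumes C: "separated_net G U C" and U: "U \<subseteq> carrier G" and s: "s \<in> carrier G"
  shows "separated_net G U (C #> s)"
proof -
  note CD = separated_netD[OF C]
  have "c = c'" if c: "c \<in> C #> s" "c' \<in> C #> s" "(U #> c) \<inter> (U #> c') \<noteq> {}" for c c'
  proof -
    from c(1,2) obtain b b' where b: "b \<in> C" "b' \<in> C" "c = b \<otimes> s" "c' = b' \<otimes> s"
      using CD(1) by (auto simp: in_rcos)
    from rcos_conflictE[OF U c(3)] obtain u u' where u: "u \<in> U" "u' \<in> U" "u \<otimes> c = u' \<otimes> c'" .
    have car: "u \<in> carrier G" "u' \<in> carrier G" "b \<in> carrier G" "b' \<in> carrier G"
      using u b U CD(1) by blast+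
    have "(u \<otimes> b) \<otimes> s = (u' \<otimes> b') \<otimes> s" using u(3) b(3,4) car s by (simp add: m_assoc)
    then have "u \<otimes> b = u' \<otimes> b'" using car s by (metis m_closed right_cancel)
    then have "b = b'" using CD(2)[OF b(1,2)] rcos_conflictI[OF u(1,2)] by blast
    then show ?thesis using b by simp
  qed
  moreover have "\<exists>c\<in>C #> s. (U #> g) \<inter> (U #> c) \<noteq> {}" if g: "g \<in> carrier G" for g
  proof -
    have gs: "g \<otimes> inv s \<in> carrier G" using g s by simp
    from CD(3)[OF gs] obtain c where c: "c \<in> C" "(U #> (g \<otimes> inv s)) \<inter> (U #> c) \<noteq> {}" by blast
    from rcos_conflictE[OF U c(2)] obtain u u' where
      u: "u \<in> U" "u' \<in> U" "u \<otimes> (g \<otimes> inv s) = u' \<otimes> c" .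
    have car: "u \<in> carrier G" "u' \<in> carrier G" "c \<in> carrier G" using u c U CD(1) by blast+
    have "u \<otimes> g = u \<otimes> (g \<otimes> inv s) \<otimes> s" using car g s by (simp add: m_assoc)
    also have "\<dots> = u' \<otimes> (c \<otimes> s)" unfolding u(3) using car s by (simp add: m_assoc)
    finally have "(U #> g) \<inter> (U #> (c \<otimes> s)) \<noteq> {}" using rcos_conflictI u by blast
    moreover have "c \<otimes> s \<in> C #> s" using c by (auto simp: r_coset_def)
    ultimately show ?thesis by blast
  qed
  moreover have "C #> s \<subseteq> carrier G" using CD(1) s by (simp add: r_coset_subset_G)
  ultimately show ?thesis unfolding separated_net_def by blast
qed

text \<open>The set is a projection of a compact set of pairs \<open>(C, z)\<close>, the net \<open>C\<close> being represented by its
  characteristic function. As \<open>U\<close> is finite, maximality of \<open>C\<close> concerns finitely many points of \<open>C\<close> for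
  each group element, so it is a closed condition.\<close>

lemma closed_net_patterned:
  assumes T: "T \<subseteq> colourings G m" "closed T" and U: "finite U" "U \<subseteq> carrier G"
  shows "closed {z \<in> T. \<exists>C. separated_net G U C \<and>
    (\<forall>c\<in>C. \<exists>a<m. \<forall>v\<in>V. z (v \<otimes> c) = (w v + a) mod m)}" (is "closed ?T'")
proof -
  let ?N = "\<lambda>g. {c \<in> carrier G. (U #> g) \<inter> (U #> c) \<noteq> {}}"
  have finN: "finite (?N g)" if g: "g \<in> carrier G" for g
  proof (rule finite_subset)
    show "?N g \<subseteq> (\<lambda>(u, u'). inv u' \<otimes> (u \<otimes> g)) ` (U \<times> U)"
    proof
      fix c assume "c \<in> ?N g"
      then have c: "c \<in> carrier G" "(U #> g) \<inter> (U #> c) \<noteq> {}" by auto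
      from rcos_conflictE[OF U(2) c(2)] obtain u u' where u: "u \<in> U" "u' \<in> U" "u \<otimes> g = u' \<otimes> c" .
      then have "c = inv u' \<otimes> (u \<otimes> g)" using U c g by (metis inv_solve_left m_closed subsetD)
      then show "c \<in> (\<lambda>(u, u'). inv u' \<otimes> (u \<otimes> g)) ` (U \<times> U)" using u by force
    qed
  qed (use U in auto)
  define Q :: "(('a \<Rightarrow> nat) \<times> ('a \<Rightarrow> nat)) set" where "Q = {p. (\<forall>c. c \<in> - carrier G \<longrightarrow> fst p c = 0) \<and>
    (\<forall>c c'. c \<noteq> c' \<and> (U #> c) \<inter> (U #> c') \<noteq> {} \<longrightarrow> fst p c = 0 \<or> fst p c' = 0) \<and>
    (\<forall>g. \<exists>c\<in>?N (if g \<in> carrier G then g else \<one>). fst p c = 1) \<and>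
    (\<forall>c. fst p c = 0 \<or> (\<exists>a\<in>{..<m}. \<forall>v. v \<in> V \<longrightarrow> snd p (v \<otimes> c) = (w v + a) mod m))}"
  have "closed Q"
    unfolding Q_def
    by (intro closed_Collect_conj closed_Collect_all closed_Collect_imp closed_Collect_disj
        closed_Collect_eq closed_Collect_finite_bex continuous_on_const continuous_on_eval_fst
        continuous_on_eval_snd finN finite_lessThan open_Collect_const) auto
  then have "compact (({z. \<forall>g. z g \<le> 1} \<times> T) \<inter> Q)"
    using compact_Times[OF compact_bounded_nat_functions compact_colourings[OF T(2,1)]]
    by (rule compact_Int_closed[rotated])
  then have "compact (snd ` (({z. \<forall>g. z g \<le> 1} \<times> T) \<inter> Q))"
    by (intro compact_continuous_image continuous_intros)
  moreover have "?T' = snd ` (({z. \<forall>g. z g \<le> 1} \<times> T) \<inter> Q)"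
  proof (intro equalityI subsetI)
    fix z assume "z \<in> ?T'"
    then obtain C where z: "z \<in> T" and C: "separated_net G U C"
      and pat: "\<And>c. c \<in> C \<Longrightarrow> \<exists>a<m. \<forall>v\<in>V. z (v \<otimes> c) = (w v + a) mod m" by blast
    note CD = separated_netD[OF C]
    let ?\<chi> = "\<lambda>c. if c \<in> C then 1 else 0 :: nat"
    have "(?\<chi>, z) \<in> Q"
      unfolding Q_def
    proof (intro CollectI conjI allI impI; (unfold fst_conv snd_conv)?)
      fix c assume "c \<in> - carrier G" then show "?\<chi> c = 0" using CD(1) by auto
    next
      fix c c' assume "c \<noteq> c' \<and> (U #> c) \<inter> (U #> c') \<noteq> {}"
      then have "c \<notin> C \<or> c' \<notin> C" using CD(2) by blast
      then show "?\<chi> c = 0 \<or> ?\<chi> c' = 0" by presburger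
    next
      fix g
      have "(if g \<in> carrier G then g else \<one>) \<in> carrier G" by simp
      from CD(3)[OF this] obtain c
        where "c \<in> C" "(U #> (if g \<in> carrier G then g else \<one>)) \<inter> (U #> c) \<noteq> {}" by blast
      then show "\<exists>c\<in>?N (if g \<in> carrier G then g else \<one>). ?\<chi> c = 1"
        using CD(1) by (intro bexI[of _ c]) auto
    next
      fix c show "?\<chi> c = 0 \<or> (\<exists>a\<in>{..<m}. \<forall>v. v \<in> V \<longrightarrow> z (v \<otimes> c) = (w v + a) mod m)"
        using pat[of c] by auto
    qed
    then have "(?\<chi>, z) \<in> ({z. \<forall>g. z g \<le> 1} \<times> T) \<inter> Q"
      using z by (intro IntI SigmaI CollectI allI) simp_all
    then show "z \<in> snd ` (({z. \<forall>g. z g \<le> 1} \<times> T) \<inter> Q)"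
      by (intro image_eqI[of z snd "(?\<chi>, z)"]) simp_all
  next
    fix z assume "z \<in> snd ` (({z. \<forall>g. z g \<le> 1} \<times> T) \<inter> Q)"
    then obtain p where "z = snd p" "p \<in> ({z. \<forall>g. z g \<le> 1} \<times> T) \<inter> Q" by (rule imageE)
    then have z: "z \<in> T" and "(fst p, z) \<in> Q" by (simp_all add: mem_Times_iff)
    then obtain \<tau> where Q: "(\<tau>, z) \<in> Q" by blast
    let ?C = "{c. \<tau> c \<noteq> 0}"
    have Q1: "\<And>c. c \<in> - carrier G \<Longrightarrow> \<tau> c = 0"
      and Q2: "\<And>c c'. c \<noteq> c' \<Longrightarrow> (U #> c) \<inter> (U #> c') \<noteq> {} \<Longrightarrow> \<tau> c = 0 \<or> \<tau> c' = 0"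
      and Q3': "\<And>g. \<exists>c\<in>?N (if g \<in> carrier G then g else \<one>). \<tau> c = 1"
      and Q4: "\<And>c. \<tau> c = 0 \<or> (\<exists>a\<in>{..<m}. \<forall>v. v \<in> V \<longrightarrow> z (v \<otimes> c) = (w v + a) mod m)"
      using Q unfolding Q_def by simp_all
    have Q3: "\<exists>c\<in>?N g. \<tau> c = 1" if "g \<in> carrier G" for g using Q3'[of g] that by simp
    have "separated_net G U ?C"
      unfolding separated_net_def
    proof (intro conjI ballI impI)
      show "?C \<subseteq> carrier G"
      proof
        fix c assume "c \<in> ?C"
        then show "c \<in> carrier G" using Q1[of c] by (cases "c \<in> carrier G") simp_all
      qed
      show "c = c'" if "c \<in> ?C" "c' \<in> ?C" "(U #> c) \<inter> (U #> c') \<noteq> {}" for c c'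
        using Q2[OF _ that(3)] that(1,2) by (cases "c = c'") simp_all
      show "\<exists>c\<in>?C. (U #> g) \<inter> (U #> c) \<noteq> {}" if "g \<in> carrier G" for g
        using Q3[OF that] by (metis (mono_tags, lifting) mem_Collect_eq zero_neq_one)
    qed
    moreover have "\<forall>c\<in>?C. \<exists>a<m. \<forall>v\<in>V. z (v \<otimes> c) = (w v + a) mod m"
    proof
      fix c assume "c \<in> ?C"
      then show "\<exists>a<m. \<forall>v\<in>V. z (v \<otimes> c) = (w v + a) mod m" using Q4[of c] by auto
    qed
    ultimately show "z \<in> ?T'" using z by blast
  qed
  ultimately show ?thesis using compact_functions_imp_closed by simp
qed

text \<open>The elements of \<open>T'\<close> carry a fixed universal word of \<open>T\<close>, up to rotation, at all points of some
  separated net, so that every pattern of \<open>T\<close> on \<open>F\<close> occurs in each of them. The universal word may be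
  rotated since the set of patterns is invariant under rotation. To glue two elements of \<open>T'\<close>, keep the
  points of their nets near the two given sets, extend them to a net, and write the word
  at all the new points.\<close>

lemma refine_flexible_subshift:
  assumes T: "flexible_subshift G m T" and inf: "infinite (carrier G)" and m: "0 < m"
    and F: "finite F" "F \<subseteq> carrier G"
  obtains T' where "T' \<subseteq> T" "flexible_subshift G m T'"
    "\<And>z x. z \<in> T' \<Longrightarrow> x \<in> T \<Longrightarrow> \<exists>h\<in>carrier G. \<forall>f\<in>F. z (f \<otimes> h) = x f"
proof -
  note TD = flexible_subshiftD[OF T]
  obtain D where D: "gluing_window G D T" using T unfolding flexible_subshift_def by blast
  note DD = gluing_windowD[OF D]
  obtain w V where w: "w \<in> T" and V: "finite V" "V \<subseteq> carrier G" "V \<noteq> {}"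
    and wV: "\<And>x. x \<in> T \<Longrightarrow> \<exists>g\<in>carrier G. \<forall>f\<in>F. f \<otimes> g \<in> V \<and> w (f \<otimes> g) = x f"
    using universal_word[OF T inf F] by metis
  have Tlt: "z g < m" if "z \<in> T" "g \<in> carrier G" for z g
    using that TD(1) unfolding colourings_def by blast
  define U where "U = D <#> V"
  have UI: "d \<otimes> v \<in> U" if "d \<in> D" "v \<in> V" for d v
    using that by (auto simp: U_def set_mult_def)
  have U: "finite U" "U \<subseteq> carrier G" "U \<noteq> {}"
  proof -
    have "U = (\<lambda>(d, v). d \<otimes> v) ` (D \<times> V)" by (auto simp: U_def set_mult_def)
    then show "finite U" using DD V by simp
    show "U \<subseteq> carrier G" unfolding U_def using DD V by (intro set_mult_closed) simp_all
    show "U \<noteq> {}" using UI DD V by blast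
  qed
  \<comment> \<open>A point \<open>c\<close> with \<open>U c\<close> meeting \<open>D E\<close> has a neighbour \<open>c'\<close> in any given net, meaning that \<open>U c\<close> meets
      \<open>U c'\<close>; then \<open>c' \<in> K E\<close>. So the points of a net near \<open>E\<close>, those in \<open>K E\<close>, rule out \<open>c\<close>.\<close>
  define K where "K = (\<lambda>(u1, u2, u3, d). inv u1 \<otimes> (u2 \<otimes> (inv u3 \<otimes> d))) ` (U \<times> U \<times> U \<times> D)"
  have K: "finite K" "K \<subseteq> carrier G"
    unfolding K_def using U DD by (auto simp: subset_iff)
  define D' where "D' = D \<union> (U <#> K)"
  have D': "finite D'" "D' \<subseteq> carrier G" "\<one> \<in> D'"
  proof -
    have "U <#> K = (\<lambda>(d, v). d \<otimes> v) ` (U \<times> K)" by (auto simp: set_mult_def)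
    then show "finite D'" unfolding D'_def using DD U K by simp
    show "D' \<subseteq> carrier G" unfolding D'_def
      using DD U K by (intro Un_least set_mult_closed) simp_all
    show "\<one> \<in> D'" using DD by (simp add: D'_def)
  qed
  \<comment> \<open>An element of \<open>T'\<close> is kept on the core: on \<open>E\<close> and on the copies of the word at the points of its
      net near \<open>E\<close>.\<close>
  define near where "near C E = {c \<in> C. \<exists>k\<in>K. \<exists>e\<in>E. c = k \<otimes> e}" for C E
  define core where "core C E = E \<union> (V <#> near C E)" for C E
  have near_far: "u \<otimes> c \<in> D' <#> E"
    if "u \<in> U" "c \<in> near C E" "E \<subseteq> carrier G" for u c C E
  proof -
    from that(2) obtain k e where k: "k \<in> K" "e \<in> E" "c = k \<otimes> e" unfolding near_def by blast
    have "u \<in> carrier G" "k \<in> carrier G" "e \<in> carrier G" using that k U K by blast+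
    then have "u \<otimes> c = (u \<otimes> k) \<otimes> e" unfolding k by (simp add: m_assoc)
    moreover have "u \<otimes> k \<in> D'" using that(1) k(1) by (auto simp: D'_def set_mult_def)
    ultimately show ?thesis using k(2) by (auto simp: set_mult_def)
  qed
  have core_far: "d \<otimes> e \<in> D' <#> E"
    if "d \<in> D" "e \<in> core C E" "E \<subseteq> carrier G" "C \<subseteq> carrier G" for d e C E
  proof (cases "e \<in> E")
    case True
    then show ?thesis using that(1) by (auto simp: set_mult_def D'_def)
  next
    case False
    with that(2) obtain v c where v: "v \<in> V" "c \<in> near C E" "e = v \<otimes> c"
      by (auto simp: core_def set_mult_def)
    have "d \<in> carrier G" "v \<in> carrier G" "c \<in> carrier G"
      using that v DD V unfolding near_def by blast+
    then have "d \<otimes> e = (d \<otimes> v) \<otimes> c" unfolding v by (simp add: m_assoc)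
    then show ?thesis using near_far[OF UI[OF that(1) v(1)] v(2) that(3)] by simp
  qed
  have conflict_near: "\<exists>c'\<in>near C E. (U #> c) \<inter> (U #> c') \<noteq> {}"
    if C: "separated_net G U C" and E: "E \<subseteq> carrier G" and c: "c \<in> carrier G"
      and de: "u \<in> U" "d \<in> D" "e \<in> E" "u \<otimes> c = d \<otimes> e" for C E c u d e
  proof -
    from separated_netD(3)[OF C c] obtain c' where c': "c' \<in> C" "(U #> c) \<inter> (U #> c') \<noteq> {}" by blast
    from rcos_conflictE[OF U(2) c'(2)] obtain u1 u2 where
      u: "u1 \<in> U" "u2 \<in> U" "u1 \<otimes> c = u2 \<otimes> c'" .
    have car: "u \<in> carrier G" "u1 \<in> carrier G" "u2 \<in> carrier G" "d \<in> carrier G" "e \<in> carrier G"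
      "c' \<in> carrier G"
      using U(2) u de DD(2) E separated_netD(1)[OF C] c' by blast+
    have "c = inv u \<otimes> (d \<otimes> e)" using de(4) car c by (metis inv_solve_left m_closed)
    moreover have "c' = inv u2 \<otimes> (u1 \<otimes> c)" using u(3) car c by (metis inv_solve_left m_closed)
    ultimately have "c' = (inv u2 \<otimes> (u1 \<otimes> (inv u \<otimes> d))) \<otimes> e"
      using car by (simp add: m_assoc)
    moreover have "inv u2 \<otimes> (u1 \<otimes> (inv u \<otimes> d)) \<in> K"
      unfolding K_def using u de by (intro image_eqI[of _ _ "(u2, u1, u, d)"]) simp_all
    ultimately have "c' \<in> near C E" unfolding near_def using c'(1) de(3) by blast
    then show ?thesis using c'(2) by blast
  qed
  define patterned where "patterned z c \<longleftrightarrow> (\<exists>a<m. \<forall>v\<in>V. z (v \<otimes> c) = (w v + a) mod m)" for z c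
  define T' where "T' = {z \<in> T. \<exists>C. separated_net G U C \<and> (\<forall>c\<in>C. patterned z c)}"
  have T'I: "z \<in> T'" if "z \<in> T" "separated_net G U C" "\<And>c. c \<in> C \<Longrightarrow> patterned z c" for z C
    using that unfolding T'_def by blast
  have patterned_word: "patterned z c" if "\<And>v. v \<in> V \<Longrightarrow> z (v \<otimes> c) = w v" for z c
  proof -
    have "z (v \<otimes> c) = (w v + 0) mod m" if v: "v \<in> V" for v
      using Tlt[OF w, of v] V(2) v \<open>\<And>v. v \<in> V \<Longrightarrow> z (v \<otimes> c) = w v\<close>[OF v] by auto
    then show ?thesis unfolding patterned_def using m by blast
  qed

  have "T' \<noteq> {}"
  proof -
    obtain C where C: "separated_net G U C"
      using extend_to_separated_net[OF U(2,3), of "{}"] by blast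
    obtain z where "z \<in> T" "\<And>c v. c \<in> C \<Longrightarrow> v \<in> V \<Longrightarrow> z (v \<otimes> c) = w v"
    proof (rule fill_with_word[OF T D w V(2) w empty_subsetI separated_netD(1)[OF C]])
      show "\<And>c c'. c \<in> C \<Longrightarrow> c' \<in> C \<Longrightarrow> ((D <#> V) #> c) \<inter> ((D <#> V) #> c') \<noteq> {} \<Longrightarrow> c = c'"
        using separated_netD(2)[OF C] unfolding U_def by blast
      show "\<And>c. c \<in> C \<Longrightarrow> (D <#> V #> c) \<inter> (D <#> {}) = {}" by (auto simp: set_mult_def)
    qed blast
    then show ?thesis using T'I[OF _ C] patterned_word by blast
  qed
  moreover have "closed T'"
    unfolding T'_def patterned_def by (rule closed_net_patterned[OF TD(1,3) U(1,2)])
  moreover have "shift_colouring G s z \<in> T'" if z: "z \<in> T'" and s: "s \<in> carrier G" for z s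
  proof -
    from z obtain C where zT: "z \<in> T" and C: "separated_net G U C"
      and pat: "\<And>c. c \<in> C \<Longrightarrow> patterned z c" unfolding T'_def by blast
    have "patterned (shift_colouring G s z) b" if b: "b \<in> C #> inv s" for b
    proof -
      from b obtain c where c: "c \<in> C" "b = c \<otimes> inv s" by (auto simp: r_coset_def)
      have cc: "c \<in> carrier G" using separated_netD(1)[OF C] c by blast
      have "shift_colouring G s z (v \<otimes> b) = z (v \<otimes> c)" if "v \<in> V" for v
      proof -
        have "v \<in> carrier G" using that V by blast
        then show ?thesis using s cc unfolding c by (simp add: shift_colouring_def m_assoc)
      qed
      then show ?thesis using pat[OF c(1)] unfolding patterned_def by simp
    qed
    then show ?thesis
      using T'I[OF TD(5)[OF zT s] separated_net_translate[OF C U(2), of "inv s"]] s by blast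
  qed
  moreover have "rotate_colours G m b z \<in> T'" if z: "z \<in> T'" for z b
  proof -
    from z obtain C where zT: "z \<in> T" and C: "separated_net G U C"
      and pat: "\<And>c. c \<in> C \<Longrightarrow> patterned z c" unfolding T'_def by blast
    have "patterned (rotate_colours G m b z) c" if c: "c \<in> C" for c
    proof -
      from pat[OF c] obtain a where a: "\<And>v. v \<in> V \<Longrightarrow> z (v \<otimes> c) = (w v + a) mod m"
        unfolding patterned_def by blast
      have "rotate_colours G m b z (v \<otimes> c) = (w v + (a + b) mod m) mod m" if v: "v \<in> V" for v
      proof -
        have "v \<otimes> c \<in> carrier G" using v V(2) c separated_netD(1)[OF C] by blast
        then show ?thesis using a[OF v] by (simp add: rotate_colours_def mod_simps add.assoc)
      qed
      then show ?thesis unfolding patterned_def using m by (intro exI[of _ "(a + b) mod m"]) simp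
    qed
    then show ?thesis using T'I[OF TD(6)[OF zT] C] by blast
  qed
  moreover have "gluing_window G D' T'"
    unfolding gluing_window_def
  proof (intro conjI ballI allI impI)
    fix x y E E' assume x: "x \<in> T'" and y: "y \<in> T'"
      and "E \<subseteq> carrier G \<and> E' \<subseteq> carrier G \<and> (D' <#> E) \<inter> (D' <#> E') = {}"
    then have E: "E \<subseteq> carrier G" "E' \<subseteq> carrier G" and disj: "(D' <#> E) \<inter> (D' <#> E') = {}" by simp_all
    from x obtain C where xT: "x \<in> T" and C: "separated_net G U C"
      and xpat: "\<And>c. c \<in> C \<Longrightarrow> patterned x c" unfolding T'_def by blast
    from y obtain C' where yT: "y \<in> T" and C': "separated_net G U C'"
      and ypat: "\<And>c. c \<in> C' \<Longrightarrow> patterned y c" unfolding T'_def by blast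
    note CC = separated_netD(1)[OF C] separated_netD(1)[OF C']
    have nearC: "near C E \<subseteq> C" "near C' E' \<subseteq> C'" by (auto simp: near_def)
    have core_sub: "core C E \<subseteq> carrier G" "core C' E' \<subseteq> carrier G"
      unfolding core_def using E V(2) nearC CC
      by (meson Un_least set_mult_closed order_trans)+
    obtain z0 where z0: "z0 \<in> T" "\<And>g. g \<in> core C E \<Longrightarrow> z0 g = x g"
      "\<And>g. g \<in> core C' E' \<Longrightarrow> z0 g = y g"
    proof (rule gluing[OF D xT yT core_sub])
      fix d d' e e' assume "d \<in> D" "d' \<in> D" "e \<in> core C E" "e' \<in> core C' E'"
      then have "d \<otimes> e \<in> D' <#> E" "d' \<otimes> e' \<in> D' <#> E'"
        using core_far E CC by blast+
      then show "d \<otimes> e \<noteq> d' \<otimes> e'" using disj by (metis disjoint_iff)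
    qed blast
    have cross: "(U #> c) \<inter> (U #> c') = {}" if "c \<in> near C E" "c' \<in> near C' E'" for c c'
    proof (rule ccontr)
      assume ne: "\<not> ?thesis"
      from rcos_conflictE[OF U(2) ne] obtain u u' where "u \<in> U" "u' \<in> U" "u \<otimes> c = u' \<otimes> c'" .
      then show False using near_far[of u c C E] near_far[of u' c' C' E'] that E disj
        by (metis disjoint_iff)
    qed
    obtain B where B: "near C E \<union> near C' E' \<subseteq> B" "separated_net G U B"
    proof (rule extend_to_separated_net[OF U(2,3)])
      show "near C E \<union> near C' E' \<subseteq> carrier G" using nearC CC by blast
      fix c c' assume c: "c \<in> near C E \<union> near C' E'" "c' \<in> near C E \<union> near C' E'"
        and ne: "(U #> c) \<inter> (U #> c') \<noteq> {}"
      consider "c \<in> near C E" "c' \<in> near C E" | "c \<in> near C' E'" "c' \<in> near C' E'"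
        | "c \<in> near C E" "c' \<in> near C' E'" | "c' \<in> near C E" "c \<in> near C' E'" using c by blast
      then show "c = c'"
      proof cases
        case 1 then show ?thesis using separated_netD(2)[OF C _ _ ne] nearC by blast
      next
        case 2 then show ?thesis using separated_netD(2)[OF C' _ _ ne] nearC by blast
      next
        case 3 then show ?thesis using cross[OF 3] ne by blast
      next
        case 4 then show ?thesis using cross[OF 4] ne by blast
      qed
    qed blast
    note BD = separated_netD[OF B(2)]
    \<comment> \<open>The new points of the net, where the word is written.\<close>
    define R where "R = B - (near C E \<union> near C' E')"
    \<comment> \<open>The copies of the word at new points are far from both cores. They are far from the old copies because
        \<open>B\<close> is separated, and from \<open>E\<close> and \<open>E'\<close> by \<open>conflict_near\<close>.\<close>
    have far_half: "u \<otimes> c \<noteq> d \<otimes> e"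
      if c: "c \<in> B" "c \<notin> near A H" and A: "separated_net G U A" "near A H \<subseteq> B" "H \<subseteq> carrier G"
        and de: "u \<in> U" "d \<in> D" "e \<in> core A H" for c A H u d e
    proof
      assume eq: "u \<otimes> c = d \<otimes> e"
      have cc: "c \<in> carrier G" using c BD(1) by blast
      have "\<exists>c'\<in>near A H. (U #> c) \<inter> (U #> c') \<noteq> {}"
      proof (cases "e \<in> H")
        case True
        then show ?thesis using conflict_near[OF A(1,3) cc de(1,2) _ eq] by blast
      next
        case False
        with de(3) obtain v c' where v: "v \<in> V" "c' \<in> near A H" "e = v \<otimes> c'"
          by (auto simp: core_def set_mult_def)
        have "d \<in> carrier G" "v \<in> carrier G" "c' \<in> carrier G"
          using de(2) DD(2) v V(2) A(2) BD(1) by blast+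
        then have "u \<otimes> c = (d \<otimes> v) \<otimes> c'" using eq unfolding v by (simp add: m_assoc)
        then show ?thesis using rcos_conflictI[OF de(1) UI[OF de(2) v(1)]] v(2) by blast
      qed
      then obtain c' where c': "c' \<in> near A H" "(U #> c) \<inter> (U #> c') \<noteq> {}" by blast
      then have "c = c'" using BD(2)[OF c(1) _ c'(2)] A(2) by blast
      then show False using c(2) c'(1) by blast
    qed
    obtain z where z: "z \<in> T" "\<And>g. g \<in> core C E \<union> core C' E' \<Longrightarrow> z g = z0 g"
      "\<And>c v. c \<in> R \<Longrightarrow> v \<in> V \<Longrightarrow> z (v \<otimes> c) = w v"
    proof (rule fill_with_word[OF T D w V(2) z0(1)])
      show "core C E \<union> core C' E' \<subseteq> carrier G" using core_sub by blast
      show "R \<subseteq> carrier G" unfolding R_def using BD(1) by blast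
      show "c = c'" if "c \<in> R" "c' \<in> R" "((D <#> V) #> c) \<inter> ((D <#> V) #> c') \<noteq> {}" for c c'
        using BD(2)[of c c'] that unfolding R_def U_def by blast
      fix c assume c: "c \<in> R"
      show "(D <#> V #> c) \<inter> (D <#> (core C E \<union> core C' E')) = {}"
      proof (rule ccontr)
        assume "\<not> ?thesis"
        then obtain h where h: "h \<in> U #> c" "h \<in> D <#> (core C E \<union> core C' E')"
          unfolding U_def by blast
        from h(1) U(2) obtain u where u: "u \<in> U" "h = u \<otimes> c" by (auto simp: in_rcos)
        from h(2) obtain d e where d: "d \<in> D" "e \<in> core C E \<union> core C' E'" "h = d \<otimes> e"
          by (auto simp: set_mult_def)
        have eq: "u \<otimes> c = d \<otimes> e" using u d by simp
        have cB: "c \<in> B" "c \<notin> near C E" "c \<notin> near C' E'" using c unfolding R_def by blast+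
        have nB: "near C E \<subseteq> B" "near C' E' \<subseteq> B" using B by blast+
        from d(2) show False
        proof
          assume "e \<in> core C E"
          from far_half[OF cB(1,2) C nB(1) E(1) u(1) d(1) this] eq show False by blast
        next
          assume "e \<in> core C' E'"
          from far_half[OF cB(1,3) C' nB(2) E(2) u(1) d(1) this] eq show False by blast
        qed
      qed
    qed blast
    have "patterned z c" if c: "c \<in> B" for c
    proof -
      consider "c \<in> near C E" | "c \<in> near C' E'" | "c \<in> R" using c unfolding R_def by blast
      then show ?thesis
      proof cases
        case 1
        have "z (v \<otimes> c) = x (v \<otimes> c)" if "v \<in> V" for v
        proof -
          have "v \<otimes> c \<in> core C E" using 1 that by (auto simp: core_def set_mult_def)
          then show ?thesis using z(2) z0(2) by simp
        qed
        moreover have "patterned x c" using xpat 1 nearC by blast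
        ultimately show ?thesis unfolding patterned_def by simp
      next
        case 2
        have "z (v \<otimes> c) = y (v \<otimes> c)" if "v \<in> V" for v
        proof -
          have "v \<otimes> c \<in> core C' E'" using 2 that by (auto simp: core_def set_mult_def)
          then show ?thesis using z(2) z0(3) by simp
        qed
        moreover have "patterned y c" using ypat 2 nearC by blast
        ultimately show ?thesis unfolding patterned_def by simp
      next
        case 3
        then show ?thesis using patterned_word z(3) by blast
      qed
    qed
    then have "z \<in> T'" using T'I[OF z(1) B(2)] by blast
    moreover have "z g = x g" if "g \<in> E" for g
      using that z(2)[of g] z0(2)[of g] by (simp add: core_def)
    moreover have "z g = y g" if "g \<in> E'" for g
      using that z(2)[of g] z0(3)[of g] by (simp add: core_def)
    ultimately show "\<exists>z\<in>T'. (\<forall>g\<in>E. z g = x g) \<and> (\<forall>g\<in>E'. z g = y g)" by blast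
  qed (use D' in simp_all)
  moreover have sub: "T' \<subseteq> T" unfolding T'_def by blast
  ultimately have "flexible_subshift G m T'"
    unfolding flexible_subshift_def using TD(1) by blast
  moreover have "\<exists>h\<in>carrier G. \<forall>f\<in>F. z (f \<otimes> h) = x f" if z: "z \<in> T'" and x: "x \<in> T" for z x
  proof -
    from z obtain C where zT: "z \<in> T" and C: "separated_net G U C"
      and pat: "\<And>c. c \<in> C \<Longrightarrow> patterned z c" unfolding T'_def by blast
    obtain c where c: "c \<in> C" using separated_netD(3)[OF C one_closed] by blast
    then have cc: "c \<in> carrier G" using separated_netD(1)[OF C] by blast
    from pat[OF c] obtain a where a: "a < m" "\<And>v. v \<in> V \<Longrightarrow> z (v \<otimes> c) = (w v + a) mod m"
      unfolding patterned_def by blast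
    \<comment> \<open>The pattern is sought in the word after the inverse rotation, which compensates for the rotation by
        \<open>a\<close> of the copy of the word at \<open>c\<close>.\<close>
    from wV[OF TD(6)[OF x, of "m - a"]] obtain g where g: "g \<in> carrier G"
      "\<And>f. f \<in> F \<Longrightarrow> f \<otimes> g \<in> V \<and> w (f \<otimes> g) = rotate_colours G m (m - a) x f" by blast
    have "z (f \<otimes> (g \<otimes> c)) = x f" if f: "f \<in> F" for f
    proof -
      have fc: "f \<in> carrier G" using f F by blast
      have "z (f \<otimes> (g \<otimes> c)) = z (f \<otimes> g \<otimes> c)" using fc g cc by (simp add: m_assoc)
      also have "\<dots> = (w (f \<otimes> g) + a) mod m" using a(2) g(2)[OF f] by blast
      also have "\<dots> = ((x f + (m - a)) mod m + a) mod m"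
        using g(2)[OF f] fc by (simp add: rotate_colours_def)
      also have "\<dots> = (x f + m) mod m" using a(1) by (simp add: mod_simps)
      also have "\<dots> = x f" using Tlt[OF x fc] by simp
      finally show ?thesis .
    qed
    then show ?thesis using g(1) cc by (intro bexI[of _ "g \<otimes> c"]) simp_all
  qed
  ultimately show ?thesis using that sub by blast
qed

lemma flexible_full_shift:
  assumes "0 < m"
  shows "flexible_subshift G m (colourings G m)"
proof -
  have "closed (colourings G m)"
  proof -
    have "colourings G m = {z. (\<forall>g\<in>carrier G. \<exists>k\<in>{..<m}. z g = k) \<and> (\<forall>g. g \<notin> carrier G \<longrightarrow> z g = 0)}"
      by (simp add: colourings_def)
    also have "closed \<dots>"
      unfolding Ball_def
      by (intro closed_Collect_conj closed_Collect_all closed_Collect_imp open_Collect_const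
          closed_Collect_eq closed_Collect_finite_bex continuous_on_const
          continuous_on_product_coordinates) simp_all
    finally show ?thesis .
  qed
  moreover have "(\<lambda>_. 0) \<in> colourings G m" using assms by (simp add: colourings_def)
  then have "colourings G m \<noteq> {}" by blast
  moreover have "gluing_window G {\<one>} (colourings G m)"
    unfolding gluing_window_def
  proof (intro conjI ballI allI impI)
    fix x y E E' assume x: "x \<in> colourings G m" and y: "y \<in> colourings G m"
      and "E \<subseteq> carrier G \<and> E' \<subseteq> carrier G \<and> ({\<one>} <#> E) \<inter> ({\<one>} <#> E') = {}"
    then have E: "E \<subseteq> carrier G" "E' \<subseteq> carrier G" and disj: "({\<one>} <#> E) \<inter> ({\<one>} <#> E') = {}"
      by blast+
    have "h \<in> {\<one>} <#> H" if "h \<in> H" "H \<subseteq> carrier G" for h H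
      using that l_one[of h] unfolding set_mult_def by force
    then have "g \<in> {\<one>} <#> E \<and> g \<in> {\<one>} <#> E'" if "g \<in> E" "g \<in> E'" for g
      using that E by simp
    then have dj: "E \<inter> E' = {}" using disj by (metis disjoint_iff)
    define z where "z g = (if g \<in> E then x g else y g)" for g
    have "z \<in> colourings G m"
      using x y by (simp add: z_def colourings_def)
    moreover have "\<forall>g\<in>E. z g = x g" by (simp add: z_def)
    moreover have "\<forall>g\<in>E'. z g = y g"
    proof
      fix g assume "g \<in> E'"
      then have "g \<notin> E" using dj by blast
      then show "z g = y g" by (simp add: z_def)
    qed
    ultimately show "\<exists>z\<in>colourings G m. (\<forall>g\<in>E. z g = x g) \<and> (\<forall>g\<in>E'. z g = y g)" by blast
  qed simp_all
  moreover have "rotate_colours G m a z \<in> colourings G m" if "z \<in> colourings G m" for a z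
    using assms by (simp add: rotate_colours_def colourings_def)
  ultimately show ?thesis
    unfolding flexible_subshift_def using shift_colouring_mem by blast
qed

text \<open>The intersection of a decreasing sequence of refinements, along finite windows that exhaust the
  group. A pattern of an element of the intersection occurs in all elements of the next stage.\<close>

lemma rotation_invariant_minimal_subshift:
  assumes cnt: "countable (carrier G)" and inf: "infinite (carrier G)" and m: "0 < m"
  obtains T where "T \<subseteq> colourings G m" "T \<noteq> {}" "compact T"
    "\<And>z s. z \<in> T \<Longrightarrow> s \<in> carrier G \<Longrightarrow> shift_colouring G s z \<in> T"
    "\<And>z a. z \<in> T \<Longrightarrow> rotate_colours G m a z \<in> T"
    "\<And>z x F. z \<in> T \<Longrightarrow> x \<in> T \<Longrightarrow> finite F \<Longrightarrow> F \<subseteq> carrier G \<Longrightarrow>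
      \<exists>h\<in>carrier G. \<forall>f\<in>F. z (f \<otimes> h) = x f"
proof -
  define F where "F n = from_nat_into (carrier G) ` {..n}" for n :: nat
  have ne: "carrier G \<noteq> {}" using one_closed by blast
  have F: "finite (F n)" "F n \<subseteq> carrier G" for n
    using from_nat_into[OF ne] by (auto simp: F_def)
  have "\<exists>f. \<forall>n. flexible_subshift G m (f n) \<and> (f (Suc n) \<subseteq> f n \<and>
      (\<forall>z\<in>f (Suc n). \<forall>x\<in>f n. \<exists>h\<in>carrier G. \<forall>k\<in>F n. z (k \<otimes> h) = x k))"
  proof (rule dependent_nat_choice)
    show "\<exists>T. flexible_subshift G m T" using flexible_full_shift[OF m] by blast
    fix T n assume "flexible_subshift G m T"
    from refine_flexible_subshift[OF this inf m F(1,2)[of n]] obtain T' where T': "T' \<subseteq> T"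
      "flexible_subshift G m T'"
      "\<And>z x. z \<in> T' \<Longrightarrow> x \<in> T \<Longrightarrow> \<exists>h\<in>carrier G. \<forall>f\<in>F n. z (f \<otimes> h) = x f" by blast
    show "\<exists>T'. flexible_subshift G m T' \<and> (T' \<subseteq> T \<and>
      (\<forall>z\<in>T'. \<forall>x\<in>T. \<exists>h\<in>carrier G. \<forall>k\<in>F n. z (k \<otimes> h) = x k))"
      using T' by (intro exI[of _ T'] conjI ballI)
  qed
  then obtain T where T: "\<And>n. flexible_subshift G m (T n)" "\<And>n. T (Suc n) \<subseteq> T n"
    "\<And>n z x. z \<in> T (Suc n) \<Longrightarrow> x \<in> T n \<Longrightarrow> \<exists>h\<in>carrier G. \<forall>k\<in>F n. z (k \<otimes> h) = x k"
    by (elim exE) (metis (no_types, lifting))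
  note TD = flexible_subshiftD[OF T(1)]
  have anti: "T n \<subseteq> T k" if "k \<le> n" for k n
    by (rule lift_Suc_antimono_le[of T]) (use T(2) that in blast)+
  let ?S = "\<Inter>n. T n"
  have "T 0 \<inter> ?S \<noteq> {}"
  proof (rule compact_imp_fip_image)
    show "compact (T 0)" by (rule TD(4))
    show "closed (T n)" for n by (rule TD(3))
    fix I' :: "nat set" assume "finite I'" "I' \<subseteq> UNIV"
    then obtain n where "\<forall>k\<in>I'. k \<le> n" using finite_nat_set_iff_bounded_le[of I'] by blast
    then have "T n \<subseteq> T 0 \<inter> (\<Inter>k\<in>I'. T k)" by (intro Int_greatest INT_greatest anti) simp_all
    then show "T 0 \<inter> (\<Inter>k\<in>I'. T k) \<noteq> {}" using TD(2)[of n] by blast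
  qed
  then have neS: "?S \<noteq> {}" by blast
  have cS: "compact ?S"
  proof -
    have "closed ?S" using TD(3) by blast
    moreover have "?S \<subseteq> colourings G m" using TD(1)[of 0] by blast
    ultimately show ?thesis by (rule compact_colourings)
  qed
  have minS: "\<exists>h\<in>carrier G. \<forall>f\<in>A. z (f \<otimes> h) = x f"
    if zx: "z \<in> ?S" "x \<in> ?S" and A: "finite A" "A \<subseteq> carrier G" for z x A
  proof -
    obtain n where n: "A \<subseteq> F n"
    proof -
      have "\<forall>a\<in>A. \<exists>k. from_nat_into (carrier G) k = a"
        using A(2) from_nat_into_surj[OF cnt] by blast
      then obtain c where c: "\<And>a. a \<in> A \<Longrightarrow> from_nat_into (carrier G) (c a) = a" by metis
      have "A \<subseteq> F (Max (c ` A))"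
      proof
        fix a assume a: "a \<in> A"
        then have "c a \<le> Max (c ` A)" using A(1) by simp
        then show "a \<in> F (Max (c ` A))" using c[OF a] unfolding F_def by (metis atMost_iff imageI)
      qed
      then show ?thesis using that by blast
    qed
    have "z \<in> T (Suc n)" "x \<in> T n" using zx by blast+
    from T(3)[OF this] show ?thesis using n by blast
  qed
  show ?thesis
  proof (rule that[OF _ neS cS])
    show "?S \<subseteq> colourings G m" using TD(1)[of 0] by blast
    show "shift_colouring G s z \<in> ?S" if "z \<in> ?S" "s \<in> carrier G" for z s
      using TD(5) that by blast
    show "rotate_colours G m a z \<in> ?S" if "z \<in> ?S" for z a
      using TD(6) that by blast
  qed (rule minS)
qed

lemma group_actionI:
  assumes "\<And>s x. s \<in> carrier G \<Longrightarrow> x \<in> E \<Longrightarrow> \<phi> s x \<in> E"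
    and "\<And>s x. s \<in> carrier G \<Longrightarrow> x \<notin> E \<Longrightarrow> \<phi> s x = undefined"
    and "\<And>x. x \<in> E \<Longrightarrow> \<phi> \<one> x = x"
    and "\<And>s t x. s \<in> carrier G \<Longrightarrow> t \<in> carrier G \<Longrightarrow> x \<in> E \<Longrightarrow> \<phi> (s \<otimes> t) x = \<phi> s (\<phi> t x)"
  shows "group_action G E \<phi>"
proof -
  have bij: "\<phi> s \<in> Bij E" if s: "s \<in> carrier G" for s
  proof -
    have "bij_betw (\<phi> s) E E"
    proof (rule bij_betw_byWitness[where f' = "\<phi> (inv s)"])
      show "\<forall>a\<in>E. \<phi> (inv s) (\<phi> s a) = a"
        using assms(3) assms(4)[of "inv s" s] s by simp
      show "\<forall>a\<in>E. \<phi> s (\<phi> (inv s) a) = a"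
        using assms(3) assms(4)[of s "inv s"] s by simp
    qed (use assms(1) s in auto)
    moreover have "\<phi> s \<in> extensional E" using assms(2) s by (simp add: extensional_def)
    ultimately show ?thesis by (simp add: Bij_def)
  qed
  have "\<phi> \<in> hom G (BijGroup E)"
  proof (rule homI)
    show "\<phi> s \<in> carrier (BijGroup E)" if "s \<in> carrier G" for s
      using bij that by (simp add: BijGroup_def)
    show "\<phi> (s \<otimes> t) = \<phi> s \<otimes>\<^bsub>BijGroup E\<^esub> \<phi> t" if st: "s \<in> carrier G" "t \<in> carrier G" for s t
    proof -
      have "\<phi> (s \<otimes> t) = compose E (\<phi> s) (\<phi> t)"
        using assms(2,4) st by (intro ext) (simp add: compose_def)
      then show ?thesis using bij st by (simp add: BijGroup_def)
    qed
  qed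
  then show ?thesis
    unfolding group_action_def group_hom_def group_hom_axioms_def
    using group_BijGroup is_group by blast
qed

text \<open>The points \<open>c a\<close> are the rotations of one element of the subshift, and \<open>col\<close> is the colour at the
  identity. Universality of a minimal space concerns spaces of families of subsets of the
  group, so colourings are coded as such families.\<close>

lemma minimal_space_with_separated_points:
  assumes cnt: "countable (carrier G)" and inf: "infinite (carrier G)" and m: "0 < m"
  obtains Z :: "('a, 'a set set) gspace" and col :: "'a set set \<Rightarrow> nat" and c :: "nat \<Rightarrow> 'a set set"
  where "minimal_gamma_space G Z" "continuous_map (gtop Z) euclidean col"
    "\<And>a. a < m \<Longrightarrow> c a \<in> points Z"
    "\<And>s a b. s \<in> carrier G \<Longrightarrow> a < m \<Longrightarrow> b < m \<Longrightarrow> a \<noteq> b \<Longrightarrow>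
      col (move Z s (c a)) \<noteq> col (move Z s (c b))"
proof -
  obtain T where T: "T \<subseteq> colourings G m" "T \<noteq> {}" "compact T"
    "\<And>z s. z \<in> T \<Longrightarrow> s \<in> carrier G \<Longrightarrow> shift_colouring G s z \<in> T"
    "\<And>z a. z \<in> T \<Longrightarrow> rotate_colours G m a z \<in> T"
    "\<And>z x F. z \<in> T \<Longrightarrow> x \<in> T \<Longrightarrow> finite F \<Longrightarrow> F \<subseteq> carrier G \<Longrightarrow>
      \<exists>h\<in>carrier G. \<forall>f\<in>F. z (f \<otimes> h) = x f"
    using rotation_invariant_minimal_subshift[OF assms] by metis
  define code where
    "code g k = from_nat_into (carrier G) (prod_encode (to_nat_on (carrier G) g, k))" for g k
  have code_inj: "g = h \<and> k = l"
    if "code g k = code h l" "g \<in> carrier G" "h \<in> carrier G" for g h k l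
  proof -
    have "prod_encode (to_nat_on (carrier G) g, k) = prod_encode (to_nat_on (carrier G) h, l)"
      using that(1) cnt inf unfolding code_def by (metis to_nat_on_from_nat_into_infinite)
    then have "to_nat_on (carrier G) g = to_nat_on (carrier G) h" "k = l" by simp_all
    then show ?thesis using cnt that(2,3) by simp
  qed
  \<comment> \<open>The graph of a colouring is coded as a subset of the group, and the colouring by the family that
      consists of this set.\<close>
  define enc where "enc z = {(\<lambda>g. code g (z g)) ` carrier G}" for z
  have enc_inj: "inj_on enc T"
  proof (rule inj_onI)
    fix x y assume xy: "x \<in> T" "y \<in> T" and eq: "enc x = enc y"
    have "x g = y g" for g
    proof (cases "g \<in> carrier G")
      case True
      have "code g (x g) \<in> (\<lambda>g. code g (y g)) ` carrier G"
        using eq True unfolding enc_def by blast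
      then obtain h where h: "h \<in> carrier G" "code g (x g) = code h (y h)" by blast
      then show ?thesis using code_inj[OF h(2) True h(1)] by metis
    next
      case False
      have "x \<in> colourings G m" "y \<in> colourings G m" using xy T(1) by blast+
      then show ?thesis using False by (simp add: colourings_def)
    qed
    then show "x = y" by blast
  qed
  define dec where "dec = inv_into T enc"
  have dec: "dec (enc z) = z" if "z \<in> T" for z
    using enc_inj that by (simp add: dec_def)
  have dec_in: "dec A \<in> T" "enc (dec A) = A" if "A \<in> enc ` T" for A
    using that dec by auto
  define Z :: "('a, 'a set set) gspace" where
    "Z = \<lparr>gtop = pullback_topology (enc ` T) dec euclidean,
          move = (\<lambda>s. \<lambda>A\<in>enc ` T. enc (shift_colouring G s (dec A)))\<rparr>"
  have pts: "points Z = enc ` T"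
    by (simp add: Z_def topspace_pullback_topology)
  have mv: "move Z s A = enc (shift_colouring G s (dec A))" if "A \<in> enc ` T" for s A
    using that by (simp add: Z_def)
  have cont_dec: "continuous_map (gtop Z) euclidean dec"
    using continuous_map_pullback[of euclidean euclidean id "enc ` T" dec]
    by (simp add: Z_def)
  have cont_dec': "continuous_map (gtop Z) (top_of_set T) dec"
    using cont_dec dec_in by (auto simp: continuous_map_in_subtopology pts)
  have cont_enc: "continuous_map (top_of_set T) (gtop Z) enc"
  proof -
    have "continuous_map (top_of_set T) euclidean (dec \<circ> enc)"
      by (rule continuous_map_eq[of _ _ id]) (simp_all add: dec)
    then show ?thesis
      unfolding Z_def by (auto intro!: continuous_map_pullback')
  qed
  have hom: "homeomorphic_maps (top_of_set T) (gtop Z) enc dec"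
    unfolding homeomorphic_maps_def using cont_enc cont_dec' dec dec_in by (simp add: pts)
  then have hs: "top_of_set T homeomorphic_space gtop Z"
    unfolding homeomorphic_space_def by blast
  have "compact_space (top_of_set T)"
    using T(3) by (simp add: compact_space_subtopology)
  then have comp: "compact_space (gtop Z)" using homeomorphic_compact_space[OF hs] by simp
  have "Hausdorff_space (top_of_set T)"
  proof -
    have "Hausdorff_space (euclidean :: nat topology)"
      unfolding Hausdorff_space_def disjnt_def using hausdorff by auto
    then have "Hausdorff_space (product_topology (\<lambda>_::'a. euclidean :: nat topology) UNIV)"
      by (simp add: Hausdorff_space_product_topology)
    then show ?thesis by (simp add: euclidean_product_topology Hausdorff_space_subtopology)
  qed
  then have haus: "Hausdorff_space (gtop Z)" using homeomorphic_Hausdorff_space[OF hs] by simp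
  have act: "group_action G (points Z) (move Z)"
  proof (rule group_actionI)
    fix s A assume s: "s \<in> carrier G" and A: "A \<in> points Z"
    then have A': "A \<in> enc ` T" by (simp add: pts)
    show "move Z s A \<in> points Z"
      unfolding mv[OF A'] pts using T(4)[OF dec_in(1)[OF A'] s] by blast
  next
    fix s A assume "A \<notin> points Z"
    then show "move Z s A = undefined" unfolding pts by (simp add: Z_def)
  next
    fix A assume "A \<in> points Z"
    then have A': "A \<in> enc ` T" by (simp add: pts)
    have "dec A \<in> colourings G m" using dec_in(1)[OF A'] T(1) by blast
    then have "shift_colouring G \<one> (dec A) = dec A"
      by (intro ext) (simp add: shift_colouring_def colourings_def)
    then show "move Z \<one> A = A" unfolding mv[OF A'] using dec_in(2)[OF A'] by simp
  next
    fix s t A assume st: "s \<in> carrier G" "t \<in> carrier G" and "A \<in> points Z"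
    then have A': "A \<in> enc ` T" by (simp add: pts)
    have tA: "shift_colouring G t (dec A) \<in> T" using T(4)[OF dec_in(1)[OF A'] st(2)] .
    then have "move Z s (move Z t A) = enc (shift_colouring G s (shift_colouring G t (dec A)))"
      using A' by (simp add: mv dec)
    then show "move Z (s \<otimes> t) A = move Z s (move Z t A)"
      using A' st by (simp add: mv shift_shift_colouring)
  qed
  interpret Z: group_action G "points Z" "move Z" by (rule act)
  have cont_move: "continuous_map (gtop Z) (gtop Z) (move Z s)" if s: "s \<in> carrier G" for s
  proof -
    have "continuous_on T (\<lambda>z. shift_colouring G s z g)" for g
      unfolding shift_colouring_def
      by (cases "g \<in> carrier G") (auto intro: continuous_on_subset[OF continuous_on_product_coordinates])
    then have "continuous_on T (shift_colouring G s)"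
      by (rule continuous_on_coordinatewise_then_product)
    then have "continuous_map (top_of_set T) (top_of_set T) (shift_colouring G s)"
      using T(4) s by (auto simp: continuous_map_in_subtopology)
    then have "continuous_map (gtop Z) (gtop Z) (enc \<circ> (shift_colouring G s \<circ> dec))"
      by (intro continuous_map_compose[OF _ cont_enc] continuous_map_compose[OF cont_dec'])
    then show ?thesis
      by (rule continuous_map_eq) (simp add: mv pts)
  qed
  have "homeomorphic_map (gtop Z) (gtop Z) (move Z s)" if s: "s \<in> carrier G" for s
  proof (rule homeomorphic_maps_imp_map)
    show "homeomorphic_maps (gtop Z) (gtop Z) (move Z s) (move Z (inv s))"
      unfolding homeomorphic_maps_def
    proof (intro conjI ballI)
      fix A assume A: "A \<in> points Z"
      show "move Z (inv s) (move Z s A) = A" using Z.orbit_sym_aux[OF s A] by simp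
      have "move Z s (move Z (inv s) A) = move Z (s \<otimes> inv s) A"
        using Z.composition_rule[OF A s inv_closed[OF s]] by simp
      also have "\<dots> = A" using s A fun_cong[OF Z.id_eq_one, of A] by simp
      finally show "move Z s (move Z (inv s) A) = A" .
    qed (use cont_move s in simp_all)
  qed
  then have gs: "gamma_space G Z" unfolding gamma_space_def using comp haus act by simp
  have "gtop Z closure_of orbit G (move Z) A = points Z" if A: "A \<in> points Z" for A
  proof (intro equalityI subsetI)
    fix B assume B: "B \<in> points Z"
    show "B \<in> gtop Z closure_of orbit G (move Z) A"
      unfolding in_closure_of
    proof (intro conjI allI impI B)
      fix W assume "B \<in> W \<and> openin (gtop Z) W"
      then obtain Q where Q: "open Q" "W = dec -` Q \<inter> enc ` T" "B \<in> W"
        unfolding Z_def by (auto simp: openin_pullback_topology)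
      have A': "A \<in> enc ` T" and B': "B \<in> enc ` T" using A B by (simp_all add: pts)
      have "openin (product_topology (\<lambda>_. euclidean) UNIV) Q" "dec B \<in> Q"
        using Q by (simp_all add: euclidean_product_topology)
      from product_topology_open_contains_basis[OF this] obtain X where
        X: "dec B \<in> (\<Pi>\<^sub>E i\<in>UNIV. X i)" "finite {i. X i \<noteq> UNIV}" "(\<Pi>\<^sub>E i\<in>UNIV. X i) \<subseteq> Q"
        by auto
      obtain h where h: "h \<in> carrier G"
        "\<And>f. f \<in> {i. X i \<noteq> UNIV} \<inter> carrier G \<Longrightarrow> dec A (f \<otimes> h) = dec B f"
        using T(6)[OF dec_in(1)[OF A'] dec_in(1)[OF B'], of "{i. X i \<noteq> UNIV} \<inter> carrier G"] X(2)
        by blast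
      have "shift_colouring G h (dec A) i \<in> X i" for i
      proof (cases "X i = UNIV")
        case False
        have "shift_colouring G h (dec A) i = dec B i"
        proof (cases "i \<in> carrier G")
          case True
          then show ?thesis using h(2)[of i] False by (simp add: shift_colouring_def)
        next
          case nc: False
          have "dec B \<in> colourings G m" using dec_in(1)[OF B'] T(1) by blast
          then show ?thesis using nc by (simp add: shift_colouring_def colourings_def)
        qed
        then show ?thesis using X(1) by (auto simp: PiE_def Pi_def)
      qed simp
      then have "shift_colouring G h (dec A) \<in> Q" using X(3) by (auto simp: PiE_def Pi_def)
      moreover have sT: "shift_colouring G h (dec A) \<in> T" using T(4)[OF dec_in(1)[OF A'] h(1)] .
      ultimately have "move Z h A \<in> W" using Q(2) by (simp add: mv[OF A'] dec)
      moreover have "move Z h A \<in> orbit G (move Z) A" using h(1) unfolding orbit_def by blast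
      ultimately show "\<exists>y. y \<in> orbit G (move Z) A \<and> y \<in> W" by blast
    qed
  qed (use closure_of_subset_topspace[of "gtop Z"] in blast)
  then have min: "minimal_gamma_space G Z"
    unfolding minimal_gamma_space_def using gs T(2) by (simp add: pts)
  obtain z where z: "z \<in> T" using T(2) by blast
  define col where "col A = dec A \<one>" for A
  have ccol: "continuous_map (gtop Z) euclidean col"
  proof -
    have "continuous_map euclidean euclidean (\<lambda>z :: 'a \<Rightarrow> nat. z \<one>)"
      by simp
    from continuous_map_compose[OF cont_dec this] show ?thesis by (simp add: col_def[abs_def] o_def)
  qed
  show ?thesis
  proof (rule that[of Z col "\<lambda>a. enc (rotate_colours G m a z)"])
    show "enc (rotate_colours G m a z) \<in> points Z" for a
      using T(5)[OF z] by (simp add: pts)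
    fix s a b assume s: "s \<in> carrier G" and ab: "a < m" "b < m" "a \<noteq> b"
    have colr: "col (move Z s (enc (rotate_colours G m k z))) = (z s + k) mod m" for k
    proof -
      have r: "rotate_colours G m k z \<in> T" using T(5)[OF z] .
      then show ?thesis
        using T(4)[OF r s] s by (simp add: mv dec col_def shift_colouring_def rotate_colours_def)
    qed
    have "(z s + a) mod m \<noteq> (z s + b) mod m"
    proof
      assume "(z s + a) mod m = (z s + b) mod m"
      then obtain p q where "z s + a + m * p = z s + b + m * q" unfolding nat_mod_eq_iff by blast
      then have "a + m * p = b + m * q" by simp
      then have "a mod m = b mod m" unfolding nat_mod_eq_iff by blast
      then show False using ab by simp
    qed
    then show "col (move Z s (enc (rotate_colours G m a z))) \<noteq> col (move Z s (enc (rotate_colours G m b z)))"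
      by (simp add: colr)
  qed (use min ccol in simp_all)
qed

end

section \<open>The square root of a positive semidefinite matrix as a power series\<close>

definition sesq :: "nat \<Rightarrow> (nat \<Rightarrow> nat \<Rightarrow> complex) \<Rightarrow> (nat \<Rightarrow> complex) \<Rightarrow> (nat \<Rightarrow> complex) \<Rightarrow> complex"
  where "sesq n M u v = (\<Sum>i<n. \<Sum>j<n. cnj (u i) * M i j * v j)"

definition positive_semidefinite :: "nat \<Rightarrow> (nat \<Rightarrow> nat \<Rightarrow> complex) \<Rightarrow> bool"
  where "positive_semidefinite n M \<longleftrightarrow> (\<forall>v. sesq n M v v \<in> \<real>\<^sub>\<ge>\<^sub>0)"

definition hermitian :: "nat \<Rightarrow> (nat \<Rightarrow> nat \<Rightarrow> complex) \<Rightarrow> bool"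
  where "hermitian n M \<longleftrightarrow> (\<forall>i<n. \<forall>j<n. cnj (M i j) = M j i)"

fun mpow :: "nat \<Rightarrow> (nat \<Rightarrow> nat \<Rightarrow> complex) \<Rightarrow> nat \<Rightarrow> nat \<Rightarrow> nat \<Rightarrow> complex"
  where "mpow n x 0 i j = (if i = j then 1 else 0)"
  | "mpow n x (Suc k) i j = (\<Sum>l<n. x i l * mpow n x k l j)"

text \<open>The coefficients of the power series of \<open>\<surd>(1 - t)\<close>.\<close>

definition sqrt_coeff :: "nat \<Rightarrow> real"
  where "sqrt_coeff k = (1/2 gchoose k) * (-1) ^ k"

lemma cnj_mult_self: "cnj z * z = of_real ((cmod z)\<^sup>2)"
  using complex_norm_square[of z] by (simp add: mult.commute)

lemma sum_two_points:
  fixes n :: nat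
  assumes "i < n" "j < n" "i \<noteq> j" "\<And>k. k \<noteq> i \<Longrightarrow> k \<noteq> j \<Longrightarrow> f k = 0"
  shows "(\<Sum>k<n. f k) = f i + (f j :: complex)"
proof -
  have "(\<Sum>k<n. f k) = (\<Sum>k\<in>{i, j}. f k)"
  proof (rule sum.mono_neutral_right)
    show "{i, j} \<subseteq> {..<n}" using assms(1,2) by simp
    show "\<forall>k\<in>{..<n} - {i, j}. f k = 0" using assms(4) by blast
  qed simp
  then show ?thesis using assms(3) by simp
qed

lemma sesq_two_points:
  assumes "i < n" "j < n" "i \<noteq> j" and v: "\<And>k. k \<noteq> i \<Longrightarrow> k \<noteq> j \<Longrightarrow> v k = 0"
  shows "sesq n M v v = cnj (v i) * M i i * v i + cnj (v i) * M i j * v j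
    + (cnj (v j) * M j i * v i + cnj (v j) * M j j * v j)"
proof -
  have "(\<Sum>j<n. cnj (v k) * M k j * v j) = cnj (v k) * M k i * v i + cnj (v k) * M k j * v j" for k
    using sum_two_points[OF assms(1-3), of "\<lambda>l. cnj (v k) * M k l * v l"] v by simp
  then show ?thesis
    unfolding sesq_def
    using sum_two_points[OF assms(1-3), of "\<lambda>k. cnj (v k) * M k i * v i + cnj (v k) * M k j * v j"] v
    by simp
qed

lemma sesq_one_point:
  assumes "i < n" and v: "\<And>k. k \<noteq> i \<Longrightarrow> v k = 0"
  shows "sesq n M v v = cnj (v i) * M i i * v i"
proof -
  have 1: "(\<Sum>k<n. f k) = f i" if "\<And>k. k \<noteq> i \<Longrightarrow> f k = 0" for f :: "nat \<Rightarrow> complex"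
    using sum.mono_neutral_right[of "{..<n}" "{i}" f] assms(1) that by auto
  have "(\<Sum>j<n. cnj (v k) * M k j * v j) = cnj (v k) * M k i * v i" for k
    using 1[of "\<lambda>l. cnj (v k) * M k l * v l"] v by simp
  then show ?thesis
    unfolding sesq_def using 1[of "\<lambda>k. cnj (v k) * M k i * v i"] v by simp
qed

text \<open>Polarization: test the form on \<open>e\<^sub>i\<close>, on \<open>e\<^sub>i + e\<^sub>j\<close> and on \<open>e\<^sub>i + \<i> e\<^sub>j\<close>.\<close>

lemma hermitian_if_positive_semidefinite:
  assumes "positive_semidefinite n M"
  shows "hermitian n M"
  unfolding hermitian_def
proof (intro allI impI)
  fix i j assume ij: "i < n" "j < n"
  have re: "Im (sesq n M v v) = 0" for v
    using assms unfolding positive_semidefinite_def by (auto simp: complex_nonneg_Reals_iff)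
  have d: "Im (M k k) = 0" if "k < n" for k
    using re[of "\<lambda>l. if l = k then 1 else 0"] that
    by (subst (asm) sesq_one_point[of k]) auto
  show "cnj (M i j) = M j i"
  proof (cases "i = j")
    case True
    then show ?thesis using d[OF ij(1)] by (simp add: complex_eq_iff)
  next
    case False
    let ?v = "\<lambda>z l. if l = i then 1 else if l = j then z else 0 :: complex"
    have "Im (M i i + M i j * z + (cnj z * M j i + cnj z * M j j * z)) = 0" for z
      using re[of "?v z"] False by (subst (asm) sesq_two_points[OF ij False]) auto
    from this[of 1] this[of \<i>] show ?thesis
      using d ij by (simp add: complex_eq_iff)
  qed
qed

text \<open>For \<open>y = x v\<close>, the nonnegative numbers \<open>\<langle>v - y, x (v - y)\<rangle>\<close> and \<open>\<langle>y, (1 - x) y\<rangle>\<close> add up to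
  \<open>\<langle>v, x v\<rangle> - \<parallel>y\<parallel>\<^sup>2\<close>, and \<open>\<langle>v, x v\<rangle> \<le> \<parallel>v\<parallel>\<^sup>2\<close>.\<close>

lemma hermitian_contraction:
  assumes herm: "hermitian n x"
    and pos: "\<And>v. 0 \<le> Re (sesq n x v v)"
    and le: "\<And>v. Re (sesq n x v v) \<le> (\<Sum>i<n. (cmod (v i))\<^sup>2)"
  shows "(\<Sum>i<n. (cmod (\<Sum>j<n. x i j * v j))\<^sup>2) \<le> (\<Sum>i<n. (cmod (v i))\<^sup>2)"
proof -
  define y where "y i = (\<Sum>j<n. x i j * v j)" for i
  define N where "N = (\<Sum>i<n. (cmod (y i))\<^sup>2)"
  have yv: "sesq n x u v = (\<Sum>i<n. cnj (u i) * y i)" for u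
    unfolding sesq_def y_def by (simp add: sum_distrib_left mult.assoc)
  have vy: "sesq n x v u = (\<Sum>i<n. cnj (y i) * u i)" for u
  proof -
    have "sesq n x v u = (\<Sum>j<n. \<Sum>i<n. cnj (v i) * x i j * u j)"
      unfolding sesq_def by (rule sum.swap)
    also have "\<dots> = (\<Sum>j<n. cnj (y j) * u j)"
    proof (rule sum.cong[OF refl])
      fix j assume j: "j \<in> {..<n}"
      have "(\<Sum>i<n. cnj (v i) * x i j * u j) = (\<Sum>i<n. cnj (x j i * v i)) * u j"
        using herm j unfolding hermitian_def by (simp add: sum_distrib_left mult_ac)
      then show "(\<Sum>i<n. cnj (v i) * x i j * u j) = cnj (y j) * u j" by (simp add: y_def)
    qed
    finally show ?thesis .
  qed
  have yy: "(\<Sum>i<n. cnj (y i) * y i) = of_real N"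
    unfolding N_def by (simp only: cnj_mult_self of_real_sum)
  have "sesq n x (\<lambda>i. v i - y i) (\<lambda>i. v i - y i)
      = sesq n x v v - sesq n x v y - (sesq n x y v - sesq n x y y)"
    unfolding sesq_def by (simp add: algebra_simps sum.distrib sum_subtractf)
  then have "Re (sesq n x (\<lambda>i. v i - y i) (\<lambda>i. v i - y i))
      = Re (sesq n x v v) - 2 * N + Re (sesq n x y y)"
    using yv[of y] vy[of y] yy by simp
  then show ?thesis
    using pos[of "\<lambda>i. v i - y i"] le[of y] le[of v] unfolding N_def y_def by simp
qed

lemma mpow_add:
  assumes "i < n"
  shows "(\<Sum>l<n. mpow n x k i l * mpow n x k' l j) = mpow n x (k + k') i j"
  using assms
proof (induction k arbitrary: i)
  case 0
  then have "(\<Sum>l<n. (if i = l then 1 else 0) * mpow n x k' l j) = mpow n x k' i j"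
    using sum.mono_neutral_right[of "{..<n}" "{i}" "\<lambda>l. (if i = l then 1 else 0) * mpow n x k' l j"]
    by auto
  then show ?case by simp
next
  case (Suc k)
  have "(\<Sum>l<n. mpow n x (Suc k) i l * mpow n x k' l j)
      = (\<Sum>l<n. \<Sum>p<n. x i p * mpow n x k p l * mpow n x k' l j)"
    by (simp add: sum_distrib_right)
  also have "\<dots> = (\<Sum>p<n. \<Sum>l<n. x i p * mpow n x k p l * mpow n x k' l j)" by (rule sum.swap)
  also have "\<dots> = (\<Sum>p<n. x i p * (\<Sum>l<n. mpow n x k p l * mpow n x k' l j))"
    by (simp add: sum_distrib_left mult.assoc)
  also have "\<dots> = (\<Sum>p<n. x i p * mpow n x (k + k') p j)" using Suc.IH by simp
  finally show ?case by simp
qed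

lemma mpow_one:
  assumes "j < n"
  shows "mpow n x (Suc 0) i j = x i j"
proof -
  have "(\<Sum>l<n. x i l * (if l = j then 1 else 0)) = (\<Sum>l<n. if l = j then x i l else 0)"
    by (rule sum.cong) auto
  then show ?thesis using assms by simp
qed

lemma mpow_hermitian:
  assumes "hermitian n x"
  shows "hermitian n (mpow n x k)"
proof (induction k)
  case 0
  then show ?case by (simp add: hermitian_def)
next
  case (Suc k)
  show ?case
    unfolding hermitian_def
  proof (intro allI impI)
    fix i j assume ij: "i < n" "j < n"
    have "cnj (mpow n x (Suc k) i j) = (\<Sum>l<n. cnj (mpow n x k l j) * cnj (x i l))"
      by (simp add: mult.commute)
    also have "\<dots> = (\<Sum>l<n. mpow n x k j l * mpow n x (Suc 0) l i)"
    proof (rule sum.cong[OF refl])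
      fix l assume "l \<in> {..<n}"
      then have l: "l < n" by simp
      have "cnj (mpow n x k l j) = mpow n x k j l" "cnj (x i l) = x l i"
        using Suc.IH assms ij l unfolding hermitian_def by simp_all
      then show "cnj (mpow n x k l j) * cnj (x i l) = mpow n x k j l * mpow n x (Suc 0) l i"
        unfolding mpow_one[OF ij(1)] by simp
    qed
    also have "\<dots> = mpow n x (Suc k) j i" using mpow_add[OF ij(2), of x k "Suc 0" i] by simp
    finally show "cnj (mpow n x (Suc k) i j) = mpow n x (Suc k) j i" .
  qed
qed

text \<open>The columns of the powers of a contraction have norm at most 1.\<close>

lemma norm_mpow_le_1:
  assumes x: "hermitian n x" "\<And>v. 0 \<le> Re (sesq n x v v)"
    "\<And>v. Re (sesq n x v v) \<le> (\<Sum>i<n. (cmod (v i))\<^sup>2)"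
    and ij: "i < n" "j < n"
  shows "cmod (mpow n x k i j) \<le> 1"
proof -
  have "(\<Sum>i<n. (cmod (mpow n x k i j))\<^sup>2) \<le> 1"
  proof (induction k)
    case 0
    have "(\<Sum>i<n. (cmod (mpow n x 0 i j))\<^sup>2) = (\<Sum>i<n. if i = j then 1 else 0)"
      by (rule sum.cong) auto
    then show ?case by simp
  next
    case (Suc k)
    have "(\<Sum>i<n. (cmod (mpow n x (Suc k) i j))\<^sup>2) \<le> (\<Sum>i<n. (cmod (mpow n x k i j))\<^sup>2)"
      using hermitian_contraction[OF x, of "\<lambda>l. mpow n x k l j"] by simp
    then show ?case using Suc by linarith
  qed
  moreover have "(cmod (mpow n x k i j))\<^sup>2 \<le> (\<Sum>i<n. (cmod (mpow n x k i j))\<^sup>2)"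
    using ij(1) by (intro member_le_sum) auto
  ultimately have "(cmod (mpow n x k i j))\<^sup>2 \<le> 1\<^sup>2" by simp
  then show ?thesis using power2_le_imp_le zero_le_one by blast
qed

lemma gchoose_Suc_sign:
  "(a gchoose Suc k) * (-1) ^ Suc k = ((a gchoose k) * (-1) ^ k) * ((real k - a) / real (Suc k))"
proof -
  have "real (Suc k) * (a gchoose Suc k) = (a - real k) * (a gchoose k)"
    using gbinomial_mult_1[of a k] by (simp add: algebra_simps)
  then have "(a gchoose Suc k) = (a - real k) * (a gchoose k) / real (Suc k)"
    by (simp add: nonzero_eq_divide_eq mult.commute del: of_nat_Suc)
  then have "(a gchoose Suc k) * (-1) ^ Suc k = (a - real k) * (a gchoose k) / real (Suc k) * (-1) ^ Suc k"
    by (rule arg_cong)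
  also have "\<dots> = ((a gchoose k) * (-1) ^ k) * ((real k - a) / real (Suc k))"
    by (simp add: divide_inverse algebra_simps del: of_nat_Suc)
  finally show ?thesis .
qed

lemma sqrt_coeff_0: "sqrt_coeff 0 = 1"
  by (simp add: sqrt_coeff_def)

lemma sqrt_coeff_nonpos: "sqrt_coeff (Suc k) \<le> 0"
proof (induction k)
  case 0
  then show ?case by (simp add: sqrt_coeff_def)
next
  case (Suc k)
  have "sqrt_coeff (Suc (Suc k)) = sqrt_coeff (Suc k) * ((real (Suc k) - 1/2) / real (Suc (Suc k)))"
    unfolding sqrt_coeff_def by (rule gchoose_Suc_sign)
  moreover have "0 \<le> (real (Suc k) - 1/2) / real (Suc (Suc k))" by simp
  ultimately show ?case using Suc by (simp only: mult_nonpos_nonneg)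
qed

text \<open>All coefficients except the first are at most 0, and the partial sums are nonnegative because they
  equal \<open>(-1)\<^sup>m\<close> times the binomial coefficient of \<open>-1/2\<close> over \<open>m\<close>. So the absolute values sum
  to at most 2.\<close>

lemma sqrt_coeff_summable: "summable (\<lambda>k. \<bar>sqrt_coeff k\<bar>)"
proof (rule summableI_nonneg_bounded[where x = 2])
  fix n
  have pos: "0 \<le> ((-1/2 :: real) gchoose m) * (-1) ^ m" for m
  proof (induction m)
    case (Suc m)
    then show ?case unfolding gchoose_Suc_sign by (simp del: of_nat_Suc)
  qed simp
  have low: "0 \<le> (\<Sum>k\<le>m. sqrt_coeff k)" for m
    using pos[of m] gbinomial_sum_lower_neg[of "1/2 :: real" m]
    by (simp add: sqrt_coeff_def mult.commute)
  have abs: "\<bar>sqrt_coeff k\<bar> = - sqrt_coeff k + (if k = 0 then 2 else 0)" for k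
    using sqrt_coeff_nonpos[of "k - 1"] sqrt_coeff_0 by (cases k) auto
  have "(\<Sum>k\<le>n. \<bar>sqrt_coeff k\<bar>) = - (\<Sum>k\<le>n. sqrt_coeff k) + 2"
    unfolding abs by (simp add: sum.distrib sum_negf sum_subtractf)
  then have "(\<Sum>k\<le>n. \<bar>sqrt_coeff k\<bar>) \<le> 2" using low[of n] by simp
  moreover have "(\<Sum>k<n. \<bar>sqrt_coeff k\<bar>) \<le> (\<Sum>k\<le>n. \<bar>sqrt_coeff k\<bar>)"
    by (rule sum_mono2) auto
  ultimately show "(\<Sum>k<n. \<bar>sqrt_coeff k\<bar>) \<le> 2" by linarith
qed simp

text \<open>Vandermonde's identity for \<open>1/2 + 1/2 = 1\<close>.\<close>

lemma sqrt_coeff_convolution: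
  "(\<Sum>i\<le>k. sqrt_coeff i * sqrt_coeff (k - i)) = (if k = 0 then 1 else if k = 1 then -1 else 0)"
proof -
  have "(\<Sum>i\<le>k. sqrt_coeff i * sqrt_coeff (k - i))
      = (\<Sum>i\<le>k. ((1/2 gchoose i) * (1/2 gchoose (k - i))) * (-1) ^ k)"
  proof (rule sum.cong[OF refl])
    fix i assume "i \<in> {..k}"
    then have "(-1 :: real) ^ k = (-1) ^ i * (-1) ^ (k - i)" by (simp add: power_add[symmetric])
    then show "sqrt_coeff i * sqrt_coeff (k - i) = ((1/2 gchoose i) * (1/2 gchoose (k - i))) * (-1) ^ k"
      by (simp add: sqrt_coeff_def)
  qed
  also have "\<dots> = ((1/2 + 1/2 :: real) gchoose k) * (-1) ^ k"
    unfolding gbinomial_Vandermonde[symmetric] by (simp add: sum_distrib_right atLeast0AtMost)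
  also have "(1/2 + 1/2 :: real) gchoose k = real (1 choose k)"
    by (simp add: binomial_gbinomial)
  finally show ?thesis by (cases k) (auto simp: binomial_eq_0)
qed

text \<open>The powers of \<open>x\<close> have bounded entries, so the series converges absolutely and can be squared by
  the Cauchy product.\<close>

lemma sqrt_series_square:
  assumes x: "hermitian n x" "\<And>v. 0 \<le> Re (sesq n x v v)"
    "\<And>v. Re (sesq n x v v) \<le> (\<Sum>i<n. (cmod (v i))\<^sup>2)"
  defines "S \<equiv> \<lambda>i j. \<Sum>k. of_real (sqrt_coeff k) * mpow n x k i j"
  assumes ij: "i < n" "j < n"
  shows "cnj (S i j) = S j i" "(\<Sum>l<n. S i l * S l j) = (if i = j then 1 else 0) - x i j"
proof -
  have nrm: "norm (of_real (sqrt_coeff k) * mpow n x k p q) \<le> \<bar>sqrt_coeff k\<bar>"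
    if "p < n" "q < n" for k p q
    using norm_mpow_le_1[OF x that, of k] by (simp add: norm_mult mult_left_le)
  have sm: "summable (\<lambda>k. norm (of_real (sqrt_coeff k) * mpow n x k p q))" if "p < n" "q < n" for p q
    by (rule summable_comparison_test'[OF sqrt_coeff_summable, of 0]) (use nrm[OF that] in auto)
  show "cnj (S i j) = S j i"
  proof -
    have "(\<lambda>k. cnj (of_real (sqrt_coeff k) * mpow n x k i j)) sums cnj (S i j)"
      unfolding S_def sums_cnj using sm[OF ij] by (simp add: summable_norm_cancel summable_sums)
    moreover have "cnj (of_real (sqrt_coeff k) * mpow n x k i j) = of_real (sqrt_coeff k) * mpow n x k j i" for k
      using mpow_hermitian[OF x(1), of k] ij unfolding hermitian_def by simp
    ultimately have "(\<lambda>k. of_real (sqrt_coeff k) * mpow n x k j i) sums cnj (S i j)" by (simp only:)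
    then show ?thesis unfolding S_def by (rule sums_unique)
  qed
  have "(\<lambda>k. \<Sum>l<n. \<Sum>p\<le>k. (of_real (sqrt_coeff p) * mpow n x p i l)
      * (of_real (sqrt_coeff (k - p)) * mpow n x (k - p) l j)) sums (\<Sum>l<n. S i l * S l j)"
    unfolding S_def using ij by (intro sums_sum Cauchy_product_sums sm) auto
  moreover have "(\<Sum>l<n. \<Sum>p\<le>k. (of_real (sqrt_coeff p) * mpow n x p i l)
      * (of_real (sqrt_coeff (k - p)) * mpow n x (k - p) l j))
    = (if k = 0 then 1 else if k = 1 then -1 else 0) * mpow n x k i j" for k
  proof -
    have "(\<Sum>l<n. \<Sum>p\<le>k. (of_real (sqrt_coeff p) * mpow n x p i l)
        * (of_real (sqrt_coeff (k - p)) * mpow n x (k - p) l j))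
      = (\<Sum>p\<le>k. of_real (sqrt_coeff p * sqrt_coeff (k - p))
          * (\<Sum>l<n. mpow n x p i l * mpow n x (k - p) l j))"
      by (subst sum.swap) (simp add: sum_distrib_left mult_ac)
    also have "\<dots> = (\<Sum>p\<le>k. of_real (sqrt_coeff p * sqrt_coeff (k - p)) * mpow n x k i j)"
      by (rule sum.cong[OF refl]) (simp add: mpow_add[OF ij(1)])
    also have "\<dots> = of_real (\<Sum>p\<le>k. sqrt_coeff p * sqrt_coeff (k - p)) * mpow n x k i j"
      by (simp add: sum_distrib_right)
    finally show ?thesis unfolding sqrt_coeff_convolution by auto
  qed
  ultimately have 1: "(\<lambda>k. (if k = 0 then 1 else if k = 1 then -1 else 0) * mpow n x k i j)
      sums (\<Sum>l<n. S i l * S l j)" by simp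
  have "(\<lambda>k. (if k = 0 then 1 else if k = 1 then -1 else 0) * mpow n x k i j)
      sums (\<Sum>k\<in>{0, 1}. (if k = 0 then 1 else if k = 1 then -1 else 0) * mpow n x k i j)"
    by (rule sums_finite) auto
  then show "(\<Sum>l<n. S i l * S l j) = (if i = j then 1 else 0) - x i j"
    using sums_unique2[OF 1] mpow_one[OF ij(2), of x i] by (simp del: mpow.simps(2))
qed

text \<open>Rescaling: if \<open>M\<close> has entries of modulus at most \<open>B\<close>, its form is at most \<open>n B\<close> times the square
  of the norm, so \<open>M / R\<close> and \<open>1 - M / R\<close> both lie between 0 and 1.\<close>

lemma bounded_matrix_shift:
  assumes M: "positive_semidefinite n M" and B: "\<And>i j. i < n \<Longrightarrow> j < n \<Longrightarrow> cmod (M i j) \<le> B"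
    and R: "real n * B \<le> R" "0 < R"
  defines "x \<equiv> \<lambda>i j. (if i = j then 1 else 0) - M i j / of_real R"
  shows "hermitian n x" "0 \<le> Re (sesq n x v v)" "Re (sesq n x v v) \<le> (\<Sum>i<n. (cmod (v i))\<^sup>2)"
proof -
  show "hermitian n x"
    using hermitian_if_positive_semidefinite[OF M] by (simp add: hermitian_def x_def)
  have B0: "0 \<le> B" if "0 < n" using B[OF that that] norm_ge_zero[of "M 0 0"] by linarith
  have "sesq n x v v = (\<Sum>i<n. \<Sum>j<n. (if i = j then cnj (v i) * v j else 0)
      - cnj (v i) * M i j * v j / of_real R)"
    unfolding sesq_def x_def by (intro sum.cong refl) (auto simp: algebra_simps)
  also have "\<dots> = (\<Sum>i<n. cnj (v i) * v i) - sesq n M v v / of_real R"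
    by (simp add: sum_subtractf sesq_def sum_divide_distrib)
  also have "(\<Sum>i<n. cnj (v i) * v i) = of_real (\<Sum>i<n. (cmod (v i))\<^sup>2)"
    by (simp only: cnj_mult_self of_real_sum)
  finally have eq: "Re (sesq n x v v) = (\<Sum>i<n. (cmod (v i))\<^sup>2) - Re (sesq n M v v) / R"
    by simp
  have "0 \<le> Re (sesq n M v v)"
    using M unfolding positive_semidefinite_def by (simp add: complex_nonneg_Reals_iff)
  then show "Re (sesq n x v v) \<le> (\<Sum>i<n. (cmod (v i))\<^sup>2)" using eq R(2) by simp
  have "cmod (sesq n M v v) \<le> (\<Sum>i<n. \<Sum>j<n. cmod (v i) * B * cmod (v j))"
    unfolding sesq_def
  proof (intro order_trans[OF norm_sum] sum_mono)
    fix i j assume "i \<in> {..<n}" "j \<in> {..<n}"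
    then have "cmod (M i j) \<le> B" using B by simp
    then show "cmod (cnj (v i) * M i j * v j) \<le> cmod (v i) * B * cmod (v j)"
      by (simp add: norm_mult mult_left_mono mult_right_mono)
  qed
  also have "\<dots> = B * (\<Sum>i<n. cmod (v i))\<^sup>2"
    by (simp add: power2_eq_square sum_product sum_distrib_left mult_ac)
  also have "\<dots> \<le> R * (\<Sum>i<n. (cmod (v i))\<^sup>2)"
  proof (cases "n = 0")
    case False
    have "B * (\<Sum>i<n. cmod (v i))\<^sup>2 \<le> B * ((\<Sum>i<n. (cmod (v i))\<^sup>2) * real n)"
      using sum_squared_le_sum_of_squares[of "\<lambda>i. cmod (v i)" "{..<n}"] B0 False
      by (intro mult_left_mono) auto
    also have "\<dots> = (real n * B) * (\<Sum>i<n. (cmod (v i))\<^sup>2)" by simp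
    also have "\<dots> \<le> R * (\<Sum>i<n. (cmod (v i))\<^sup>2)"
      by (intro mult_right_mono R sum_nonneg) simp
    finally show ?thesis .
  qed simp
  finally have "Re (sesq n M v v) \<le> R * (\<Sum>i<n. (cmod (v i))\<^sup>2)"
    using complex_Re_le_cmod order_trans by blast
  then show "0 \<le> Re (sesq n x v v)" unfolding eq using R(2) by (simp add: field_simps)
qed

section \<open>Algebras of bounded functions\<close>

lemma cring_complex_ring: "cring complex_ring"
proof (rule cringI)
  show "abelian_group complex_ring"
  proof (rule abelian_groupI)
    fix x assume "x \<in> carrier complex_ring"
    then show "\<exists>y\<in>carrier complex_ring. y \<oplus>\<^bsub>complex_ring\<^esub> x = \<zero>\<^bsub>complex_ring\<^esub>"
      by (intro bexI[of _ "- x"]) (simp_all add: complex_ring_def)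
  qed (simp_all add: complex_ring_def)
  show "comm_monoid complex_ring"
    by (rule comm_monoidI) (simp_all add: complex_ring_def)
qed (simp add: complex_ring_def distrib_right)

text \<open>A commutative \<open>C\<^sup>*\<close>-algebra whose elements act as bounded functions on \<open>\<Omega>\<close>, \<open>ev x w\<close> being the value
  of \<open>x\<close> at \<open>w\<close>. Separating elements from functions lets the same results apply to \<open>C(T)\<close>, to
  \<open>\<ell>\<^sup>\<infinity>(\<Gamma>)\<close> in the type of matrix-valued functions, and to abstract algebras isomorphic to
  one of these. The norm is left open, so that it can be compared with the supremum later.\<close>

locale function_algebra =
  fixes A :: "'a cstar" (structure) and \<Omega> :: "'w set" and ev :: "'a \<Rightarrow> 'w \<Rightarrow> complex"
  assumes zero_mem: "\<zero> \<in> carrier A" and one_mem: "\<one> \<in> carrier A"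
    and add_mem: "\<And>x y. x \<in> carrier A \<Longrightarrow> y \<in> carrier A \<Longrightarrow> x \<oplus> y \<in> carrier A"
    and mult_mem: "\<And>x y. x \<in> carrier A \<Longrightarrow> y \<in> carrier A \<Longrightarrow> x \<otimes> y \<in> carrier A"
    and smult_mem: "\<And>c x. x \<in> carrier A \<Longrightarrow> c \<odot> x \<in> carrier A"
    and adj_mem: "\<And>x. x \<in> carrier A \<Longrightarrow> adj A x \<in> carrier A"
    and ev_zero: "\<And>w. w \<in> \<Omega> \<Longrightarrow> ev \<zero> w = 0"
    and ev_one: "\<And>w. w \<in> \<Omega> \<Longrightarrow> ev \<one> w = 1"
    and ev_add: "\<And>x y w. x \<in> carrier A \<Longrightarrow> y \<in> carrier A \<Longrightarrow> w \<in> \<Omega> \<Longrightarrow> ev (x \<oplus> y) w = ev x w + ev y w"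
    and ev_mult: "\<And>x y w. x \<in> carrier A \<Longrightarrow> y \<in> carrier A \<Longrightarrow> w \<in> \<Omega> \<Longrightarrow> ev (x \<otimes> y) w = ev x w * ev y w"
    and ev_smult: "\<And>c x w. x \<in> carrier A \<Longrightarrow> w \<in> \<Omega> \<Longrightarrow> ev (c \<odot> x) w = c * ev x w"
    and ev_adj: "\<And>x w. x \<in> carrier A \<Longrightarrow> w \<in> \<Omega> \<Longrightarrow> ev (adj A x) w = cnj (ev x w)"
    and ev_eqI: "\<And>x y. x \<in> carrier A \<Longrightarrow> y \<in> carrier A \<Longrightarrow> (\<And>w. w \<in> \<Omega> \<Longrightarrow> ev x w = ev y w) \<Longrightarrow> x = y"
    and ev_bounded: "\<And>x. x \<in> carrier A \<Longrightarrow> \<exists>B. \<forall>w\<in>\<Omega>. cmod (ev x w) \<le> B"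
    and ev_limit: "\<And>x u. (\<And>n. x n \<in> carrier A) \<Longrightarrow>
      uniform_limit \<Omega> (\<lambda>n. ev (x n)) u sequentially \<Longrightarrow> \<exists>y\<in>carrier A. \<forall>w\<in>\<Omega>. ev y w = u w"
begin

lemmas mem = zero_mem one_mem add_mem mult_mem smult_mem adj_mem
lemmas evs = ev_zero ev_one ev_add ev_mult ev_smult ev_adj

lemma is_abelian_group: "abelian_group A"
proof (rule abelian_groupI)
  show "x \<oplus> y \<in> carrier A" if "x \<in> carrier A" "y \<in> carrier A" for x y
    using that by (rule add_mem)
  show "\<zero> \<in> carrier A" by (rule zero_mem)
  show "(x \<oplus> y) \<oplus> z = x \<oplus> (y \<oplus> z)" if "x \<in> carrier A" "y \<in> carrier A" "z \<in> carrier A" for x y z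
    by (rule ev_eqI) (simp_all add: mem evs that)
  show "x \<oplus> y = y \<oplus> x" if "x \<in> carrier A" "y \<in> carrier A" for x y
    by (rule ev_eqI) (simp_all add: mem evs that)
  show "\<zero> \<oplus> x = x" if "x \<in> carrier A" for x
    by (rule ev_eqI) (simp_all add: mem evs that)
  show "\<exists>y\<in>carrier A. y \<oplus> x = \<zero>" if "x \<in> carrier A" for x
  proof
    show "(-1) \<odot> x \<oplus> x = \<zero>" by (rule ev_eqI) (simp_all add: mem evs that)
  qed (simp add: mem that)
qed

lemma is_cring: "cring A"
proof (rule cringI)
  show "comm_monoid A"
  proof (rule comm_monoidI)
    show "x \<otimes> y \<in> carrier A" if "x \<in> carrier A" "y \<in> carrier A" for x y
      using that by (rule mult_mem)
    show "\<one> \<in> carrier A" by (rule one_mem)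
    show "(x \<otimes> y) \<otimes> z = x \<otimes> (y \<otimes> z)" if "x \<in> carrier A" "y \<in> carrier A" "z \<in> carrier A" for x y z
      by (rule ev_eqI) (simp_all add: mem evs that)
    show "x \<otimes> y = y \<otimes> x" if "x \<in> carrier A" "y \<in> carrier A" for x y
      by (rule ev_eqI) (simp_all add: mem evs that)
    show "\<one> \<otimes> x = x" if "x \<in> carrier A" for x
      by (rule ev_eqI) (simp_all add: mem evs that)
  qed
  show "(x \<oplus> y) \<otimes> z = x \<otimes> z \<oplus> y \<otimes> z" if "x \<in> carrier A" "y \<in> carrier A" "z \<in> carrier A" for x y z
    by (rule ev_eqI) (simp_all add: mem evs that distrib_right)
qed (rule is_abelian_group)

lemma is_module: "module complex_ring A"
proof (rule moduleI[OF cring_complex_ring is_abelian_group])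
  show "c \<odot> x \<in> carrier A" if "x \<in> carrier A" for c x using that by (rule smult_mem)
  show "(a \<oplus>\<^bsub>complex_ring\<^esub> b) \<odot> x = a \<odot> x \<oplus> b \<odot> x" if "x \<in> carrier A" for a b x
    by (rule ev_eqI) (simp_all add: mem evs that complex_ring_def distrib_right)
  show "a \<odot> (x \<oplus> y) = a \<odot> x \<oplus> a \<odot> y" if "x \<in> carrier A" "y \<in> carrier A" for a x y
    by (rule ev_eqI) (simp_all add: mem evs that distrib_left)
  show "(a \<otimes>\<^bsub>complex_ring\<^esub> b) \<odot> x = a \<odot> (b \<odot> x)" if "x \<in> carrier A" for a b x
    by (rule ev_eqI) (simp_all add: mem evs that complex_ring_def)
  show "\<one>\<^bsub>complex_ring\<^esub> \<odot> x = x" if "x \<in> carrier A" for x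
    by (rule ev_eqI) (simp_all add: mem evs that complex_ring_def)
qed

lemma ev_minus:
  assumes "x \<in> carrier A" "y \<in> carrier A" "w \<in> \<Omega>"
  shows "ev (x \<ominus> y) w = ev x w - ev y w"
proof -
  interpret cring A by (rule is_cring)
  have "ev (x \<ominus> y) w + ev y w = ev ((x \<ominus> y) \<oplus> y) w"
    using assms by (simp add: ev_add)
  also have "(x \<ominus> y) \<oplus> y = x"
    using assms by (simp add: a_minus_def a_assoc l_neg)
  finally show ?thesis by (simp add: algebra_simps)
qed

lemma ev_finsum:
  assumes "finite K" "\<And>k. k \<in> K \<Longrightarrow> f k \<in> carrier A" "w \<in> \<Omega>"
  shows "(\<Oplus>k\<in>K. f k) \<in> carrier A" "ev (\<Oplus>k\<in>K. f k) w = (\<Sum>k\<in>K. ev (f k) w)"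
proof -
  interpret cring A by (rule is_cring)
  have "(\<Oplus>k\<in>K. f k) \<in> carrier A \<and> ev (\<Oplus>k\<in>K. f k) w = (\<Sum>k\<in>K. ev (f k) w)"
    using assms(1,2)
  proof (induction K rule: finite_induct)
    case empty
    then show ?case using assms(3) by (simp add: ev_zero)
  next
    case (insert k K)
    then have "f \<in> K \<rightarrow> carrier A" "f k \<in> carrier A" by auto
    then show ?case using insert assms(3) by (simp add: finsum_insert ev_add)
  qed
  then show "(\<Oplus>k\<in>K. f k) \<in> carrier A" "ev (\<Oplus>k\<in>K. f k) w = (\<Sum>k\<in>K. ev (f k) w)" by auto
qed

lemma finsum_mem:
  assumes "finite K" "\<And>k. k \<in> K \<Longrightarrow> f k \<in> carrier A"
  shows "(\<Oplus>k\<in>K. f k) \<in> carrier A"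
proof -
  interpret cring A by (rule is_cring)
  show ?thesis using assms(2) by (intro finsum_closed) auto
qed

definition represented :: "('w \<Rightarrow> complex) \<Rightarrow> bool"
  where "represented u \<longleftrightarrow> (\<exists>x\<in>carrier A. \<forall>w\<in>\<Omega>. ev x w = u w)"

lemma represented_ev: "x \<in> carrier A \<Longrightarrow> represented (ev x)"
  unfolding represented_def by blast

lemma represented_const: "represented (\<lambda>w. c)"
  unfolding represented_def by (intro bexI[of _ "c \<odot> \<one>"]) (simp_all add: mem evs)

lemma represented_add: "represented u \<Longrightarrow> represented v \<Longrightarrow> represented (\<lambda>w. u w + v w)"
  unfolding represented_def by (metis add_mem ev_add)

lemma represented_mult: "represented u \<Longrightarrow> represented v \<Longrightarrow> represented (\<lambda>w. u w * v w)"
  unfolding represented_def by (metis mult_mem ev_mult)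

lemma represented_sum:
  "finite K \<Longrightarrow> (\<And>k. k \<in> K \<Longrightarrow> represented (u k)) \<Longrightarrow> represented (\<lambda>w. \<Sum>k\<in>K. u k w)"
proof (induction K rule: finite_induct)
  case empty
  then show ?case using represented_const[of 0] by simp
next
  case (insert k K)
  then show ?case using represented_add[of "u k" "\<lambda>w. \<Sum>k\<in>K. u k w"] by simp
qed

lemma represented_limit:
  assumes "\<And>n. represented (u n)" "uniform_limit \<Omega> u v sequentially"
  shows "represented v"
proof -
  obtain x where x: "\<And>n. x n \<in> carrier A" "\<And>n w. w \<in> \<Omega> \<Longrightarrow> ev (x n) w = u n w"
    using assms(1) unfolding represented_def by metis
  have "uniform_limit \<Omega> (\<lambda>n. ev (x n)) v sequentially"
    using assms(2) by (rule uniform_limit_cong'[THEN iffD1, rotated 2]) (simp_all add: x(2))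
  from ev_limit[OF x(1) this] show ?thesis unfolding represented_def .
qed

lemma mat_carrierI:
  assumes "\<And>i j. i < n \<Longrightarrow> j < n \<Longrightarrow> a i j \<in> carrier A"
  shows "mat_of A n a \<in> carrier (mat_cstar n A)"
  using assms by (auto simp: mat_cstar_def mat_of_def fun_eq_iff)

text \<open>A matrix \<open>b\<^sup>* b\<close> is positive semidefinite at every point. Conversely, the pointwise square root of a
  positive semidefinite matrix \<open>a\<close> is \<open>\<surd>R\<close> times the series of \<open>\<surd>(1 - t)\<close> in \<open>1 - a / R\<close>, for
  \<open>R\<close> large. The series converges uniformly, so its entries belong to the algebra.\<close>

lemma cstar_pos_mat_iff:
  assumes a: "a \<in> carrier (mat_cstar n A)"
  shows "cstar_pos (mat_cstar n A) a \<longleftrightarrow>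
    (\<forall>w\<in>\<Omega>. positive_semidefinite n (\<lambda>i j. ev (a i j) w))"
proof
  assume "cstar_pos (mat_cstar n A) a"
  then obtain b where b: "b \<in> carrier (mat_cstar n A)"
    and ab: "a = adj (mat_cstar n A) b \<otimes>\<^bsub>mat_cstar n A\<^esub> b"
    unfolding cstar_pos_def by blast
  have bm: "b i j \<in> carrier A" if "i < n" "j < n" for i j
    using b that by (simp add: mat_cstar_def)
  show "\<forall>w\<in>\<Omega>. positive_semidefinite n (\<lambda>i j. ev (a i j) w)"
    unfolding positive_semidefinite_def
  proof (intro ballI allI)
    fix w v assume w: "w \<in> \<Omega>"
    have aij: "ev (a i j) w = (\<Sum>k<n. cnj (ev (b k i) w) * ev (b k j) w)" if ij: "i < n" "j < n" for i j
    proof -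
      have "a i j = (\<Oplus>k\<in>{..<n}. mat_of A n (\<lambda>i j. adj A (b j i)) i k \<otimes> b k j)"
        unfolding ab using ij by (simp add: mat_cstar_def mat_of_def)
      also have "ev \<dots> w = (\<Sum>k<n. ev (mat_of A n (\<lambda>i j. adj A (b j i)) i k \<otimes> b k j) w)"
        using ij w bm by (intro ev_finsum) (simp_all add: mat_of_def mem)
      also have "\<dots> = (\<Sum>k<n. cnj (ev (b k i) w) * ev (b k j) w)"
        using ij w bm by (intro sum.cong) (simp_all add: mat_of_def mem evs)
      finally show ?thesis .
    qed
    have "sesq n (\<lambda>i j. ev (a i j) w) v v
        = (\<Sum>i<n. \<Sum>j<n. \<Sum>k<n. cnj (ev (b k i) w * v i) * (ev (b k j) w * v j))"
      unfolding sesq_def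
      by (intro sum.cong refl) (simp add: aij sum_distrib_left sum_distrib_right mult_ac)
    also have "\<dots> = (\<Sum>i<n. \<Sum>k<n. \<Sum>j<n. cnj (ev (b k i) w * v i) * (ev (b k j) w * v j))"
      by (rule sum.cong[OF refl]) (rule sum.swap)
    also have "\<dots> = (\<Sum>k<n. \<Sum>i<n. \<Sum>j<n. cnj (ev (b k i) w * v i) * (ev (b k j) w * v j))"
      by (rule sum.swap)
    also have "\<dots> = (\<Sum>k<n. cnj (\<Sum>i<n. ev (b k i) w * v i) * (\<Sum>j<n. ev (b k j) w * v j))"
      by (simp add: sum_product)
    also have "\<dots> = of_real (\<Sum>k<n. (cmod (\<Sum>i<n. ev (b k i) w * v i))\<^sup>2)"
      by (simp only: cnj_mult_self of_real_sum)
    also have "\<dots> \<in> \<real>\<^sub>\<ge>\<^sub>0" unfolding nonneg_Reals_of_real_iff by (simp add: sum_nonneg)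
    finally show "sesq n (\<lambda>i j. ev (a i j) w) v v \<in> \<real>\<^sub>\<ge>\<^sub>0" .
  qed
next
  assume psd: "\<forall>w\<in>\<Omega>. positive_semidefinite n (\<lambda>i j. ev (a i j) w)"
  have am: "a i j \<in> carrier A" if "i < n" "j < n" for i j
    using a that by (simp add: mat_cstar_def)
  have a0: "mat_of A n a = a" using a by (simp add: mat_cstar_def)
  have "\<exists>B. \<forall>w\<in>\<Omega>. cmod (ev (a i j) w) \<le> B" if "i < n" "j < n" for i j
    by (rule ev_bounded[OF am[OF that]])
  then obtain B where B: "\<And>i j w. i < n \<Longrightarrow> j < n \<Longrightarrow> w \<in> \<Omega> \<Longrightarrow> cmod (ev (a i j) w) \<le> B i j"
    by metis
  define b where "b = (\<Sum>i<n. \<Sum>j<n. \<bar>B i j\<bar>)"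
  have b: "cmod (ev (a i j) w) \<le> b" if "i < n" "j < n" "w \<in> \<Omega>" for i j w
  proof -
    have "\<bar>B i j\<bar> \<le> (\<Sum>j<n. \<bar>B i j\<bar>)"
      using that by (intro member_le_sum[of j "{..<n}" "\<lambda>j. \<bar>B i j\<bar>"]) auto
    also have "\<dots> \<le> b"
      unfolding b_def using that
      by (intro member_le_sum[of i "{..<n}" "\<lambda>i. \<Sum>j<n. \<bar>B i j\<bar>"]) (auto intro: sum_nonneg)
    finally show ?thesis using B[OF that] by linarith
  qed
  define R where "R = \<bar>real n * b\<bar> + 1"
  have R: "real n * b \<le> R" "0 < R" by (auto simp: R_def)
  define x where "x w i j = (if i = j then 1 else 0) - ev (a i j) w / of_real R" for w i j
  have x: "hermitian n (x w)" "\<And>v. 0 \<le> Re (sesq n (x w) v v)"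
      "\<And>v. Re (sesq n (x w) v v) \<le> (\<Sum>i<n. (cmod (v i))\<^sup>2)" if "w \<in> \<Omega>" for w
    using bounded_matrix_shift[of n "\<lambda>i j. ev (a i j) w" b R] psd b that R
    unfolding x_def by blast+
  have rx: "represented (\<lambda>w. x w i j)" if "i < n" "j < n" for i j
    using represented_add[OF represented_const[of "if i = j then 1 else 0"]
        represented_mult[OF represented_const[of "- 1 / of_real R"] represented_ev[OF am[OF that]]]]
    by (simp add: x_def)
  have rp: "represented (\<lambda>w. mpow n (x w) k i j)" if "i < n" "j < n" for i j k
    using that
  proof (induction k arbitrary: i)
    case 0
    then show ?case using represented_const by simp
  next
    case (Suc k)
    have "represented (\<lambda>w. \<Sum>l<n. x w i l * mpow n (x w) k l j)"
      using Suc by (intro represented_sum represented_mult rx) auto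
    then show ?case by simp
  qed
  define S where "S w i j = (\<Sum>k. of_real (sqrt_coeff k) * mpow n (x w) k i j)" for w i j
  have rS: "represented (\<lambda>w. S w i j)" if ij: "i < n" "j < n" for i j
  proof (rule represented_limit)
    show "represented (\<lambda>w. \<Sum>k<N. of_real (sqrt_coeff k) * mpow n (x w) k i j)" for N
      using ij by (intro represented_sum represented_mult represented_const rp) auto
    show "uniform_limit \<Omega> (\<lambda>N w. \<Sum>k<N. of_real (sqrt_coeff k) * mpow n (x w) k i j)
        (\<lambda>w. S w i j) sequentially"
      unfolding S_def
    proof (rule Weierstrass_m_test)
      show "summable (\<lambda>k. \<bar>sqrt_coeff k\<bar>)" by (rule sqrt_coeff_summable)
      show "norm (of_real (sqrt_coeff k) * mpow n (x w) k i j) \<le> \<bar>sqrt_coeff k\<bar>" if "w \<in> \<Omega>" for k w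
        using norm_mpow_le_1[OF x[OF that] ij, of k] by (simp add: norm_mult mult_left_le)
    qed
  qed
  have "\<exists>y\<in>carrier A. \<forall>w\<in>\<Omega>. ev y w = of_real (sqrt R) * S w i j" if "i < n" "j < n" for i j
    using represented_mult[OF represented_const rS[OF that]] unfolding represented_def .
  then obtain s where s: "\<And>i j. i < n \<Longrightarrow> j < n \<Longrightarrow> s i j \<in> carrier A"
    "\<And>i j w. i < n \<Longrightarrow> j < n \<Longrightarrow> w \<in> \<Omega> \<Longrightarrow> ev (s i j) w = of_real (sqrt R) * S w i j"
    by metis
  let ?M = "mat_cstar n A" and ?b = "mat_of A n s"
  have bM: "?b \<in> carrier ?M" by (rule mat_carrierI[OF s(1)])
  have "a i j = (adj ?M ?b \<otimes>\<^bsub>?M\<^esub> ?b) i j" for i j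
  proof (cases "i < n \<and> j < n")
    case True
    then have ij: "i < n" "j < n" by auto
    have eq: "(adj ?M ?b \<otimes>\<^bsub>?M\<^esub> ?b) i j = (\<Oplus>k\<in>{..<n}. mat_of A n (\<lambda>i j. adj A (mat_of A n s j i)) i k \<otimes> mat_of A n s k j)"
      using ij by (simp add: mat_cstar_def mat_of_def)
    have mem': "mat_of A n (\<lambda>i j. adj A (mat_of A n s j i)) i k \<otimes> mat_of A n s k j \<in> carrier A"
      if "k \<in> {..<n}" for k
      using that ij s(1) by (simp add: mat_of_def mem)
    show ?thesis
      unfolding eq
    proof (rule ev_eqI[OF am[OF ij] finsum_mem[OF finite_lessThan mem']])
      fix w assume w: "w \<in> \<Omega>"
      have "ev (\<Oplus>k\<in>{..<n}. mat_of A n (\<lambda>i j. adj A (mat_of A n s j i)) i k \<otimes> mat_of A n s k j) w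
          = (\<Sum>k<n. ev (mat_of A n (\<lambda>i j. adj A (mat_of A n s j i)) i k \<otimes> mat_of A n s k j) w)"
        by (rule ev_finsum(2)[OF finite_lessThan mem' w])
      also have "\<dots> = (\<Sum>k<n. of_real R * (S w i k * S w k j))"
      proof (rule sum.cong[OF refl])
        fix k assume "k \<in> {..<n}"
        then have k: "k < n" by simp
        have "ev (mat_of A n (\<lambda>i j. adj A (mat_of A n s j i)) i k \<otimes> mat_of A n s k j) w
            = cnj (ev (s k i) w) * ev (s k j) w"
          using k ij s(1) w by (simp add: mat_of_def mem evs)
        also have "\<dots> = (of_real (sqrt R) * of_real (sqrt R)) * (cnj (S w k i) * S w k j)"
          using s(2) k ij w by simp
        also have "of_real (sqrt R) * of_real (sqrt R) = (of_real R :: complex)"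
          unfolding of_real_mult[symmetric] using R(2) by simp
        also have "cnj (S w k i) = S w i k"
          unfolding S_def by (rule sqrt_series_square(1)[OF x[OF w] k ij(1)])
        finally show "ev (mat_of A n (\<lambda>i j. adj A (mat_of A n s j i)) i k \<otimes> mat_of A n s k j) w
            = of_real R * (S w i k * S w k j)" .
      qed
      also have "\<dots> = of_real R * (\<Sum>k<n. S w i k * S w k j)" by (simp add: sum_distrib_left)
      also have "(\<Sum>k<n. S w i k * S w k j) = (if i = j then 1 else 0) - x w i j"
        unfolding S_def by (rule sqrt_series_square(2)[OF x[OF w] ij])
      also have "of_real R * ((if i = j then 1 else 0) - x w i j) = ev (a i j) w"
        using R(2) by (simp add: x_def)
      finally show "ev (a i j) w
        = ev (\<Oplus>k\<in>{..<n}. mat_of A n (\<lambda>i j. adj A (mat_of A n s j i)) i k \<otimes> mat_of A n s k j) w" by simp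
    qed
  next
    case False
    then have "a i j = \<zero>" using fun_cong[OF fun_cong[OF a0, of i], of j] by (auto simp: mat_of_def)
    then show ?thesis using False by (auto simp: mat_cstar_def mat_of_def)
  qed
  then have "a = adj ?M ?b \<otimes>\<^bsub>?M\<^esub> ?b" by (intro ext)
  then show "cstar_pos ?M a" unfolding cstar_pos_def using bM by blast
qed

lemma unital_cstar_algebra_if_sup_norm:
  assumes "\<Omega> \<noteq> {}"
    and nrm: "\<And>x. x \<in> carrier A \<Longrightarrow> nrm A x = (SUP w\<in>\<Omega>. cmod (ev x w))"
  shows "unital_cstar_algebra A"
proof -
  interpret cring A by (rule is_cring)
  interpret module complex_ring A by (rule is_module)
  have bdd: "bdd_above ((\<lambda>w. cmod (ev x w)) ` \<Omega>)" if "x \<in> carrier A" for x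
    using ev_bounded[OF that] by (auto simp: bdd_above_def)
  have up: "cmod (ev x w) \<le> nrm A x" if "x \<in> carrier A" "w \<in> \<Omega>" for x w
    unfolding nrm[OF that(1)] by (rule cSUP_upper[OF that(2) bdd[OF that(1)]])
  have least: "nrm A x \<le> c" if "x \<in> carrier A" "\<And>w. w \<in> \<Omega> \<Longrightarrow> cmod (ev x w) \<le> c" for x c
    unfolding nrm[OF that(1)] by (rule cSUP_least[OF assms(1) that(2)])
  have nn: "0 \<le> nrm A x" if "x \<in> carrier A" for x
    using up[OF that] assms(1) norm_ge_zero order_trans by blast
  show ?thesis
  proof (unfold_locales)
    fix x assume x: "x \<in> carrier A"
    show "0 \<le> nrm A x" by (rule nn[OF x])
    show "adj A x \<in> carrier A" "adj A (adj A x) = x"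
      by (simp add: mem x) (rule ev_eqI, simp_all add: mem evs x)
    show "nrm A x = 0 \<longleftrightarrow> x = \<zero>"
    proof
      assume "nrm A x = 0"
      then have "ev x w = 0" if "w \<in> \<Omega>" for w using up[OF x that] by simp
      then show "x = \<zero>" by (intro ev_eqI) (simp_all add: x mem evs)
    next
      assume "x = \<zero>"
      then have "nrm A x \<le> 0" by (intro least) (simp_all add: mem evs)
      then show "nrm A x = 0" using nn[OF x] by simp
    qed
    show "nrm A (adj A x \<otimes> x) = (nrm A x)\<^sup>2"
    proof (rule antisym)
      show "nrm A (adj A x \<otimes> x) \<le> (nrm A x)\<^sup>2"
        by (rule least) (simp_all add: mem evs x norm_mult power2_eq_square mult_mono up nn)
      have "nrm A x \<le> sqrt (nrm A (adj A x \<otimes> x))"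
      proof (rule least[OF x])
        fix w assume w: "w \<in> \<Omega>"
        have "(cmod (ev x w))\<^sup>2 = cmod (ev (adj A x \<otimes> x) w)"
          using x w by (simp add: mem evs norm_mult power2_eq_square)
        also have "\<dots> \<le> nrm A (adj A x \<otimes> x)" using up x w by (simp add: mem)
        finally show "cmod (ev x w) \<le> sqrt (nrm A (adj A x \<otimes> x))" by (rule real_le_rsqrt)
      qed
      then have "(nrm A x)\<^sup>2 \<le> (sqrt (nrm A (adj A x \<otimes> x)))\<^sup>2"
        using nn[OF x] by (intro power_mono)
      then show "(nrm A x)\<^sup>2 \<le> nrm A (adj A x \<otimes> x)" using nn x by (simp add: mem)
    qed
    fix c
    show "adj A (c \<odot> x) = cnj c \<odot> adj A x" by (rule ev_eqI) (simp_all add: mem evs x)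
    show "nrm A (c \<odot> x) = cmod c * nrm A x"
    proof (rule antisym)
      show "nrm A (c \<odot> x) \<le> cmod c * nrm A x"
        by (rule least) (simp_all add: mem evs x norm_mult mult_left_mono up)
      show "cmod c * nrm A x \<le> nrm A (c \<odot> x)"
      proof (cases "c = 0")
        case False
        have "nrm A x \<le> nrm A (c \<odot> x) / cmod c"
        proof (rule least[OF x])
          fix w assume w: "w \<in> \<Omega>"
          have "cmod c * cmod (ev x w) \<le> nrm A (c \<odot> x)"
            using up[of "c \<odot> x" w] x w by (simp add: mem evs norm_mult)
          then show "cmod (ev x w) \<le> nrm A (c \<odot> x) / cmod c"
            using False by (simp add: field_simps)
        qed
        then show ?thesis using False by (simp add: field_simps)
      qed (simp add: nn mem x)
    qed
    fix y assume y: "y \<in> carrier A"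
    show "(c \<odot> x) \<otimes> y = c \<odot> (x \<otimes> y)" "x \<otimes> (c \<odot> y) = c \<odot> (x \<otimes> y)"
      "adj A (x \<oplus> y) = adj A x \<oplus> adj A y" "adj A (x \<otimes> y) = adj A y \<otimes> adj A x"
      by (rule ev_eqI, simp_all add: mem evs x y)+
    show "nrm A (x \<oplus> y) \<le> nrm A x + nrm A y"
    proof (rule least)
      fix w assume w: "w \<in> \<Omega>"
      show "cmod (ev (x \<oplus> y) w) \<le> nrm A x + nrm A y"
        using norm_triangle_ineq[of "ev x w" "ev y w"] up[OF x w] up[OF y w] x y w
        by (simp add: evs)
    qed (simp add: mem x y)
    show "nrm A (x \<otimes> y) \<le> nrm A x * nrm A y"
      by (rule least) (simp_all add: mem evs x y norm_mult mult_mono up nn)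
  next
    fix f :: "nat \<Rightarrow> 'a"
    assume f: "\<And>n. f n \<in> carrier A"
      and cauchy: "\<And>e. 0 < e \<Longrightarrow> \<exists>N. \<forall>m\<ge>N. \<forall>n\<ge>N. nrm A (f m \<ominus> f n) < e"
    have "uniformly_Cauchy_on \<Omega> (\<lambda>n. ev (f n))"
      unfolding uniformly_Cauchy_on_def
    proof (intro allI impI)
      fix e :: real assume "0 < e"
      then obtain N where N: "\<And>m n. m \<ge> N \<Longrightarrow> n \<ge> N \<Longrightarrow> nrm A (f m \<ominus> f n) < e" using cauchy by metis
      have "dist (ev (f m) w) (ev (f n) w) < e" if "w \<in> \<Omega>" "m \<ge> N" "n \<ge> N" for w m n
        using up[of "f m \<ominus> f n" w] N[OF that(2,3)] f that(1) by (simp add: ev_minus dist_norm)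
      then show "\<exists>M. \<forall>w\<in>\<Omega>. \<forall>m\<ge>M. \<forall>n\<ge>M. dist (ev (f m) w) (ev (f n) w) < e" by blast
    qed
    then obtain u where u: "uniform_limit \<Omega> (\<lambda>n. ev (f n)) u sequentially"
      using Cauchy_uniformly_convergent unfolding uniformly_convergent_on_def by blast
    from ev_limit[OF f u] obtain y where y: "y \<in> carrier A" "\<And>w. w \<in> \<Omega> \<Longrightarrow> ev y w = u w" by blast
    have "(\<lambda>n. nrm A (f n \<ominus> y)) \<longlonglongrightarrow> 0"
    proof (rule LIMSEQ_I)
      fix e :: real assume "0 < e"
      then have "\<forall>\<^sub>F n in sequentially. \<forall>w\<in>\<Omega>. dist (ev (f n) w) (u w) < e / 2"
        using u half_gt_zero unfolding uniform_limit_iff by blast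
      then obtain N where N: "\<And>n w. n \<ge> N \<Longrightarrow> w \<in> \<Omega> \<Longrightarrow> dist (ev (f n) w) (u w) < e / 2"
        unfolding eventually_sequentially by blast
      have "nrm A (f n \<ominus> y) \<le> e / 2" if "n \<ge> N" for n
      proof (rule least)
        fix w assume w: "w \<in> \<Omega>"
        show "cmod (ev (f n \<ominus> y) w) \<le> e / 2"
          using N[OF that w] f y w by (simp add: ev_minus dist_norm)
      qed (simp add: f y)
      then have "norm (nrm A (f n \<ominus> y) - 0) < e" if "n \<ge> N" for n
        using \<open>0 < e\<close> nn[of "f n \<ominus> y"] f y(1) that by fastforce
      then show "\<exists>N. \<forall>n\<ge>N. norm (nrm A (f n \<ominus> y) - 0) < e" by blast
    qed
    then show "\<exists>x\<in>carrier A. (\<lambda>n. nrm A (f n \<ominus> x)) \<longlonglongrightarrow> 0" using y(1) by blast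
  qed
qed

end

lemma complex_submoduleD:
  assumes "submodule S complex_ring A"
  shows "S \<subseteq> carrier A" "\<zero>\<^bsub>A\<^esub> \<in> S"
    "\<And>x y. x \<in> S \<Longrightarrow> y \<in> S \<Longrightarrow> x \<oplus>\<^bsub>A\<^esub> y \<in> S"
    "\<And>c x. x \<in> S \<Longrightarrow> c \<odot>\<^bsub>A\<^esub> x \<in> S"
proof -
  interpret submodule S complex_ring A by (rule assms)
  show "S \<subseteq> carrier A" using subset by simp
  show "\<zero>\<^bsub>A\<^esub> \<in> S" using one_closed by simp
  show "x \<oplus>\<^bsub>A\<^esub> y \<in> S" if "x \<in> S" "y \<in> S" for x y using m_closed[OF that] by simp
  show "c \<odot>\<^bsub>A\<^esub> x \<in> S" if "x \<in> S" for c x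
    using smult_closed[OF _ that, of c] by (simp add: complex_ring_def)
qed

lemma (in function_algebra) complex_submoduleI:
  assumes S: "S \<subseteq> carrier A" "\<zero> \<in> S" "\<And>x y. x \<in> S \<Longrightarrow> y \<in> S \<Longrightarrow> x \<oplus> y \<in> S"
    "\<And>c x. x \<in> S \<Longrightarrow> c \<odot> x \<in> S"
  shows "submodule S complex_ring A"
proof -
  interpret cring A by (rule is_cring)
  interpret module complex_ring A by (rule is_module)
  show ?thesis
  proof (rule submoduleI[OF S(1,2)])
    fix x assume x: "x \<in> S"
    then have xA: "x \<in> carrier A" using S(1) by blast
    have "\<ominus> x = (-1) \<odot> x"
    proof (rule ev_eqI)
      fix w assume w: "w \<in> \<Omega>"
      have "ev (\<ominus> x) w = ev (\<zero> \<ominus> x) w" using xA by (simp add: a_minus_def)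
      also have "\<dots> = ev ((-1) \<odot> x) w" using xA w zero_mem by (simp add: ev_minus ev_zero ev_smult)
      finally show "ev (\<ominus> x) w = ev ((-1) \<odot> x) w" .
    qed (use xA mem in simp_all)
    then show "\<ominus> x \<in> S" using S(4)[OF x] by simp
  qed (use S in simp_all)
qed

lemma unital_linearD:
  assumes "unital_linear A S B T \<phi>"
  shows "\<And>x. x \<in> S \<Longrightarrow> \<phi> x \<in> T"
    "\<And>x y. x \<in> S \<Longrightarrow> y \<in> S \<Longrightarrow> \<phi> (x \<oplus>\<^bsub>A\<^esub> y) = \<phi> x \<oplus>\<^bsub>B\<^esub> \<phi> y"
    "\<And>c x. x \<in> S \<Longrightarrow> \<phi> (c \<odot>\<^bsub>A\<^esub> x) = c \<odot>\<^bsub>B\<^esub> \<phi> x"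
    "\<phi> \<one>\<^bsub>A\<^esub> = \<one>\<^bsub>B\<^esub>"
  using assms unfolding unital_linear_def by blast+

text \<open>In terms of values only, a linear map commutes with finite linear combinations. This moves quadratic
  forms through it.\<close>

lemma linear_combination_image:
  assumes A: "function_algebra A \<Omega>1 ev1" and B: "function_algebra B \<Omega>2 ev2"
    and S: "submodule S complex_ring A" and T: "T \<subseteq> carrier B"
    and \<phi>: "unital_linear A S B T \<phi>" and a: "finite K" "\<And>k. k \<in> K \<Longrightarrow> a k \<in> S"
  shows "\<exists>x\<in>S. (\<forall>w\<in>\<Omega>1. ev1 x w = (\<Sum>k\<in>K. c k * ev1 (a k) w)) \<and>
    (\<forall>w\<in>\<Omega>2. ev2 (\<phi> x) w = (\<Sum>k\<in>K. c k * ev2 (\<phi> (a k)) w))"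
proof -
  interpret A: function_algebra A \<Omega>1 ev1 by (rule A)
  interpret B: function_algebra B \<Omega>2 ev2 by (rule B)
  note SD = complex_submoduleD[OF S] and \<phi>D = unital_linearD[OF \<phi>]
  have SA: "x \<in> carrier A" if "x \<in> S" for x using SD(1) that by blast
  have TB: "\<phi> x \<in> carrier B" if "x \<in> S" for x using \<phi>D(1)[OF that] T by blast
  show ?thesis
    using a
  proof (induction K rule: finite_induct)
    case empty
    let ?x = "0 \<odot>\<^bsub>A\<^esub> \<zero>\<^bsub>A\<^esub>"
    have "?x \<in> S" using SD(2,4) by blast
    moreover have "ev1 ?x w = 0" if "w \<in> \<Omega>1" for w
      using that by (simp add: A.evs A.mem)
    moreover have "ev2 (\<phi> ?x) w = 0" if "w \<in> \<Omega>2" for w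
      using that by (simp add: \<phi>D(3)[OF SD(2)] B.evs TB[OF SD(2)])
    ultimately show ?case by auto
  next
    case (insert k K)
    then obtain x where x: "x \<in> S" "\<And>w. w \<in> \<Omega>1 \<Longrightarrow> ev1 x w = (\<Sum>k\<in>K. c k * ev1 (a k) w)"
      "\<And>w. w \<in> \<Omega>2 \<Longrightarrow> ev2 (\<phi> x) w = (\<Sum>k\<in>K. c k * ev2 (\<phi> (a k)) w)" by auto
    have ak: "a k \<in> S" using insert by simp
    let ?y = "(c k \<odot>\<^bsub>A\<^esub> a k) \<oplus>\<^bsub>A\<^esub> x"
    have ca: "c k \<odot>\<^bsub>A\<^esub> a k \<in> S" by (rule SD(4)[OF ak])
    have "?y \<in> S" by (rule SD(3)[OF ca x(1)])
    moreover have "ev1 ?y w = (\<Sum>k\<in>insert k K. c k * ev1 (a k) w)" if "w \<in> \<Omega>1" for w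
      using that x(1,2) ak ca insert(1,2) by (simp add: SA A.evs)
    moreover have "ev2 (\<phi> ?y) w = (\<Sum>k\<in>insert k K. c k * ev2 (\<phi> (a k)) w)" if "w \<in> \<Omega>2" for w
      using that x(1,3) ak ca insert(1,2) by (simp add: TB B.evs B.mem \<phi>D(2,3))
    ultimately show ?case by blast
  qed
qed

text \<open>For a vector \<open>v\<close> of scalars, the form of the image matrix at \<open>v\<close> is the image of the form of the
  matrix at \<open>v\<close>, which is a positive element. Pointwise, such vectors suffice to test positivity.\<close>

lemma completely_positive_if_positive:
  assumes A: "function_algebra (alg V) \<Omega>1 ev1" and B: "function_algebra (alg W) \<Omega>2 ev2"
    and S: "submodule (sys V) complex_ring (alg V)" and T: "sys W \<subseteq> carrier (alg W)"
    and \<phi>: "unital_linear (alg V) (sys V) (alg W) (sys W) \<phi>"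
    and pos: "\<And>x w. x \<in> sys V \<Longrightarrow> (\<And>w. w \<in> \<Omega>1 \<Longrightarrow> ev1 x w \<in> \<real>\<^sub>\<ge>\<^sub>0) \<Longrightarrow> w \<in> \<Omega>2 \<Longrightarrow> ev2 (\<phi> x) w \<in> \<real>\<^sub>\<ge>\<^sub>0"
  shows "completely_positive V W \<phi>"
  unfolding completely_positive_def
proof (intro allI ballI impI)
  fix n a assume a: "a \<in> mat_sys n V" and posa: "cstar_pos (mat_cstar n (alg V)) a"
  interpret A: function_algebra "alg V" \<Omega>1 ev1 by (rule A)
  interpret B: function_algebra "alg W" \<Omega>2 ev2 by (rule B)
  have aV: "a \<in> carrier (mat_cstar n (alg V))" and aS: "\<And>i j. i < n \<Longrightarrow> j < n \<Longrightarrow> a i j \<in> sys V"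
    using a by (simp_all add: mat_sys_def)
  have psd: "positive_semidefinite n (\<lambda>i j. ev1 (a i j) w)" if "w \<in> \<Omega>1" for w
    using posa that A.cstar_pos_mat_iff[OF aV] by blast
  let ?b = "mat_of (alg W) n (\<lambda>i j. \<phi> (a i j))"
  have bW: "?b \<in> carrier (mat_cstar n (alg W))"
    using unital_linearD(1)[OF \<phi> aS] T by (intro B.mat_carrierI) blast
  show "cstar_pos (mat_cstar n (alg W)) ?b"
    unfolding B.cstar_pos_mat_iff[OF bW] positive_semidefinite_def
  proof (intro ballI allI)
    fix w and v :: "nat \<Rightarrow> complex" assume w: "w \<in> \<Omega>2"
    let ?c = "\<lambda>(i, j). cnj (v i) * v j"
    obtain x where x: "x \<in> sys V"
      "\<And>w. w \<in> \<Omega>1 \<Longrightarrow> ev1 x w = (\<Sum>k\<in>{..<n} \<times> {..<n}. ?c k * ev1 (case k of (i, j) \<Rightarrow> a i j) w)"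
      "\<And>w. w \<in> \<Omega>2 \<Longrightarrow> ev2 (\<phi> x) w
        = (\<Sum>k\<in>{..<n} \<times> {..<n}. ?c k * ev2 (\<phi> (case k of (i, j) \<Rightarrow> a i j)) w)"
      using linear_combination_image[OF A B S T \<phi>, of "{..<n} \<times> {..<n}" "\<lambda>(i, j). a i j" ?c] aS
      by auto
    have "ev1 x w = sesq n (\<lambda>i j. ev1 (a i j) w) v v" if "w \<in> \<Omega>1" for w
      unfolding x(2)[OF that] sesq_def sum.cartesian_product
      by (rule sum.cong) (auto simp: mult_ac)
    then have "ev1 x w \<in> \<real>\<^sub>\<ge>\<^sub>0" if "w \<in> \<Omega>1" for w
      using psd[OF that] that unfolding positive_semidefinite_def by simp
    then have "ev2 (\<phi> x) w \<in> \<real>\<^sub>\<ge>\<^sub>0" by (rule pos[OF x(1) _ w])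
    moreover have "ev2 (\<phi> x) w = sesq n (\<lambda>i j. ev2 (?b i j) w) v v"
      unfolding x(3)[OF w] sesq_def sum.cartesian_product
      by (rule sum.cong) (auto simp: mult_ac mat_of_def)
    ultimately show "sesq n (\<lambda>i j. ev2 (?b i j) w) v v \<in> \<real>\<^sub>\<ge>\<^sub>0" by simp
  qed
qed

text \<open>The case of matrices of size 1.\<close>

lemma positive_if_completely_positive:
  assumes A: "function_algebra (alg V) \<Omega>1 ev1" and B: "function_algebra (alg W) \<Omega>2 ev2"
    and S: "sys V \<subseteq> carrier (alg V)" and T: "\<phi> x \<in> carrier (alg W)"
    and cp: "completely_positive V W \<phi>"
    and x: "x \<in> sys V" "\<And>w. w \<in> \<Omega>1 \<Longrightarrow> ev1 x w \<in> \<real>\<^sub>\<ge>\<^sub>0" and w: "w \<in> \<Omega>2"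
  shows "ev2 (\<phi> x) w \<in> \<real>\<^sub>\<ge>\<^sub>0"
proof -
  interpret A: function_algebra "alg V" \<Omega>1 ev1 by (rule A)
  interpret B: function_algebra "alg W" \<Omega>2 ev2 by (rule B)
  have psd1: "positive_semidefinite 1 M \<longleftrightarrow> M 0 0 \<in> \<real>\<^sub>\<ge>\<^sub>0" for M
  proof
    assume "positive_semidefinite 1 M"
    then have "sesq 1 M (\<lambda>_. 1) (\<lambda>_. 1) \<in> \<real>\<^sub>\<ge>\<^sub>0" unfolding positive_semidefinite_def by blast
    then show "M 0 0 \<in> \<real>\<^sub>\<ge>\<^sub>0" by (simp add: sesq_def)
  next
    assume M: "M 0 0 \<in> \<real>\<^sub>\<ge>\<^sub>0"
    have "sesq 1 M v v = of_real ((cmod (v 0))\<^sup>2) * M 0 0" for v :: "nat \<Rightarrow> complex"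
      unfolding sesq_def cnj_mult_self[symmetric] by simp
    moreover have "of_real ((cmod (v 0))\<^sup>2) * M 0 0 \<in> \<real>\<^sub>\<ge>\<^sub>0" for v :: "nat \<Rightarrow> complex"
      by (rule nonneg_Reals_mult_I[OF _ M]) (simp only: nonneg_Reals_of_real_iff zero_le_power2)
    ultimately show "positive_semidefinite 1 M"
      unfolding positive_semidefinite_def by (simp only: simp_thms)
  qed
  let ?a = "mat_of (alg V) 1 (\<lambda>_ _. x)"
  have xV: "x \<in> carrier (alg V)" using x S by blast
  have aV: "?a \<in> carrier (mat_cstar 1 (alg V))" by (rule A.mat_carrierI[OF xV])
  moreover have "?a \<in> mat_sys 1 V" using aV x(1) by (simp add: mat_sys_def mat_of_def)
  moreover have "cstar_pos (mat_cstar 1 (alg V)) ?a"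
    unfolding A.cstar_pos_mat_iff[OF aV] psd1 using x(2) by (simp add: mat_of_def)
  ultimately have pos: "cstar_pos (mat_cstar 1 (alg W)) (mat_of (alg W) 1 (\<lambda>i j. \<phi> (?a i j)))"
    using cp unfolding completely_positive_def by blast
  have bW: "mat_of (alg W) 1 (\<lambda>i j. \<phi> (?a i j)) \<in> carrier (mat_cstar 1 (alg W))"
    by (rule B.mat_carrierI) (simp add: mat_of_def T)
  show ?thesis
    using pos w unfolding B.cstar_pos_mat_iff[OF bW] psd1 by (simp add: mat_of_def)
qed

lemma function_algebra_cfun:
  assumes "compact_space T"
  shows "function_algebra (cfun_alg T) (topspace T) (\<lambda>f. f)"
proof
  have bounded: "\<exists>B. \<forall>w\<in>topspace T. cmod (f w) \<le> B" if "continuous_map T euclidean f" for f :: "'a \<Rightarrow> complex"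
  proof -
    have "compactin euclidean (f ` topspace T)"
      using image_compactin[OF assms[unfolded compact_space_def] that] .
    then have "bounded (f ` topspace T)" by (simp add: compact_imp_bounded)
    then show ?thesis unfolding bounded_iff by blast
  qed
  show "\<exists>B. \<forall>w\<in>topspace T. cmod (x w) \<le> B" if "x \<in> carrier (cfun_alg T)" for x
    using bounded that by (simp add: cfun_alg_def)
  fix x :: "nat \<Rightarrow> 'a \<Rightarrow> complex" and u
  assume x: "\<And>n. x n \<in> carrier (cfun_alg T)" and lim: "uniform_limit (topspace T) x u sequentially"
  let ?u = "\<lambda>w. if w \<in> topspace T then u w else 0"
  have "continuous_map T Met_TC.mtopology ?u"
  proof (rule Met_TC.continuous_map_uniform_limit)
    show "\<forall>\<^sub>F n in sequentially. continuous_map T Met_TC.mtopology (x n)"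
      using x by (simp add: cfun_alg_def)
    show "\<forall>\<^sub>F n in sequentially. \<forall>w\<in>topspace T. ?u w \<in> UNIV \<and> dist (x n w) (?u w) < e"
      if "0 < e" for e
      using lim that unfolding uniform_limit_iff by simp
  qed simp
  then have "?u \<in> carrier (cfun_alg T)" by (simp add: cfun_alg_def)
  then show "\<exists>y\<in>carrier (cfun_alg T). \<forall>w\<in>topspace T. y w = u w" by (intro bexI[of _ ?u]) simp_all
next
  fix x y assume xy: "x \<in> carrier (cfun_alg T)" "y \<in> carrier (cfun_alg T)"
    and eq: "\<And>w. w \<in> topspace T \<Longrightarrow> x w = y w"
  have "x w = y w" for w
    using eq[of w] xy by (cases "w \<in> topspace T") (simp_all add: cfun_alg_def)
  then show "x = y" by (rule ext)
next
  have "continuous_map T euclidean (indicator (topspace T) :: 'a \<Rightarrow> complex)"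
    by (rule continuous_map_eq[of _ _ "\<lambda>_. 1"]) simp_all
  then show "\<one>\<^bsub>cfun_alg T\<^esub> \<in> carrier (cfun_alg T)" by (simp add: cfun_alg_def)
next
  fix x c assume "x \<in> carrier (cfun_alg T)"
  then have x: "continuous_map T euclidean x" "\<And>w. w \<notin> topspace T \<Longrightarrow> x w = 0"
    by (simp_all add: cfun_alg_def)
  have c: "continuous_map T euclidean (\<lambda>w. g (x w))" if "continuous_on UNIV g" for g :: "complex \<Rightarrow> complex"
    using continuous_map_compose[OF x(1), of euclidean g] that by (simp add: o_def)
  have "continuous_map T euclidean (\<lambda>w. c * x w)" "continuous_map T euclidean (\<lambda>w. cnj (x w))"
    by (rule c, intro continuous_intros)+
  then show "c \<odot>\<^bsub>cfun_alg T\<^esub> x \<in> carrier (cfun_alg T)" "adj (cfun_alg T) x \<in> carrier (cfun_alg T)"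
    using x(2) by (simp_all add: cfun_alg_def)
next
  fix x y assume "x \<in> carrier (cfun_alg T)" "y \<in> carrier (cfun_alg T)"
  then have x: "continuous_map T euclidean x" "\<And>w. w \<notin> topspace T \<Longrightarrow> x w = 0"
    and y: "continuous_map T euclidean y" "\<And>w. w \<notin> topspace T \<Longrightarrow> y w = 0"
    by (simp_all add: cfun_alg_def)
  have "continuous_map T euclidean (\<lambda>w. x w + y w)"
    using x(1) y(1) by (rule continuous_map_add)
  moreover have "continuous_map T euclidean (\<lambda>w. x w * y w)"
    using x(1) y(1) by (simp add: continuous_map_atin tendsto_mult)
  ultimately show "x \<oplus>\<^bsub>cfun_alg T\<^esub> y \<in> carrier (cfun_alg T)" "x \<otimes>\<^bsub>cfun_alg T\<^esub> y \<in> carrier (cfun_alg T)"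
    using x(2) y(2) by (simp_all add: cfun_alg_def)
qed (simp_all add: cfun_alg_def)

lemma function_algebra_transport:
  assumes B: "function_algebra B \<Omega> val" and A: "unital_cstar_algebra A" and h: "h \<in> ring_iso A B"
    and smult: "\<And>c x. x \<in> carrier A \<Longrightarrow> h (c \<odot>\<^bsub>A\<^esub> x) = c \<odot>\<^bsub>B\<^esub> h x"
    and adj: "\<And>x. x \<in> carrier A \<Longrightarrow> h (adj A x) = adj B (h x)"
  shows "function_algebra A \<Omega> (\<lambda>x. val (h x))"
proof -
  interpret A: unital_cstar_algebra A by (rule A)
  interpret B: function_algebra B \<Omega> val by (rule B)
  have hh: "h \<in> ring_hom A B" and bij: "bij_betw h (carrier A) (carrier B)"
    using h by (simp_all add: ring_iso_def)
  note hm = ring_hom_memE[OF hh]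
  have h0: "h \<zero>\<^bsub>A\<^esub> = \<zero>\<^bsub>B\<^esub>"
    by (rule ring_hom_zero[OF hh unital_cstar_algebra.axioms(1)[OF A] cring.axioms(1)[OF B.is_cring]])
  show ?thesis
  proof
    fix x y assume xy: "x \<in> carrier A" "y \<in> carrier A" "\<And>w. w \<in> \<Omega> \<Longrightarrow> val (h x) w = val (h y) w"
    then have "h x = h y" by (intro B.ev_eqI) (simp_all add: hm)
    then show "x = y" using bij xy(1,2) by (meson bij_betw_imp_inj_on inj_onD)
  next
    fix x u
    assume "\<And>n :: nat. x n \<in> carrier A" and lim: "uniform_limit \<Omega> (\<lambda>n. val (h (x n))) u sequentially"
    then have "\<And>n. h (x n) \<in> carrier B" by (simp add: hm)
    from B.ev_limit[OF this lim] obtain z where z: "z \<in> carrier B" "\<forall>w\<in>\<Omega>. val z w = u w" by blast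
    then obtain y where "y \<in> carrier A" "h y = z" using bij by (metis bij_betw_imp_surj_on imageE)
    then show "\<exists>y\<in>carrier A. \<forall>w\<in>\<Omega>. val (h y) w = u w" using z by blast
  next
    fix x assume "x \<in> carrier A"
    then show "\<exists>Ba. \<forall>w\<in>\<Omega>. cmod (val (h x) w) \<le> Ba" by (intro B.ev_bounded) (simp add: hm)
  next
    fix c x assume "x \<in> carrier A"
    then show "c \<odot>\<^bsub>A\<^esub> x \<in> carrier A" using A.smult_closed[of c x] by (simp add: complex_ring_def)
  qed (simp_all add: hm h0 smult adj B.evs A.adj_closed)
qed

section \<open>Subsystems of \<open>\<ell>\<^sup>\<infinity>(\<Gamma>)\<close>\<close>

definition bounded_functions :: "('g, 'm) monoid_scheme \<Rightarrow> ('g \<Rightarrow> complex) set"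
  where "bounded_functions G =
    {u. (\<exists>B. \<forall>g. cmod (u g) \<le> B) \<and> (\<forall>g. g \<notin> carrier G \<longrightarrow> u g = 0)}"

definition left_translate :: "('g, 'm) monoid_scheme \<Rightarrow> 'g \<Rightarrow> ('g \<Rightarrow> complex) \<Rightarrow> 'g \<Rightarrow> complex"
  where "left_translate G s u = (\<lambda>g. if g \<in> carrier G then u (s \<otimes>\<^bsub>G\<^esub> g) else 0)"

text \<open>Embeds functions on the group in the type over which \<open>\<Gamma>\<close>-injectivity is tested.\<close>

definition inflate :: "('g \<Rightarrow> complex) \<Rightarrow> 'g \<Rightarrow> 'i \<Rightarrow> 'i \<Rightarrow> complex"
  where "inflate u = (\<lambda>g i j. u g)"

definition linf_alg :: "('g, 'm) monoid_scheme \<Rightarrow> ('g \<Rightarrow> 'i \<Rightarrow> 'i \<Rightarrow> complex) cstar"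
  where "linf_alg G =
    \<lparr>carrier = inflate ` bounded_functions G,
     monoid.mult = (\<lambda>F K g i j. F g i j * K g i j),
     one = inflate (indicator (carrier G)),
     ring.zero = (\<lambda>g i j. 0),
     add = (\<lambda>F K g i j. F g i j + K g i j),
     smult = (\<lambda>c F g i j. c * F g i j),
     adj = (\<lambda>F g i j. cnj (F g i j)),
     nrm = (\<lambda>F. SUP g\<in>carrier G. cmod (F g undefined undefined))\<rparr>"

text \<open>The subspace \<open>S\<close> of \<open>\<ell>\<^sup>\<infinity>(\<Gamma>)\<close> with the left translation action.\<close>

definition linf_system ::
    "('g, 'm) monoid_scheme \<Rightarrow> ('g \<Rightarrow> complex) set \<Rightarrow> ('g, 'g \<Rightarrow> 'i \<Rightarrow> 'i \<Rightarrow> complex) gsystem"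
  where "linf_system G S =
    \<lparr>alg = linf_alg G, sys = inflate ` S,
     act = (\<lambda>s. \<lambda>F\<in>inflate ` S. \<lambda>g i j. if g \<in> carrier G then F (inv\<^bsub>G\<^esub> s \<otimes>\<^bsub>G\<^esub> g) i j else 0)\<rparr>"

lemma bounded_functionsI:
  "(\<And>g. cmod (u g) \<le> B) \<Longrightarrow> (\<And>g. g \<notin> carrier G \<Longrightarrow> u g = 0) \<Longrightarrow> u \<in> bounded_functions G"
  unfolding bounded_functions_def by blast

lemma bounded_functionsE:
  assumes "u \<in> bounded_functions G"
  obtains B where "0 \<le> B" "\<And>g. cmod (u g) \<le> B" "\<And>g. g \<notin> carrier G \<Longrightarrow> u g = 0"
proof -
  obtain B where B: "\<And>g. cmod (u g) \<le> B" "\<And>g. g \<notin> carrier G \<Longrightarrow> u g = 0"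
    using assms unfolding bounded_functions_def by blast
  have "0 \<le> B" using B(1)[of undefined] norm_ge_zero order_trans by blast
  then show ?thesis using B that by blast
qed

lemma bounded_functions_add:
  assumes "u \<in> bounded_functions G" "v \<in> bounded_functions G"
  shows "(\<lambda>g. u g + v g) \<in> bounded_functions G"
proof -
  obtain B where B: "\<And>g. cmod (u g) \<le> B" "\<And>g. g \<notin> carrier G \<Longrightarrow> u g = 0"
    using bounded_functionsE[OF assms(1)] by metis
  obtain C where C: "\<And>g. cmod (v g) \<le> C" "\<And>g. g \<notin> carrier G \<Longrightarrow> v g = 0"
    using bounded_functionsE[OF assms(2)] by metis
  show ?thesis
  proof (rule bounded_functionsI[of _ "B + C"])
    show "cmod (u g + v g) \<le> B + C" for g
      using norm_triangle_ineq[of "u g" "v g"] B(1)[of g] C(1)[of g] by linarith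
  qed (simp add: B C)
qed

lemma bounded_functions_mult:
  assumes "u \<in> bounded_functions G" "v \<in> bounded_functions G"
  shows "(\<lambda>g. u g * v g) \<in> bounded_functions G"
proof -
  obtain B where B: "0 \<le> B" "\<And>g. cmod (u g) \<le> B" "\<And>g. g \<notin> carrier G \<Longrightarrow> u g = 0"
    using bounded_functionsE[OF assms(1)] by metis
  obtain C where C: "\<And>g. cmod (v g) \<le> C" using bounded_functionsE[OF assms(2)] by metis
  show ?thesis
    by (rule bounded_functionsI[of _ "B * C"]) (simp_all add: B C norm_mult mult_mono)
qed

lemma bounded_functions_one: "(indicator (carrier G) :: _ \<Rightarrow> complex) \<in> bounded_functions G"
  by (rule bounded_functionsI[of _ 1]) (simp_all add: indicator_def)

lemma bounded_functions_smult:
  assumes "u \<in> bounded_functions G"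
  shows "(\<lambda>g. c * u g) \<in> bounded_functions G"
proof -
  obtain B where B: "\<And>g. cmod (u g) \<le> B" "\<And>g. g \<notin> carrier G \<Longrightarrow> u g = 0"
    using bounded_functionsE[OF assms] by metis
  show ?thesis
    by (rule bounded_functionsI[of _ "cmod c * B"]) (simp_all add: B norm_mult mult_left_mono)
qed

lemma bounded_functions_map:
  assumes "u \<in> bounded_functions G" "\<And>z. cmod (f z) \<le> cmod z"
  shows "(\<lambda>g. f (u g)) \<in> bounded_functions G"
proof -
  obtain B where B: "\<And>g. cmod (u g) \<le> B" "\<And>g. g \<notin> carrier G \<Longrightarrow> u g = 0"
    using bounded_functionsE[OF assms(1)] by metis
  have "f 0 = 0" using assms(2)[of 0] by simp
  then show ?thesis
    using B assms(2) order_trans by (intro bounded_functionsI[of _ B]) (blast, simp)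
qed

lemma function_algebra_linf:
  "function_algebra (linf_alg G :: ('g \<Rightarrow> 'i \<Rightarrow> 'i \<Rightarrow> complex) cstar) (carrier G)
    (\<lambda>F g. F g undefined undefined)"
proof
  let ?A = "linf_alg G :: ('g \<Rightarrow> 'i \<Rightarrow> 'i \<Rightarrow> complex) cstar"
  have car: "carrier ?A = inflate ` bounded_functions G" by (simp add: linf_alg_def)
  show "\<zero>\<^bsub>?A\<^esub> \<in> carrier ?A"
    unfolding car
    by (rule image_eqI[of _ _ "\<lambda>g. 0"]) (auto simp: linf_alg_def inflate_def intro: bounded_functionsI[of _ 0])
  show "\<one>\<^bsub>?A\<^esub> \<in> carrier ?A"
  proof -
    have "\<one>\<^bsub>?A\<^esub> = inflate (indicator (carrier G))" by (simp add: linf_alg_def)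
    then show ?thesis unfolding car by (simp only: imageI[OF bounded_functions_one])
  qed
  show "x \<oplus>\<^bsub>?A\<^esub> y \<in> carrier ?A" if xy: "x \<in> carrier ?A" "y \<in> carrier ?A" for x y
  proof -
    obtain u v where "u \<in> bounded_functions G" "v \<in> bounded_functions G" "x = inflate u" "y = inflate v"
      using xy unfolding car by blast
    then show ?thesis
      unfolding car using bounded_functions_add
      by (intro image_eqI[of _ _ "\<lambda>g. u g + v g"]) (simp_all add: linf_alg_def inflate_def)
  qed
  show "x \<otimes>\<^bsub>?A\<^esub> y \<in> carrier ?A" if xy: "x \<in> carrier ?A" "y \<in> carrier ?A" for x y
  proof -
    obtain u v where "u \<in> bounded_functions G" "v \<in> bounded_functions G" "x = inflate u" "y = inflate v"
      using xy unfolding car by blast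
    then show ?thesis
      unfolding car using bounded_functions_mult
      by (intro image_eqI[of _ _ "\<lambda>g. u g * v g"]) (simp_all add: linf_alg_def inflate_def)
  qed
  fix x assume "x \<in> carrier ?A"
  then obtain u where u: "u \<in> bounded_functions G" "x = inflate u" unfolding car by blast
  show "c \<odot>\<^bsub>?A\<^esub> x \<in> carrier ?A" for c
    unfolding car using u bounded_functions_smult
    by (intro image_eqI[of _ _ "\<lambda>g. c * u g"]) (simp_all add: linf_alg_def inflate_def)
  show "adj ?A x \<in> carrier ?A"
    unfolding car using u bounded_functions_map[of u G cnj]
    by (intro image_eqI[of _ _ "\<lambda>g. cnj (u g)"]) (simp_all add: linf_alg_def inflate_def)
  show "\<exists>B. \<forall>w\<in>carrier G. cmod (x w undefined undefined) \<le> B"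
    using bounded_functionsE[OF u(1)] unfolding u(2) inflate_def by metis
next
  let ?A = "linf_alg G :: ('g \<Rightarrow> 'i \<Rightarrow> 'i \<Rightarrow> complex) cstar"
  have car: "carrier ?A = inflate ` bounded_functions G" by (simp add: linf_alg_def)
  fix x y assume "x \<in> carrier ?A" "y \<in> carrier ?A"
    and eq: "\<And>w. w \<in> carrier G \<Longrightarrow> x w undefined undefined = y w undefined undefined"
  then obtain u v where uv: "u \<in> bounded_functions G" "v \<in> bounded_functions G" "x = inflate u" "y = inflate v"
    unfolding car by blast
  have "u g = v g" for g
    using eq[of g] uv by (cases "g \<in> carrier G") (simp_all add: inflate_def bounded_functions_def)
  then show "x = y" unfolding uv by (simp add: inflate_def)
next
  let ?A = "linf_alg G :: ('g \<Rightarrow> 'i \<Rightarrow> 'i \<Rightarrow> complex) cstar"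
  have car: "carrier ?A = inflate ` bounded_functions G" by (simp add: linf_alg_def)
  fix x :: "nat \<Rightarrow> 'g \<Rightarrow> 'i \<Rightarrow> 'i \<Rightarrow> complex" and u
  assume x: "\<And>n. x n \<in> carrier ?A"
    and lim: "uniform_limit (carrier G) (\<lambda>n g. x n g undefined undefined) u sequentially"
  let ?u = "\<lambda>g. if g \<in> carrier G then u g else 0"
  obtain N where N: "\<And>g. g \<in> carrier G \<Longrightarrow> dist (x N g undefined undefined) (u g) < 1"
    using lim unfolding uniform_limit_iff eventually_sequentially by (meson order_refl zero_less_one)
  obtain v where v: "v \<in> bounded_functions G" "x N = inflate v" using x[of N] unfolding car by blast
  obtain B where B: "0 \<le> B" "\<And>g. cmod (v g) \<le> B" using bounded_functionsE[OF v(1)] by metis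
  have "?u \<in> bounded_functions G"
  proof (rule bounded_functionsI[of _ "B + 1"])
    show "cmod (?u g) \<le> B + 1" for g
    proof (cases "g \<in> carrier G")
      case True
      have "cmod (u g) \<le> cmod (v g) + dist (v g) (u g)"
        unfolding dist_norm using norm_triangle_ineq2[of "u g" "v g"] by (simp add: norm_minus_commute)
      also have "\<dots> \<le> B + 1" using N[OF True] B(2)[of g] unfolding v(2) inflate_def by linarith
      finally show ?thesis using True by simp
    qed (use B in simp)
  qed simp
  then have "inflate ?u \<in> carrier ?A" unfolding car by blast
  then show "\<exists>y\<in>carrier ?A. \<forall>w\<in>carrier G. y w undefined undefined = u w"
    by (intro bexI[of _ "inflate ?u"]) (simp_all add: inflate_def)
qed (simp_all add: linf_alg_def inflate_def)

context group begin

lemma unital_cstar_algebra_linf: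
  "unital_cstar_algebra (linf_alg G :: ('a \<Rightarrow> 'i \<Rightarrow> 'i \<Rightarrow> complex) cstar)"
  by (rule function_algebra.unital_cstar_algebra_if_sup_norm[OF function_algebra_linf])
     (use one_closed in \<open>auto simp: linf_alg_def\<close>)

lemma left_translate_mem:
  assumes "u \<in> bounded_functions G"
  shows "left_translate G s u \<in> bounded_functions G"
proof -
  obtain B where B: "0 \<le> B" "\<And>g. cmod (u g) \<le> B" using bounded_functionsE[OF assms] by metis
  show ?thesis
    by (rule bounded_functionsI[of _ B]) (simp_all add: left_translate_def B)
qed

lemma left_translate_left_translate:
  assumes "s \<in> carrier G" "t \<in> carrier G"
  shows "left_translate G s (left_translate G t u) = left_translate G (t \<otimes> s) u"
  using assms by (auto simp: left_translate_def m_assoc)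

lemma left_translate_one:
  assumes "u \<in> bounded_functions G"
  shows "left_translate G \<one> u = u"
  using assms by (auto simp: left_translate_def bounded_functions_def)

lemma linf_system_act:
  assumes "u \<in> S"
  shows "act (linf_system G S) s (inflate u) = inflate (left_translate G (inv s) u)"
  using assms by (auto simp: linf_system_def inflate_def left_translate_def)

lemma gamma_operator_system_linf:
  assumes S: "S \<subseteq> bounded_functions G" "indicator (carrier G) \<in> S"
    and add: "\<And>u v. u \<in> S \<Longrightarrow> v \<in> S \<Longrightarrow> (\<lambda>g. u g + v g) \<in> S"
    and smult: "\<And>c u. u \<in> S \<Longrightarrow> (\<lambda>g. c * u g) \<in> S"
    and cnj: "\<And>u. u \<in> S \<Longrightarrow> (\<lambda>g. cnj (u g)) \<in> S"
    and trans: "\<And>s u. s \<in> carrier G \<Longrightarrow> u \<in> S \<Longrightarrow> left_translate G s u \<in> S"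
  shows "gamma_operator_system G (linf_system G S :: ('a, 'a \<Rightarrow> 'i \<Rightarrow> 'i \<Rightarrow> complex) gsystem)"
proof -
  let ?V = "linf_system G S :: ('a, 'a \<Rightarrow> 'i \<Rightarrow> 'i \<Rightarrow> complex) gsystem"
  let ?A = "linf_alg G :: ('a \<Rightarrow> 'i \<Rightarrow> 'i \<Rightarrow> complex) cstar"
  interpret A: function_algebra ?A "carrier G" "\<lambda>F g. F g undefined undefined"
    by (rule function_algebra_linf)
  have V: "alg ?V = ?A" "sys ?V = inflate ` S" by (simp_all add: linf_system_def)
  have act: "act ?V s (inflate u) = inflate (left_translate G (inv s) u)" if "u \<in> S" for s u
    using that by (rule linf_system_act)
  have "submodule (inflate ` S) complex_ring ?A"
  proof (rule A.complex_submoduleI)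
    show "inflate ` S \<subseteq> carrier ?A" using S(1) by (auto simp: linf_alg_def)
    show "\<zero>\<^bsub>?A\<^esub> \<in> inflate ` S"
      using smult[OF S(2), of 0] by (intro image_eqI[of _ _ "\<lambda>g. 0"]) (simp_all add: linf_alg_def inflate_def)
    show "x \<oplus>\<^bsub>?A\<^esub> y \<in> inflate ` S" if "x \<in> inflate ` S" "y \<in> inflate ` S" for x y
    proof -
      from that obtain u v where "u \<in> S" "v \<in> S" "x = inflate u" "y = inflate v" by blast
      then show ?thesis using add
        by (intro image_eqI[of _ _ "\<lambda>g. u g + v g"]) (simp_all add: linf_alg_def inflate_def)
    qed
    show "c \<odot>\<^bsub>?A\<^esub> x \<in> inflate ` S" if "x \<in> inflate ` S" for c x
    proof -
      from that obtain u where "u \<in> S" "x = inflate u" by blast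
      then show ?thesis using smult
        by (intro image_eqI[of _ _ "\<lambda>g. c * u g"]) (simp_all add: linf_alg_def inflate_def)
    qed
  qed
  moreover have "adj ?A x \<in> inflate ` S" if "x \<in> inflate ` S" for x
  proof -
    from that obtain u where "u \<in> S" "x = inflate u" by blast
    then show ?thesis using cnj
      by (intro image_eqI[of _ _ "\<lambda>g. cnj (u g)"]) (simp_all add: linf_alg_def inflate_def)
  qed
  moreover have "\<one>\<^bsub>?A\<^esub> \<in> inflate ` S" using S(2) by (simp add: linf_alg_def)
  ultimately have os: "operator_system (alg ?V) (sys ?V)"
    unfolding operator_system_def V using unital_cstar_algebra_linf by blast
  have ga: "group_action G (sys ?V) (act ?V)"
  proof (rule group_actionI)
    fix s x assume s: "s \<in> carrier G" and "x \<in> sys ?V"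
    then obtain u where u: "u \<in> S" "x = inflate u" unfolding V by blast
    show "act ?V s x \<in> sys ?V" unfolding u(2) act[OF u(1)] V using trans[of "inv s" u] s u(1) by simp
  next
    fix s x assume "x \<notin> sys ?V"
    then show "act ?V s x = undefined" by (simp add: linf_system_def)
  next
    fix x assume "x \<in> sys ?V"
    then obtain u where u: "u \<in> S" "x = inflate u" unfolding V by blast
    show "act ?V \<one> x = x" unfolding u(2) act[OF u(1)]
      using left_translate_one u(1) S(1) by (simp add: subset_iff)
  next
    fix s t x assume st: "s \<in> carrier G" "t \<in> carrier G" and "x \<in> sys ?V"
    then obtain u where u: "u \<in> S" "x = inflate u" unfolding V by blast
    have "left_translate G (inv t) u \<in> S" using trans st u(1) by simp
    then show "act ?V (s \<otimes> t) x = act ?V s (act ?V t x)"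
      unfolding u(2) using u(1) st by (simp add: act left_translate_left_translate inv_mult_group)
  qed
  have ul: "unital_linear (alg ?V) (sys ?V) (alg ?V) (sys ?V) (act ?V s)" if s: "s \<in> carrier G" for s
    unfolding unital_linear_def
  proof (intro conjI ballI allI)
    show "act ?V s \<in> sys ?V \<rightarrow> sys ?V"
      using group_action.element_image[OF ga s] by blast
    have "left_translate G (inv s) (indicator (carrier G)) = (indicator (carrier G) :: 'a \<Rightarrow> complex)"
      using s by (auto simp: left_translate_def indicator_def)
    then show "act ?V s \<one>\<^bsub>alg ?V\<^esub> = \<one>\<^bsub>alg ?V\<^esub>"
      unfolding V using act[OF S(2), of s] by (simp add: linf_alg_def)
    fix x assume "x \<in> sys ?V"
    then obtain u where u: "u \<in> S" "x = inflate u" unfolding V by blast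
    show "act ?V s (c \<odot>\<^bsub>alg ?V\<^esub> x) = c \<odot>\<^bsub>alg ?V\<^esub> act ?V s x" for c
    proof -
      have "c \<odot>\<^bsub>?A\<^esub> inflate u = inflate (\<lambda>g. c * u g)" by (simp add: linf_alg_def inflate_def)
      then show ?thesis unfolding u(2) V act[OF u(1)] using act[OF smult[OF u(1)], of s c]
        by (simp add: linf_alg_def inflate_def left_translate_def if_distrib cong: if_cong)
    qed
    fix y assume "y \<in> sys ?V"
    then obtain v where v: "v \<in> S" "y = inflate v" unfolding V by blast
    have "inflate u \<oplus>\<^bsub>?A\<^esub> inflate v = inflate (\<lambda>g. u g + v g)" by (simp add: linf_alg_def inflate_def)
    then show "act ?V s (x \<oplus>\<^bsub>alg ?V\<^esub> y) = act ?V s x \<oplus>\<^bsub>alg ?V\<^esub> act ?V s y"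
      unfolding u(2) v(2) V act[OF u(1)] act[OF v(1)] using act[OF add[OF u(1) v(1)], of s]
      by (auto simp: linf_alg_def inflate_def left_translate_def fun_eq_iff)
  qed
  have pos1: "cstar_pos ?A (inflate (left_translate G s u))"
    if s: "s \<in> carrier G" and p: "cstar_pos ?A (inflate u)" for s u
  proof -
    from p obtain b where b: "b \<in> carrier ?A" "inflate u = adj ?A b \<otimes>\<^bsub>?A\<^esub> b" unfolding cstar_pos_def by blast
    then obtain v where v: "v \<in> bounded_functions G" "b = inflate v" by (auto simp: linf_alg_def)
    have "u g = cnj (v g) * v g" for g
      using fun_cong[OF fun_cong[OF fun_cong[OF b(2), of g], of undefined], of undefined]
      unfolding v(2) by (simp add: linf_alg_def inflate_def)
    then have "inflate (left_translate G s u)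
        = adj ?A (inflate (left_translate G s v)) \<otimes>\<^bsub>?A\<^esub> inflate (left_translate G s v)"
      by (auto simp: linf_alg_def inflate_def left_translate_def fun_eq_iff)
    moreover have "inflate (left_translate G s v) \<in> carrier ?A"
      using left_translate_mem[OF v(1)] by (simp add: linf_alg_def)
    ultimately show ?thesis unfolding cstar_pos_def by blast
  qed
  have pos: "cstar_pos (alg ?V) (act ?V s x) \<longleftrightarrow> cstar_pos (alg ?V) x"
    if s: "s \<in> carrier G" and x: "x \<in> sys ?V" for s x
  proof -
    from x obtain u where u: "u \<in> S" "x = inflate u" unfolding V by blast
    have uB: "u \<in> bounded_functions G" using u S by blast
    have "left_translate G s (left_translate G (inv s) u) = u"
      using s uB by (simp add: left_translate_left_translate left_translate_one)
    then show ?thesis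
      unfolding u(2) act[OF u(1)] V
      using pos1[of "inv s" u] pos1[OF s, of "left_translate G (inv s) u"] s by auto
  qed
  show ?thesis unfolding gamma_operator_system_def using os ga ul pos by blast
qed

end

section \<open>States on \<open>\<ell>\<^sup>\<infinity>(\<Gamma>)\<close> and their convolution\<close>

definition states :: "('g, 'm) monoid_scheme \<Rightarrow> (('g \<Rightarrow> complex) \<Rightarrow> complex) set"
  where "states G = {\<mu>.
    (\<forall>u. u \<notin> bounded_functions G \<longrightarrow> \<mu> u = 0) \<and>
    (\<forall>u\<in>bounded_functions G. \<forall>v\<in>bounded_functions G. \<mu> (\<lambda>g. u g + v g) = \<mu> u + \<mu> v) \<and>
    (\<forall>c. \<forall>u\<in>bounded_functions G. \<mu> (\<lambda>g. c * u g) = c * \<mu> u) \<and>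
    \<mu> (indicator (carrier G)) = 1 \<and>
    (\<forall>u\<in>bounded_functions G. (\<forall>g. u g \<in> \<real>\<^sub>\<ge>\<^sub>0) \<longrightarrow> \<mu> u \<in> \<real>\<^sub>\<ge>\<^sub>0)}"

text \<open>The Poisson transform: for states \<open>\<mu>\<close>, these are exactly the \<open>\<Gamma>\<close>-maps of \<open>\<ell>\<^sup>\<infinity>(\<Gamma>)\<close> into itself.\<close>

definition poisson ::
    "('g, 'm) monoid_scheme \<Rightarrow> (('g \<Rightarrow> complex) \<Rightarrow> complex) \<Rightarrow> ('g \<Rightarrow> complex) \<Rightarrow> 'g \<Rightarrow> complex"
  where "poisson G \<mu> u = (\<lambda>s. if s \<in> carrier G then \<mu> (left_translate G s u) else 0)"

text \<open>The product for which the Poisson transform is multiplicative; see \<open>poisson_convolve\<close>.\<close>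

definition convolve :: "('g, 'm) monoid_scheme \<Rightarrow> (('g \<Rightarrow> complex) \<Rightarrow> complex) \<Rightarrow>
    (('g \<Rightarrow> complex) \<Rightarrow> complex) \<Rightarrow> ('g \<Rightarrow> complex) \<Rightarrow> complex"
  where "convolve G \<mu> \<nu> = (\<lambda>u. if u \<in> bounded_functions G then \<mu> (poisson G \<nu> u) else 0)"

lemma statesD:
  assumes "\<mu> \<in> states G"
  shows "\<And>u. u \<notin> bounded_functions G \<Longrightarrow> \<mu> u = 0"
    "\<And>u v. u \<in> bounded_functions G \<Longrightarrow> v \<in> bounded_functions G \<Longrightarrow> \<mu> (\<lambda>g. u g + v g) = \<mu> u + \<mu> v"
    "\<And>c u. u \<in> bounded_functions G \<Longrightarrow> \<mu> (\<lambda>g. c * u g) = c * \<mu> u"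
    "\<mu> (indicator (carrier G)) = 1"
    "\<And>u. u \<in> bounded_functions G \<Longrightarrow> (\<And>g. u g \<in> \<real>\<^sub>\<ge>\<^sub>0) \<Longrightarrow> \<mu> u \<in> \<real>\<^sub>\<ge>\<^sub>0"
  using assms unfolding states_def by blast+

lemma statesI:
  assumes "\<And>u. u \<notin> bounded_functions G \<Longrightarrow> \<mu> u = 0"
    "\<And>u v. u \<in> bounded_functions G \<Longrightarrow> v \<in> bounded_functions G \<Longrightarrow> \<mu> (\<lambda>g. u g + v g) = \<mu> u + \<mu> v"
    "\<And>c u. u \<in> bounded_functions G \<Longrightarrow> \<mu> (\<lambda>g. c * u g) = c * \<mu> u"
    "\<mu> (indicator (carrier G)) = 1"
    "\<And>u. u \<in> bounded_functions G \<Longrightarrow> (\<And>g. u g \<in> \<real>\<^sub>\<ge>\<^sub>0) \<Longrightarrow> \<mu> u \<in> \<real>\<^sub>\<ge>\<^sub>0"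
  shows "\<mu> \<in> states G"
  using assms unfolding states_def by blast

text \<open>Both \<open>B + u\<close> and \<open>B - u\<close> are positive.\<close>

lemma state_real_bound:
  assumes \<mu>: "\<mu> \<in> states G" and u: "u \<in> bounded_functions G"
    and real: "\<And>g. u g = of_real (f g)" and B: "\<And>g. \<bar>f g\<bar> \<le> B"
  shows "Im (\<mu> u) = 0" "\<bar>Re (\<mu> u)\<bar> \<le> B"
proof -
  let ?one = "indicator (carrier G) :: 'a \<Rightarrow> complex"
  note D = statesD[OF \<mu>]
  have "of_real B + of_real c * \<mu> u \<in> \<real>\<^sub>\<ge>\<^sub>0" if c: "c = 1 \<or> c = -1" for c :: real
  proof -
    let ?v = "\<lambda>g. of_real B * ?one g + of_real c * u g"
    have m: "(\<lambda>g. of_real B * ?one g) \<in> bounded_functions G" "(\<lambda>g. of_real c * u g) \<in> bounded_functions G"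
      using bounded_functions_smult bounded_functions_one u by blast+
    have "?v g \<in> \<real>\<^sub>\<ge>\<^sub>0" for g
    proof (cases "g \<in> carrier G")
      case True
      have "?v g = of_real (B + c * f g)" using True real by simp
      moreover have "0 \<le> B + c * f g" using c B[of g] by auto
      ultimately show ?thesis by (metis nonneg_Reals_of_real_iff)
    next
      case False
      then have "u g = 0" using u unfolding bounded_functions_def by blast
      then show ?thesis using False by simp
    qed
    then have "\<mu> ?v \<in> \<real>\<^sub>\<ge>\<^sub>0" by (rule D(5)[OF bounded_functions_add[OF m]])
    also have "\<mu> ?v = of_real B + of_real c * \<mu> u"
      using D(2)[OF m] D(3)[OF bounded_functions_one, of "of_real B"] D(3)[OF u, of "of_real c"] D(4) by simp
    finally show ?thesis .
  qed
  from this[of 1] this[of "-1"] show "Im (\<mu> u) = 0" "\<bar>Re (\<mu> u)\<bar> \<le> B"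
    by (auto simp: complex_nonneg_Reals_iff)
qed

lemma state_split:
  assumes \<mu>: "\<mu> \<in> states G" and u: "u \<in> bounded_functions G"
  shows "\<mu> u = \<mu> (\<lambda>g. of_real (Re (u g))) + \<i> * \<mu> (\<lambda>g. of_real (Im (u g)))"
    "(\<lambda>g. of_real (Re (u g))) \<in> bounded_functions G" "(\<lambda>g. of_real (Im (u g))) \<in> bounded_functions G"
proof -
  show m: "(\<lambda>g. of_real (Re (u g))) \<in> bounded_functions G" "(\<lambda>g. of_real (Im (u g))) \<in> bounded_functions G"
    by (rule bounded_functions_map[OF u], simp add: abs_Re_le_cmod abs_Im_le_cmod)+
  have "u = (\<lambda>g. of_real (Re (u g)) + \<i> * of_real (Im (u g)))"
    using complex_eq by blast
  then show "\<mu> u = \<mu> (\<lambda>g. of_real (Re (u g))) + \<i> * \<mu> (\<lambda>g. of_real (Im (u g)))"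
    using statesD(2)[OF \<mu> m(1) bounded_functions_smult[OF m(2)], of \<i>] statesD(3)[OF \<mu> m(2), of \<i>] by metis
qed

lemma state_bound:
  assumes \<mu>: "\<mu> \<in> states G" and u: "u \<in> bounded_functions G" and B: "\<And>g. cmod (u g) \<le> B"
  shows "cmod (\<mu> u) \<le> 2 * B"
proof -
  note S = state_split[OF \<mu> u]
  have re: "\<bar>Re (u g)\<bar> \<le> B" "\<bar>Im (u g)\<bar> \<le> B" for g
    using B[of g] abs_Re_le_cmod[of "u g"] abs_Im_le_cmod[of "u g"] by linarith+
  have "cmod (\<mu> (\<lambda>g. of_real (f g))) \<le> B"
    if "(\<lambda>g. of_real (f g)) \<in> bounded_functions G" "\<And>g. \<bar>f g\<bar> \<le> B" for f
    using state_real_bound[OF \<mu> that(1) refl that(2)] by (simp add: cmod_eq_Re)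
  from this[OF S(2) re(1)] this[OF S(3) re(2)] show ?thesis
    unfolding S(1) using norm_triangle_ineq[of "\<mu> (\<lambda>g. of_real (Re (u g)))" "\<i> * \<mu> (\<lambda>g. of_real (Im (u g)))"]
    by (simp add: norm_mult)
qed

lemma state_cnj:
  assumes \<mu>: "\<mu> \<in> states G" and u: "u \<in> bounded_functions G"
  shows "\<mu> (\<lambda>g. cnj (u g)) = cnj (\<mu> u)"
proof -
  have c: "(\<lambda>g. cnj (u g)) \<in> bounded_functions G"
    by (rule bounded_functions_map[OF u]) simp
  note S = state_split[OF \<mu> u] and T = state_split[OF \<mu> c]
  obtain B where B: "\<And>g. cmod (u g) \<le> B" using bounded_functionsE[OF u] by metis
  have re: "\<bar>Re (u g)\<bar> \<le> B" "\<bar>Im (u g)\<bar> \<le> B" for g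
    using B[of g] abs_Re_le_cmod[of "u g"] abs_Im_le_cmod[of "u g"] by linarith+
  have "(\<lambda>g. of_real (- Im (u g))) = (\<lambda>g. (-1) * of_real (Im (u g)) :: complex)" by simp
  then have "\<mu> (\<lambda>g. of_real (- Im (u g))) = - \<mu> (\<lambda>g. of_real (Im (u g)))"
    using statesD(3)[OF \<mu> S(3), of "-1"] by simp
  then have T1: "\<mu> (\<lambda>g. cnj (u g)) = \<mu> (\<lambda>g. of_real (Re (u g))) - \<i> * \<mu> (\<lambda>g. of_real (Im (u g)))"
    using T(1) by simp
  have "Im (\<mu> (\<lambda>g. of_real (Re (u g)))) = 0" "Im (\<mu> (\<lambda>g. of_real (Im (u g)))) = 0"
    using state_real_bound(1)[OF \<mu> S(2) refl re(1)] state_real_bound(1)[OF \<mu> S(3) refl re(2)] by blast+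
  then show ?thesis unfolding T1 S(1) by (simp add: complex_eq_iff)
qed

lemma closed_Collect_mem:
  fixes f :: "'a::topological_space \<Rightarrow> 'b::topological_space"
  assumes "closed S" "continuous_on UNIV f"
  shows "closed {x. f x \<in> S}"
  using closed_vimage[OF assms] by (simp add: vimage_def)

lemma compact_bounded_functionals: "compact {\<mu> :: 'i \<Rightarrow> complex. \<forall>u. \<mu> u \<in> cball 0 (b u)}"
proof -
  have "compactin (product_topology (\<lambda>i. euclidean) UNIV) (PiE UNIV (\<lambda>u. cball (0 :: complex) (b u)))"
    by (subst compactin_PiE) auto
  then show ?thesis by (simp add: euclidean_product_topology PiE_def Pi_def)
qed

text \<open>A closed subset of a product of discs, by \<open>state_bound\<close>.\<close>

lemma compact_states: "compact {\<mu> \<in> states G. \<forall>u\<in>Q. \<mu> u = c u}"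
proof -
  let ?K = "{\<mu> \<in> states G. \<forall>u\<in>Q. \<mu> u = c u}"
  have "\<exists>B. \<forall>g. cmod (u g) \<le> B" if "u \<in> bounded_functions G" for u
    using that unfolding bounded_functions_def by blast
  then obtain B where B: "\<And>u g. u \<in> bounded_functions G \<Longrightarrow> cmod (u g) \<le> B u" by metis
  let ?b = "\<lambda>u. if u \<in> bounded_functions G then 2 * B u else 0"
  have "\<mu> u \<in> cball 0 (?b u)" if "\<mu> \<in> states G" for \<mu> u
    using state_bound[OF that _ B] statesD(1)[OF that, of u] by (cases "u \<in> bounded_functions G") auto
  then have eq: "?K = {\<mu>. \<forall>u. \<mu> u \<in> cball 0 (?b u)} \<inter> ?K" by blast
  have "closed ?K"
    unfolding states_def Ball_def mem_Collect_eq
    by (intro closed_Collect_conj closed_Collect_all closed_Collect_imp closed_Collect_eq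
        closed_Collect_mem closed_nonneg_Reals_complex open_Collect_const
        continuous_on_const continuous_on_product_coordinates continuous_on_add continuous_on_mult)
  then show ?thesis by (subst eq) (rule compact_Int_closed[OF compact_bounded_functionals])
qed

context group begin

lemma left_translate_algebra:
  shows "left_translate G s (\<lambda>g. u g + v g) = (\<lambda>g. left_translate G s u g + left_translate G s v g)"
    "left_translate G s (\<lambda>g. c * u g) = (\<lambda>g. c * left_translate G s u g)"
    "s \<in> carrier G \<Longrightarrow> left_translate G s (indicator (carrier G)) = indicator (carrier G)"
  by (auto simp: left_translate_def indicator_def)

lemma poisson_mem:
  assumes \<mu>: "\<mu> \<in> states G" and u: "u \<in> bounded_functions G"
  shows "poisson G \<mu> u \<in> bounded_functions G"
proof -
  obtain B where B: "0 \<le> B" "\<And>g. cmod (u g) \<le> B" using bounded_functionsE[OF u] by metis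
  show ?thesis
  proof (rule bounded_functionsI[of _ "2 * B"])
    fix s
    have "cmod (\<mu> (left_translate G s u)) \<le> 2 * B"
      by (rule state_bound[OF \<mu> left_translate_mem[OF u]]) (simp add: left_translate_def B)
    then show "cmod (poisson G \<mu> u s) \<le> 2 * B" using B(1) by (simp add: poisson_def)
  qed (simp add: poisson_def)
qed

lemma poisson_algebra:
  assumes \<mu>: "\<mu> \<in> states G"
  shows "\<And>u v. u \<in> bounded_functions G \<Longrightarrow> v \<in> bounded_functions G \<Longrightarrow>
      poisson G \<mu> (\<lambda>g. u g + v g) = (\<lambda>s. poisson G \<mu> u s + poisson G \<mu> v s)"
    "\<And>c u. u \<in> bounded_functions G \<Longrightarrow> poisson G \<mu> (\<lambda>g. c * u g) = (\<lambda>s. c * poisson G \<mu> u s)"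
    "poisson G \<mu> (indicator (carrier G)) = indicator (carrier G)"
    "\<And>u s. u \<in> bounded_functions G \<Longrightarrow> (\<And>g. u g \<in> \<real>\<^sub>\<ge>\<^sub>0) \<Longrightarrow> poisson G \<mu> u s \<in> \<real>\<^sub>\<ge>\<^sub>0"
proof -
  note D = statesD[OF \<mu>]
  show "poisson G \<mu> (\<lambda>g. u g + v g) = (\<lambda>s. poisson G \<mu> u s + poisson G \<mu> v s)"
    if "u \<in> bounded_functions G" "v \<in> bounded_functions G" for u v
    using that by (auto simp: poisson_def left_translate_algebra D(2) left_translate_mem)
  show "poisson G \<mu> (\<lambda>g. c * u g) = (\<lambda>s. c * poisson G \<mu> u s)" if "u \<in> bounded_functions G" for c u
    using that by (auto simp: poisson_def left_translate_algebra D(3) left_translate_mem)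
  show "poisson G \<mu> (indicator (carrier G)) = indicator (carrier G)"
    by (auto simp: poisson_def left_translate_algebra D(4))
  show "poisson G \<mu> u s \<in> \<real>\<^sub>\<ge>\<^sub>0" if u: "u \<in> bounded_functions G" "\<And>g. u g \<in> \<real>\<^sub>\<ge>\<^sub>0" for u s
  proof -
    have "left_translate G s u g \<in> \<real>\<^sub>\<ge>\<^sub>0" for g using u(2) by (simp add: left_translate_def)
    then show ?thesis using D(5)[OF left_translate_mem[OF u(1)]] by (simp add: poisson_def)
  qed
qed

lemma poisson_left_translate:
  assumes "u \<in> bounded_functions G" "t \<in> carrier G"
  shows "poisson G \<mu> (left_translate G t u) = left_translate G t (poisson G \<mu> u)"
proof
  fix s
  show "poisson G \<mu> (left_translate G t u) s = left_translate G t (poisson G \<mu> u) s"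
  proof (cases "s \<in> carrier G")
    case True
    then show ?thesis
      using assms(2) left_translate_left_translate[OF True assms(2), of u]
      by (simp add: poisson_def left_translate_def[of G t "\<lambda>s. if s \<in> carrier G then \<mu> (left_translate G s u) else 0"])
  qed (simp add: poisson_def left_translate_def)
qed

lemma poisson_convolve:
  assumes "\<mu> \<in> states G" "\<nu> \<in> states G" "u \<in> bounded_functions G"
  shows "poisson G (convolve G \<mu> \<nu>) u = poisson G \<mu> (poisson G \<nu> u)"
proof
  fix s
  show "poisson G (convolve G \<mu> \<nu>) u s = poisson G \<mu> (poisson G \<nu> u) s"
  proof (cases "s \<in> carrier G")
    case True
    then have "poisson G (convolve G \<mu> \<nu>) u s = \<mu> (poisson G \<nu> (left_translate G s u))"
      unfolding poisson_def[of G "convolve G \<mu> \<nu>"] using left_translate_mem[OF assms(3)]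
      by (simp add: convolve_def)
    also have "\<dots> = poisson G \<mu> (poisson G \<nu> u) s"
      using True by (simp add: poisson_left_translate[OF assms(3)] poisson_def[of G \<mu>])
    finally show ?thesis .
  qed (simp add: poisson_def)
qed

lemma convolve_mem:
  assumes \<mu>: "\<mu> \<in> states G" and \<nu>: "\<nu> \<in> states G"
  shows "convolve G \<mu> \<nu> \<in> states G"
proof (rule statesI)
  note D = statesD[OF \<mu>] and P = poisson_algebra[OF \<nu>] and Pm = poisson_mem[OF \<nu>]
  show "convolve G \<mu> \<nu> u = 0" if "u \<notin> bounded_functions G" for u using that by (simp add: convolve_def)
  show "convolve G \<mu> \<nu> (\<lambda>g. u g + v g) = convolve G \<mu> \<nu> u + convolve G \<mu> \<nu> v"
    if "u \<in> bounded_functions G" "v \<in> bounded_functions G" for u v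
    using that by (simp add: convolve_def bounded_functions_add P D(2) Pm)
  show "convolve G \<mu> \<nu> (\<lambda>g. c * u g) = c * convolve G \<mu> \<nu> u" if "u \<in> bounded_functions G" for c u
    using that by (simp add: convolve_def bounded_functions_smult P D(3) Pm)
  show "convolve G \<mu> \<nu> (indicator (carrier G)) = 1"
    unfolding convolve_def P(3) D(4) using bounded_functions_one[of G] by simp
  show "convolve G \<mu> \<nu> u \<in> \<real>\<^sub>\<ge>\<^sub>0" if "u \<in> bounded_functions G" "\<And>g. u g \<in> \<real>\<^sub>\<ge>\<^sub>0" for u
    using that D(5)[OF Pm[OF that(1)] P(4)[OF that]] by (simp add: convolve_def)
qed

lemma convolve_assoc:
  assumes "\<mu> \<in> states G" "\<nu> \<in> states G" "\<rho> \<in> states G"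
  shows "convolve G (convolve G \<mu> \<nu>) \<rho> = convolve G \<mu> (convolve G \<nu> \<rho>)"
proof
  fix u
  show "convolve G (convolve G \<mu> \<nu>) \<rho> u = convolve G \<mu> (convolve G \<nu> \<rho>) u"
  proof (cases "u \<in> bounded_functions G")
    case True
    have "convolve G (convolve G \<mu> \<nu>) \<rho> u = \<mu> (poisson G \<nu> (poisson G \<rho> u))"
      using True poisson_mem[OF assms(3) True] by (simp add: convolve_def)
    also have "\<dots> = \<mu> (poisson G (convolve G \<nu> \<rho>) u)"
      using poisson_convolve[OF assms(2,3) True] by simp
    also have "\<dots> = convolve G \<mu> (convolve G \<nu> \<rho>) u"
      using True by (simp add: convolve_def[of G \<mu>])
    finally show ?thesis .
  qed (simp add: convolve_def)
qed

lemma continuous_convolve: "continuous_on S (\<lambda>\<mu>. convolve G \<mu> \<nu>)"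
proof (rule continuous_on_coordinatewise_then_product)
  fix u
  show "continuous_on S (\<lambda>\<mu>. convolve G \<mu> \<nu> u)"
    unfolding convolve_def
    by (cases "u \<in> bounded_functions G")
       (auto intro: continuous_on_subset[OF continuous_on_product_coordinates])
qed

lemma poisson_fixes:
  assumes Q: "Q \<subseteq> bounded_functions G" "\<And>s u. s \<in> carrier G \<Longrightarrow> u \<in> Q \<Longrightarrow> left_translate G s u \<in> Q"
    and \<mu>: "\<And>u. u \<in> Q \<Longrightarrow> \<mu> u = u \<one>" and u: "u \<in> Q"
  shows "poisson G \<mu> u = u"
proof
  fix s
  show "poisson G \<mu> u s = u s"
  proof (cases "s \<in> carrier G")
    case True
    then have "\<mu> (left_translate G s u) = left_translate G s u \<one>" using Q(2) \<mu> u by blast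
    then show ?thesis using True by (simp add: poisson_def left_translate_def)
  next
    case False
    then show ?thesis using Q(1) u by (auto simp: poisson_def bounded_functions_def)
  qed
qed

text \<open>The states that agree on \<open>Q\<close> with evaluation at the identity form a compact semigroup, because their
  Poisson transforms fix \<open>Q\<close>.\<close>

lemma state_left_invertible:
  assumes Q: "Q \<subseteq> bounded_functions G" "\<And>s u. s \<in> carrier G \<Longrightarrow> u \<in> Q \<Longrightarrow> left_translate G s u \<in> Q"
    and e: "e \<in> states G" "\<And>u. u \<in> Q \<Longrightarrow> e u = u \<one>" "convolve G e e = e"
    and n: "n \<in> states G" "\<And>u. u \<in> Q \<Longrightarrow> n u = u \<one>" "convolve G n e = n"
    and minimal: "\<And>f. f \<in> states G \<Longrightarrow> (\<And>u. u \<in> Q \<Longrightarrow> f u = u \<one>) \<Longrightarrow> convolve G f f = f \<Longrightarrow>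
      convolve G e f = f \<Longrightarrow> convolve G f e = f \<Longrightarrow> f = e"
  obtains x where "x \<in> states G" "convolve G x n = e"
proof -
  let ?K = "{\<mu> \<in> states G. \<forall>u\<in>Q. \<mu> u = u \<one>}"
  have closed: "convolve G x y \<in> ?K" if "x \<in> ?K" "y \<in> ?K" for x y
  proof -
    have "convolve G x y u = u \<one>" if u: "u \<in> Q" for u
    proof -
      have "poisson G y u = u" using \<open>y \<in> ?K\<close> by (intro poisson_fixes[OF Q _ u]) simp_all
      then show ?thesis using \<open>x \<in> ?K\<close> u Q(1) by (auto simp: convolve_def)
    qed
    then show ?thesis using that convolve_mem by simp
  qed
  obtain x where "x \<in> ?K" "convolve G x n = e"
  proof (rule left_invertible_if_idempotent_minimal[of ?K "convolve G" e n])
    show "compact ?K" by (rule compact_states)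
    show "convolve G (convolve G x y) z = convolve G x (convolve G y z)"
      if "x \<in> ?K" "y \<in> ?K" "z \<in> ?K" for x y z
      using that by (intro convolve_assoc) simp_all
    show "continuous_on ?K (\<lambda>x. convolve G x y)" for y by (rule continuous_convolve)
    show "e \<in> ?K" "n \<in> ?K" using e n by simp_all
    show "f = e" if "f \<in> ?K" "convolve G f f = f" "convolve G e f = f" "convolve G f e = f" for f
      using that by (intro minimal) simp_all
  qed (use closed e n in blast)+
  then show ?thesis using that by blast
qed

end

section \<open>\<open>\<Gamma>\<close>-injective algebras of continuous functions on a minimal space\<close>

lemma minimal_gamma_spaceD:
  assumes "minimal_gamma_space G X"
  shows "compact_space (gtop X)" "Hausdorff_space (gtop X)" "group_action G (points X) (move X)"
    "\<And>s. s \<in> carrier G \<Longrightarrow> homeomorphic_map (gtop X) (gtop X) (move X s)"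
    "points X \<noteq> {}" "\<And>x. x \<in> points X \<Longrightarrow> gtop X closure_of orbit G (move X) x = points X"
  using assms unfolding minimal_gamma_space_def gamma_space_def by blast+

lemma gamma_mapD:
  assumes "gamma_map G V W \<phi>"
  shows "unital_linear (alg V) (sys V) (alg W) (sys W) \<phi>" "completely_positive V W \<phi>"
    "\<And>s x. s \<in> carrier G \<Longrightarrow> x \<in> sys V \<Longrightarrow> \<phi> (act V s x) = act W s (\<phi> x)"
  using assms unfolding gamma_map_def by blast+

text \<open>\<open>h\<close> identifies the \<open>\<Gamma>\<close>-injective algebra \<open>I\<close> with \<open>C(L)\<close>, and \<open>l0\<close> is the base point whose orbit
  is used to embed it in \<open>\<ell>\<^sup>\<infinity>(\<Gamma>)\<close>.\<close>

locale injective_flow_algebra = group G for G :: "('g, 'm) monoid_scheme" (structure) +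
  fixes L :: "('g, 'l) gspace" and I :: "('g, 'i) gsystem" and h :: "'i \<Rightarrow> 'l \<Rightarrow> complex" and l0 :: 'l
  assumes minimal_L: "minimal_gamma_space G L" and injective_I: "gamma_injective G I"
    and full: "sys I = carrier (alg I)"
    and iso: "h \<in> ring_iso (alg I) (cfun_alg (gtop L))"
    and h_smult: "\<And>c x. x \<in> carrier (alg I) \<Longrightarrow> h (c \<odot>\<^bsub>alg I\<^esub> x) = c \<odot>\<^bsub>cfun_alg (gtop L)\<^esub> h x"
    and h_adj: "\<And>x. x \<in> carrier (alg I) \<Longrightarrow> h (adj (alg I) x) = adj (cfun_alg (gtop L)) (h x)"
    and h_act: "\<And>s x. s \<in> carrier G \<Longrightarrow> x \<in> carrier (alg I) \<Longrightarrow> h (act I s x) = act (cfun G L) s (h x)"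
    and l0: "l0 \<in> points L"
begin

sublocale L: group_action G "points L" "move L"
  by (rule minimal_gamma_spaceD(3)[OF minimal_L])

lemma system_I: "gamma_operator_system G I"
  using injective_I unfolding gamma_injective_def by blast

lemma cstar_I: "unital_cstar_algebra (alg I)"
  using system_I unfolding gamma_operator_system_def operator_system_def by blast

sublocale I: function_algebra "alg I" "points L" h
  using function_algebra_transport[OF function_algebra_cfun[OF minimal_gamma_spaceD(1)[OF minimal_L]]
      cstar_I iso h_smult h_adj] by simp

sublocale I: group_action G "carrier (alg I)" "act I"
  using system_I unfolding gamma_operator_system_def full by blast

lemma submodule_I: "submodule (carrier (alg I)) complex_ring (alg I)"
  by (rule module.carrier_is_submodule[OF I.is_module])

lemma move_mem: "s \<in> carrier G \<Longrightarrow> l \<in> points L \<Longrightarrow> move L s l \<in> points L"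
  using L.element_image by blast

lemma act_mem: "s \<in> carrier G \<Longrightarrow> x \<in> carrier (alg I) \<Longrightarrow> act I s x \<in> carrier (alg I)"
  using I.element_image by blast

lemma h_mem: "x \<in> carrier (alg I) \<Longrightarrow> h x \<in> carrier (cfun_alg (gtop L))"
  by (rule ring_iso_memE(1)[OF iso])

lemma h_cont: "x \<in> carrier (alg I) \<Longrightarrow> continuous_map (gtop L) euclidean (h x)"
  using h_mem by (simp add: cfun_alg_def)

lemma h_act_eval:
  assumes "s \<in> carrier G" "x \<in> carrier (alg I)" "l \<in> points L"
  shows "h (act I s x) l = h x (move L (inv s) l)"
  using assms h_mem by (simp add: h_act cfun_def)

lemma act_linear:
  assumes s: "s \<in> carrier G"
  shows "unital_linear (alg I) (carrier (alg I)) (alg I) (carrier (alg I)) (act I s)"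
  using system_I s unfolding gamma_operator_system_def full by blast

definition along_orbit :: "'i \<Rightarrow> 'g \<Rightarrow> complex"
  where "along_orbit x = (\<lambda>g. if g \<in> carrier G then h x (move L g l0) else 0)"

lemma along_orbit_mem:
  assumes "x \<in> carrier (alg I)"
  shows "along_orbit x \<in> bounded_functions G"
proof -
  obtain B where B: "\<And>l. l \<in> points L \<Longrightarrow> cmod (h x l) \<le> B" using I.ev_bounded[OF assms] by blast
  have "0 \<le> B" using B[OF l0] norm_ge_zero order_trans by blast
  then show ?thesis
    using B move_mem[OF _ l0] by (intro bounded_functionsI[of _ B]) (auto simp: along_orbit_def)
qed

lemma along_orbit_algebra:
  assumes "x \<in> carrier (alg I)"
  shows "y \<in> carrier (alg I) \<Longrightarrow> along_orbit (x \<oplus>\<^bsub>alg I\<^esub> y) = (\<lambda>g. along_orbit x g + along_orbit y g)"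
    "along_orbit (c \<odot>\<^bsub>alg I\<^esub> x) = (\<lambda>g. c * along_orbit x g)"
    "along_orbit \<one>\<^bsub>alg I\<^esub> = indicator (carrier G)"
    "along_orbit (adj (alg I) x) = (\<lambda>g. cnj (along_orbit x g))"
    "s \<in> carrier G \<Longrightarrow> along_orbit (act I s x) = left_translate G (inv s) (along_orbit x)"
  using assms move_mem[OF _ l0] L.composition_rule[OF l0]
  by (auto simp: along_orbit_def fun_eq_iff I.evs left_translate_def h_act_eval)

lemma dense_orbit_closed:
  assumes "closed S" "x \<in> carrier (alg I)" "\<And>g. g \<in> carrier G \<Longrightarrow> along_orbit x g \<in> S" "l \<in> points L"
  shows "h x l \<in> S"
proof -
  have "closedin (gtop L) {l \<in> points L. h x l \<in> S}"
    by (rule closedin_continuous_map_preimage[OF h_cont[OF assms(2)]]) (use assms(1) in simp)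
  moreover have "orbit G (move L) l0 \<subseteq> {l \<in> points L. h x l \<in> S}"
    using assms(3) move_mem[OF _ l0] by (auto simp: orbit_def along_orbit_def)
  ultimately have "gtop L closure_of orbit G (move L) l0 \<subseteq> {l \<in> points L. h x l \<in> S}"
    by (simp add: closure_of_minimal)
  then show ?thesis using minimal_gamma_spaceD(6)[OF minimal_L l0] assms(4) by blast
qed

lemma along_orbit_inj: "inj_on along_orbit (carrier (alg I))"
proof (rule inj_onI)
  fix x y assume xy: "x \<in> carrier (alg I)" "y \<in> carrier (alg I)" and eq: "along_orbit x = along_orbit y"
  have d: "x \<oplus>\<^bsub>alg I\<^esub> ((-1) \<odot>\<^bsub>alg I\<^esub> y) \<in> carrier (alg I)" using xy I.mem by simp
  have "along_orbit (x \<oplus>\<^bsub>alg I\<^esub> ((-1) \<odot>\<^bsub>alg I\<^esub> y)) g \<in> {0}" for g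
    using xy eq by (simp add: along_orbit_algebra I.mem)
  from dense_orbit_closed[OF closed_singleton d this] have "h x l = h y l" if "l \<in> points L" for l
    using that xy by (simp add: I.evs I.mem)
  then show "x = y" using xy by (rule I.ev_eqI[rotated 2])
qed

text \<open>A \<open>\<Gamma>\<close>-map from \<open>\<ell>\<^sup>\<infinity>(\<Gamma>)\<close> to the algebra that is a left inverse of \<open>along_orbit\<close>.\<close>

definition retraction :: "(('g \<Rightarrow> complex) \<Rightarrow> 'i) \<Rightarrow> bool"
  where "retraction p \<longleftrightarrow>
    (\<forall>u\<in>bounded_functions G. p u \<in> carrier (alg I)) \<and>
    (\<forall>u\<in>bounded_functions G. \<forall>v\<in>bounded_functions G. p (\<lambda>g. u g + v g) = p u \<oplus>\<^bsub>alg I\<^esub> p v) \<and>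
    (\<forall>c. \<forall>u\<in>bounded_functions G. p (\<lambda>g. c * u g) = c \<odot>\<^bsub>alg I\<^esub> p u) \<and>
    p (indicator (carrier G)) = \<one>\<^bsub>alg I\<^esub> \<and>
    (\<forall>u\<in>bounded_functions G. (\<forall>g. u g \<in> \<real>\<^sub>\<ge>\<^sub>0) \<longrightarrow> (\<forall>l\<in>points L. h (p u) l \<in> \<real>\<^sub>\<ge>\<^sub>0)) \<and>
    (\<forall>s\<in>carrier G. \<forall>u\<in>bounded_functions G. p (left_translate G s u) = act I (inv s) (p u)) \<and>
    (\<forall>x\<in>carrier (alg I). p (along_orbit x) = x)"

text \<open>Injectivity extends the inverse of \<open>along_orbit\<close> from the range of this map to \<open>\<ell>\<^sup>\<infinity>(\<Gamma>)\<close>. The inverse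
  is positive because the orbit is dense.\<close>

lemma retraction_exists: "\<exists>p. retraction p"
proof -
  let ?O = "along_orbit ` carrier (alg I)" and ?B = "bounded_functions G"
  let ?V = "linf_system G ?O :: ('g, 'g \<Rightarrow> 'i \<Rightarrow> 'i \<Rightarrow> complex) gsystem"
  let ?W = "linf_system G ?B :: ('g, 'g \<Rightarrow> 'i \<Rightarrow> 'i \<Rightarrow> complex) gsystem"
  let ?A = "linf_alg G :: ('g \<Rightarrow> 'i \<Rightarrow> 'i \<Rightarrow> complex) cstar"
  have V: "alg ?V = ?A" "sys ?V = inflate ` ?O" and W: "alg ?W = ?A" "sys ?W = inflate ` ?B"
    by (simp_all add: linf_system_def)
  have OB: "?O \<subseteq> ?B" using along_orbit_mem by blast
  have carA: "carrier ?A = inflate ` ?B" by (simp add: linf_alg_def)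
  have sysV: "gamma_operator_system G ?V"
  proof (rule gamma_operator_system_linf[OF OB])
    show "indicator (carrier G) \<in> ?O"
      using along_orbit_algebra(3)[OF I.one_mem] I.one_mem by (metis imageI)
    show "(\<lambda>g. u g + v g) \<in> ?O" if uv: "u \<in> ?O" "v \<in> ?O" for u v
    proof -
      from uv obtain x y where "x \<in> carrier (alg I)" "y \<in> carrier (alg I)"
        "u = along_orbit x" "v = along_orbit y" by blast
      then show ?thesis
        using along_orbit_algebra(1)[of x y] I.add_mem
        by (intro image_eqI[of _ _ "x \<oplus>\<^bsub>alg I\<^esub> y"]) simp_all
    qed
    show "(\<lambda>g. c * u g) \<in> ?O" if u: "u \<in> ?O" for c u
    proof -
      from u obtain x where "x \<in> carrier (alg I)" "u = along_orbit x" by blast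
      then show ?thesis 
        using along_orbit_algebra(2)[of x c] I.smult_mem
        by (intro image_eqI[of _ _ "c \<odot>\<^bsub>alg I\<^esub> x"]) simp_all
    qed
    show "(\<lambda>g. cnj (u g)) \<in> ?O" if u: "u \<in> ?O" for u
    proof -
      from u obtain x where "x \<in> carrier (alg I)" "u = along_orbit x" by blast
      then show ?thesis 
        using along_orbit_algebra(4)[of x] I.adj_mem
        by (intro image_eqI[of _ _ "adj (alg I) x"]) simp_all
    qed
    show "left_translate G s u \<in> ?O" if s: "s \<in> carrier G" and u: "u \<in> ?O" for s u
    proof -
      from u obtain x where x: "x \<in> carrier (alg I)" "u = along_orbit x" by blast
      then have "left_translate G s u = along_orbit (act I (inv s) x)"
        using along_orbit_algebra(5)[OF x(1), of "inv s"] s by simp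
      then show ?thesis using act_mem[of "inv s" x] s x(1) by simp
    qed
  qed
  have sysW: "gamma_operator_system G ?W"
    by (rule gamma_operator_system_linf)
       (use bounded_functions_one bounded_functions_add bounded_functions_smult left_translate_mem
          bounded_functions_map[of _ G cnj] in auto)
  have subV: "submodule (sys ?V) complex_ring (alg ?V)"
    using sysV unfolding gamma_operator_system_def operator_system_def by blast
  have ex: "\<exists>x. x \<in> carrier (alg I) \<and> inflate (along_orbit x) = F" if "F \<in> sys ?V" for F
    using that unfolding V by blast
  define \<phi> :: "('g \<Rightarrow> 'i \<Rightarrow> 'i \<Rightarrow> complex) \<Rightarrow> 'i"
    where "\<phi> F = (SOME x. x \<in> carrier (alg I) \<and> inflate (along_orbit x) = F)" for F
  have \<phi>: "\<phi> F \<in> carrier (alg I)" "inflate (along_orbit (\<phi> F)) = F" if "F \<in> sys ?V" for F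
    using someI_ex[OF ex[OF that]] unfolding \<phi>_def by blast+
  have infl_inj: "u = v" if "inflate u = (inflate v :: 'g \<Rightarrow> 'i \<Rightarrow> 'i \<Rightarrow> complex)" for u v
  proof
    fix g show "u g = v g"
      using fun_cong[OF fun_cong[OF fun_cong[OF that, of g], of undefined], of undefined]
      by (simp add: inflate_def)
  qed
  have \<phi>I: "\<phi> (inflate (along_orbit x)) = x" if x: "x \<in> carrier (alg I)" for x
  proof -
    have F: "inflate (along_orbit x) \<in> sys ?V" using x unfolding V by blast
    show ?thesis
      using infl_inj[OF \<phi>(2)[OF F]] along_orbit_inj \<phi>(1)[OF F] x by (meson inj_onD)
  qed
  have \<phi>lin: "unital_linear (alg ?V) (sys ?V) (alg I) (sys I) \<phi>"
    unfolding unital_linear_def full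
  proof (intro conjI ballI allI)
    show "\<phi> \<in> sys ?V \<rightarrow> carrier (alg I)" using \<phi>(1) by blast
    have "\<one>\<^bsub>alg ?V\<^esub> = inflate (along_orbit \<one>\<^bsub>alg I\<^esub>)"
      unfolding along_orbit_algebra(3)[OF I.one_mem] V by (simp add: linf_alg_def)
    then show "\<phi> \<one>\<^bsub>alg ?V\<^esub> = \<one>\<^bsub>alg I\<^esub>" using \<phi>I[OF I.one_mem] by simp
    fix F assume "F \<in> sys ?V"
    then obtain x where x: "x \<in> carrier (alg I)" "F = inflate (along_orbit x)" unfolding V by blast
    show "\<phi> (c \<odot>\<^bsub>alg ?V\<^esub> F) = c \<odot>\<^bsub>alg I\<^esub> \<phi> F" for c
    proof -
      have "c \<odot>\<^bsub>alg ?V\<^esub> F = inflate (along_orbit (c \<odot>\<^bsub>alg I\<^esub> x))"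
        unfolding x(2) along_orbit_algebra(2)[OF x(1)] V by (simp add: linf_alg_def inflate_def)
      then show ?thesis using \<phi>I[OF I.smult_mem[OF x(1)]] \<phi>I[OF x(1)] x(2) by simp
    qed
    fix K assume "K \<in> sys ?V"
    then obtain y where y: "y \<in> carrier (alg I)" "K = inflate (along_orbit y)" unfolding V by blast
    have "F \<oplus>\<^bsub>alg ?V\<^esub> K = inflate (along_orbit (x \<oplus>\<^bsub>alg I\<^esub> y))"
      unfolding x(2) y(2) along_orbit_algebra(1)[OF x(1) y(1)] V by (simp add: linf_alg_def inflate_def)
    then show "\<phi> (F \<oplus>\<^bsub>alg ?V\<^esub> K) = \<phi> F \<oplus>\<^bsub>alg I\<^esub> \<phi> K"
      using \<phi>I[OF I.add_mem[OF x(1) y(1)]] \<phi>I[OF x(1)] \<phi>I[OF y(1)] x(2) y(2) by simp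
  qed
  have \<phi>map: "gamma_map G ?V I \<phi>"
    unfolding gamma_map_def
  proof (intro conjI ballI \<phi>lin)
    show "completely_positive ?V I \<phi>"
    proof (rule completely_positive_if_positive[of ?V "carrier G" "\<lambda>F g. F g undefined undefined"])
      show "function_algebra (alg ?V) (carrier G) (\<lambda>F g. F g undefined undefined)"
        unfolding V by (rule function_algebra_linf)
      show "function_algebra (alg I) (points L) h" by (rule I.function_algebra_axioms)
      fix F l assume F: "F \<in> sys ?V" and pos: "\<And>g. g \<in> carrier G \<Longrightarrow> F g undefined undefined \<in> \<real>\<^sub>\<ge>\<^sub>0"
        and l: "l \<in> points L"
      have "along_orbit (\<phi> F) g \<in> \<real>\<^sub>\<ge>\<^sub>0" if "g \<in> carrier G" for g
        using pos[OF that] fun_cong[OF fun_cong[OF fun_cong[OF \<phi>(2)[OF F], of g], of undefined], of undefined]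
        by (simp add: inflate_def)
      then show "h (\<phi> F) l \<in> \<real>\<^sub>\<ge>\<^sub>0"
        by (rule dense_orbit_closed[OF closed_nonneg_Reals_complex \<phi>(1)[OF F] _ l])
    qed (use subV \<phi>lin full in simp_all)
    fix s F assume s: "s \<in> carrier G" and "F \<in> sys ?V"
    then obtain x where x: "x \<in> carrier (alg I)" "F = inflate (along_orbit x)" unfolding V by blast
    have "act ?V s F = inflate (along_orbit (act I s x))"
      unfolding x(2) along_orbit_algebra(5)[OF x(1) s] using x(1) by (intro linf_system_act) blast
    then show "\<phi> (act ?V s F) = act I s (\<phi> F)"
      using \<phi>I[OF act_mem[OF s x(1)]] \<phi>I[OF x(1)] x(2) by simp
  qed
  have mat_id: "mat_of (alg ?W) n (\<lambda>i j. a i j) = a" if "a \<in> mat_sys n ?V" for n a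
    using that by (simp add: mat_sys_def mat_cstar_def V W)
  have "gamma_extension G ?V ?W (\<lambda>F. F)"
    unfolding gamma_extension_def gamma_map_def
  proof (intro conjI ballI sysW)
    show "unital_linear (alg ?V) (sys ?V) (alg ?W) (sys ?W) (\<lambda>F. F)"
      unfolding unital_linear_def using OB by (auto simp: V W)
    show "completely_positive ?V ?W (\<lambda>F. F)"
      unfolding completely_positive_def using mat_id by (simp add: V W)
    show "completely_isometric ?V ?W (\<lambda>F. F)"
      unfolding completely_isometric_def using mat_id by (simp add: V W)
    fix s F assume "F \<in> sys ?V"
    then obtain u where u: "u \<in> ?O" "F = inflate u" unfolding V by blast
    have "u \<in> ?B" using u(1) OB by blast
    then have "act ?W s (inflate u) = inflate (left_translate G (inv s) u)" by (rule linf_system_act)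
    moreover have "act ?V s (inflate u) = inflate (left_translate G (inv s) u)"
      using u(1) by (rule linf_system_act)
    ultimately show "act ?V s F = act ?W s F" unfolding u(2) by simp
  qed
  then have "\<exists>\<psi>. gamma_map G ?W I \<psi> \<and> (\<forall>v\<in>sys ?V. \<psi> v = \<phi> v)"
    using injective_I sysV \<phi>map unfolding gamma_injective_def by blast
  then obtain \<psi> where \<psi>: "gamma_map G ?W I \<psi>" "\<And>F. F \<in> sys ?V \<Longrightarrow> \<psi> F = \<phi> F" by blast
  note \<psi>D = unital_linearD[OF gamma_mapD(1)[OF \<psi>(1)]]
  have Wmem: "inflate u \<in> sys ?W" if "u \<in> ?B" for u using that unfolding W by blast
  define p where "p u = \<psi> (inflate u)" for u
  have "retraction p"
    unfolding retraction_def
  proof (intro conjI ballI allI impI)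
    show mem: "p u \<in> carrier (alg I)" if "u \<in> ?B" for u
      using \<psi>D(1)[OF Wmem[OF that]] unfolding p_def full .
    show "p (indicator (carrier G)) = \<one>\<^bsub>alg I\<^esub>"
      using \<psi>D(4) unfolding p_def by (simp add: W linf_alg_def)
    show "p (\<lambda>g. u g + v g) = p u \<oplus>\<^bsub>alg I\<^esub> p v" if "u \<in> ?B" "v \<in> ?B" for u v
    proof -
      have "inflate (\<lambda>g. u g + v g) = inflate u \<oplus>\<^bsub>alg ?W\<^esub> inflate v"
        by (simp add: W linf_alg_def inflate_def)
      then show ?thesis using \<psi>D(2)[OF Wmem[OF that(1)] Wmem[OF that(2)]] by (simp add: p_def)
    qed
    show "p (\<lambda>g. c * u g) = c \<odot>\<^bsub>alg I\<^esub> p u" if "u \<in> ?B" for c u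
    proof -
      have "inflate (\<lambda>g. c * u g) = c \<odot>\<^bsub>alg ?W\<^esub> inflate u"
        by (simp add: W linf_alg_def inflate_def)
      then show ?thesis using \<psi>D(3)[OF Wmem[OF that]] by (simp add: p_def)
    qed
    show "h (p u) l \<in> \<real>\<^sub>\<ge>\<^sub>0" if u: "u \<in> ?B" "\<forall>g. u g \<in> \<real>\<^sub>\<ge>\<^sub>0" and l: "l \<in> points L" for u l
      unfolding p_def
    proof (rule positive_if_completely_positive[of ?W "carrier G" "\<lambda>F g. F g undefined undefined" I "points L" h])
      show "function_algebra (alg ?W) (carrier G) (\<lambda>F g. F g undefined undefined)"
        unfolding W by (rule function_algebra_linf)
      show "function_algebra (alg I) (points L) h" by (rule I.function_algebra_axioms)
      show "sys ?W \<subseteq> carrier (alg ?W)" unfolding W carA by simp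
      show "\<psi> (inflate u) \<in> carrier (alg I)" using mem[OF u(1)] unfolding p_def .
      show "completely_positive ?W I \<psi>" by (rule gamma_mapD(2)[OF \<psi>(1)])
    qed (use Wmem u l in \<open>simp_all add: inflate_def\<close>)
    show "p (left_translate G s u) = act I (inv s) (p u)" if s: "s \<in> carrier G" and u: "u \<in> ?B" for s u
    proof -
      have "act ?W (inv s) (inflate u) = inflate (left_translate G (inv (inv s)) u)"
        using u by (rule linf_system_act)
      then show ?thesis
        using gamma_mapD(3)[OF \<psi>(1) inv_closed[OF s] Wmem[OF u]] s by (simp add: p_def)
    qed
    show "p (along_orbit x) = x" if x: "x \<in> carrier (alg I)" for x
      using \<psi>(2)[of "inflate (along_orbit x)"] \<phi>I[OF x] x unfolding p_def V by simp
  qed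
  then show ?thesis by blast
qed

lemma subsystem_act:
  "x \<in> S \<Longrightarrow> act (subsystem I S) s x = act I s x" "alg (subsystem I S) = alg I" "sys (subsystem I S) = S"
  by (simp_all add: subsystem_def)

text \<open>An extension with values in the whole algebra, composed with \<open>T\<close>, becomes one with values in the
  range of \<open>T\<close>.\<close>

lemma gamma_injective_range:
  assumes T: "unital_linear (alg I) (carrier (alg I)) (alg I) (carrier (alg I)) T"
    and pos: "\<And>x l. x \<in> carrier (alg I) \<Longrightarrow> (\<And>l. l \<in> points L \<Longrightarrow> h x l \<in> \<real>\<^sub>\<ge>\<^sub>0) \<Longrightarrow> l \<in> points L \<Longrightarrow> h (T x) l \<in> \<real>\<^sub>\<ge>\<^sub>0"
    and adj: "\<And>x. x \<in> carrier (alg I) \<Longrightarrow> T (adj (alg I) x) = adj (alg I) (T x)"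
    and equi: "\<And>s x. s \<in> carrier G \<Longrightarrow> x \<in> carrier (alg I) \<Longrightarrow> T (act I s x) = act I s (T x)"
    and idem: "\<And>x. x \<in> carrier (alg I) \<Longrightarrow> T (T x) = T x"
  shows "gamma_injective G (subsystem I (T ` carrier (alg I)))"
proof -
  let ?A = "alg I" and ?S = "T ` carrier (alg I)"
  let ?U = "subsystem I ?S"
  note TD = unital_linearD[OF T] and U = subsystem_act(2,3)[of ?S]
  have S: "?S \<subseteq> carrier ?A" using TD(1) by blast
  have fix_iff: "x \<in> ?S \<longleftrightarrow> x \<in> carrier ?A \<and> T x = x" for x
  proof
    assume "x \<in> ?S"
    then obtain y where "y \<in> carrier ?A" "x = T y" by blast
    then show "x \<in> carrier ?A \<and> T x = x" using idem TD(1) by simp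
  next
    assume "x \<in> carrier ?A \<and> T x = x"
    then show "x \<in> ?S" by (intro image_eqI[of _ _ x]) simp_all
  qed
  have "submodule ?S complex_ring ?A"
  proof (rule I.complex_submoduleI[OF S])
    have "\<zero>\<^bsub>?A\<^esub> = 0 \<odot>\<^bsub>?A\<^esub> \<one>\<^bsub>?A\<^esub>" by (rule I.ev_eqI) (simp_all add: I.evs I.mem)
    then have "T \<zero>\<^bsub>?A\<^esub> = \<zero>\<^bsub>?A\<^esub>" using TD(3)[OF I.one_mem, of 0] TD(4) by simp
    then show "\<zero>\<^bsub>?A\<^esub> \<in> ?S" unfolding fix_iff using I.zero_mem by blast
    show "x \<oplus>\<^bsub>?A\<^esub> y \<in> ?S" if "x \<in> ?S" "y \<in> ?S" for x y
      using that TD(2) I.add_mem unfolding fix_iff by simp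
    show "c \<odot>\<^bsub>?A\<^esub> x \<in> ?S" if "x \<in> ?S" for c x
      using that TD(3) I.smult_mem unfolding fix_iff by simp
  qed
  moreover have "\<one>\<^bsub>?A\<^esub> \<in> ?S" unfolding fix_iff using TD(4) I.one_mem by blast
  moreover have "adj ?A x \<in> ?S" if "x \<in> ?S" for x
    using that adj I.adj_mem unfolding fix_iff by simp
  ultimately have os: "operator_system (alg ?U) (sys ?U)"
    unfolding operator_system_def U using cstar_I by blast
  have actS: "act I s x \<in> ?S" if "s \<in> carrier G" "x \<in> ?S" for s x
    using that equi act_mem unfolding fix_iff by simp
  have ga: "group_action G (sys ?U) (act ?U)"
  proof (rule group_actionI)
    fix s x assume "s \<in> carrier G" "x \<in> sys ?U"
    then show "act ?U s x \<in> sys ?U" using actS by (simp add: subsystem_act U)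
  next
    fix s x assume "x \<notin> sys ?U"
    then show "act ?U s x = undefined" by (simp add: subsystem_def)
  next
    fix x assume "x \<in> sys ?U"
    then have x: "x \<in> ?S" "x \<in> carrier ?A" using S by (auto simp: U)
    show "act ?U \<one> x = x" using fun_cong[OF I.id_eq_one, of x] x by (simp add: subsystem_act)
  next
    fix s t x assume st: "s \<in> carrier G" "t \<in> carrier G" and "x \<in> sys ?U"
    then have x: "x \<in> ?S" "x \<in> carrier ?A" using S by (auto simp: U)
    show "act ?U (s \<otimes> t) x = act ?U s (act ?U t x)"
      using I.composition_rule[OF x(2) st] actS[OF st(2) x(1)] x(1) by (simp add: subsystem_act)
  qed
  have ul: "unital_linear (alg ?U) (sys ?U) (alg ?U) (sys ?U) (act ?U s)" if s: "s \<in> carrier G" for s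
  proof -
    note D = unital_linearD[OF act_linear[OF s]]
    have "x \<oplus>\<^bsub>?A\<^esub> y \<in> ?S" "c \<odot>\<^bsub>?A\<^esub> x \<in> ?S" if "x \<in> ?S" "y \<in> ?S" for c x y
      using that TD(2,3) I.add_mem I.smult_mem unfolding fix_iff by simp_all
    moreover have "\<one>\<^bsub>?A\<^esub> \<in> ?S" by fact
    moreover have "x \<in> carrier ?A" if "x \<in> ?S" for x using that S by blast
    ultimately show ?thesis
      unfolding unital_linear_def U
      using actS[OF s] D by (simp add: subsystem_act Pi_def)
  qed
  have cp: "cstar_pos (alg ?U) (act ?U s x) \<longleftrightarrow> cstar_pos (alg ?U) x"
    if s: "s \<in> carrier G" and "x \<in> sys ?U" for s x
  proof -
    have x: "x \<in> ?S" "x \<in> carrier ?A" using that S by (auto simp: U)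
    have "cstar_pos ?A (act I s x) \<longleftrightarrow> cstar_pos ?A x"
      using system_I s x(2) unfolding gamma_operator_system_def full by blast
    then show ?thesis using x(1) by (simp add: subsystem_act U)
  qed
  have "completely_positive I I T"
    by (rule completely_positive_if_positive[OF I.function_algebra_axioms I.function_algebra_axioms])
       (use submodule_I T pos in \<open>simp_all add: full\<close>)
  show ?thesis
    unfolding gamma_injective_def
  proof (intro conjI allI impI)
    show "gamma_operator_system G ?U" unfolding gamma_operator_system_def using os ga ul cp by blast
    fix V W :: "('g, 'g \<Rightarrow> 'i \<Rightarrow> 'i \<Rightarrow> complex) gsystem" and \<phi> \<iota>
    assume *: "gamma_operator_system G V \<and> gamma_map G V ?U \<phi> \<and> gamma_extension G V W \<iota>"
    then have \<phi>: "gamma_map G V ?U \<phi>" by blast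
    note \<phi>D = unital_linearD[OF gamma_mapD(1)[OF \<phi>], unfolded U]
    have "gamma_map G V I \<phi>"
      unfolding gamma_map_def
    proof (intro conjI ballI)
      show "unital_linear (alg V) (sys V) (alg I) (sys I) \<phi>"
        unfolding unital_linear_def full using \<phi>D S by blast
      show "completely_positive V I \<phi>"
        using gamma_mapD(2)[OF \<phi>] unfolding completely_positive_def U .
      fix s x assume "s \<in> carrier G" "x \<in> sys V"
      then show "\<phi> (act V s x) = act I s (\<phi> x)"
        using gamma_mapD(3)[OF \<phi>] \<phi>D(1) by (simp add: subsystem_act)
    qed
    then obtain \<psi> where \<psi>: "gamma_map G W I \<psi>" "\<And>v. v \<in> sys V \<Longrightarrow> \<psi> (\<iota> v) = \<phi> v"
      using injective_I * unfolding gamma_injective_def by blast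
    note \<psi>D = unital_linearD[OF gamma_mapD(1)[OF \<psi>(1)], unfolded full]
    have "gamma_map G W ?U (\<lambda>x. T (\<psi> x))"
      unfolding gamma_map_def
    proof (intro conjI ballI)
      show "unital_linear (alg W) (sys W) (alg ?U) (sys ?U) (\<lambda>x. T (\<psi> x))"
        unfolding unital_linear_def U using \<psi>D TD by simp
      show "completely_positive W ?U (\<lambda>x. T (\<psi> x))"
        unfolding completely_positive_def U
      proof (intro allI ballI impI)
        fix n a assume a: "a \<in> mat_sys n W" "cstar_pos (mat_cstar n (alg W)) a"
        let ?b = "mat_of ?A n (\<lambda>i j. \<psi> (a i j))"
        have "cstar_pos (mat_cstar n ?A) ?b"
          using gamma_mapD(2)[OF \<psi>(1)] a unfolding completely_positive_def by blast
        moreover have "?b \<in> mat_sys n I"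
          using \<psi>D(1) a(1) I.mat_carrierI[of n "\<lambda>i j. \<psi> (a i j)"]
          by (simp add: mat_sys_def full mat_of_def)
        ultimately have "cstar_pos (mat_cstar n ?A) (mat_of ?A n (\<lambda>i j. T (?b i j)))"
          using \<open>completely_positive I I T\<close> unfolding completely_positive_def by blast
        moreover have "mat_of ?A n (\<lambda>i j. T (?b i j)) = mat_of ?A n (\<lambda>i j. T (\<psi> (a i j)))"
          by (simp add: mat_of_def fun_eq_iff)
        ultimately show "cstar_pos (mat_cstar n ?A) (mat_of ?A n (\<lambda>i j. T (\<psi> (a i j))))" by simp
      qed
      fix s x assume "s \<in> carrier G" "x \<in> sys W"
      then show "T (\<psi> (act W s x)) = act ?U s (T (\<psi> x))"
        using gamma_mapD(3)[OF \<psi>(1)] \<psi>D(1) equi by (simp add: subsystem_act)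
    qed
    moreover have "T (\<psi> (\<iota> v)) = \<phi> v" if "v \<in> sys V" for v
      using \<psi>(2)[OF that] \<phi>D(1)[OF that] fix_iff by simp
    ultimately show "\<exists>\<psi>. gamma_map G W ?U \<psi> \<and> (\<forall>v\<in>sys V. \<psi> (\<iota> v) = \<phi> v)" by blast
  qed
qed

end

section \<open>Rigidity of the envelope\<close>

context injective_flow_algebra begin

text \<open>Let \<open>st l\<close> be the state \<open>u \<mapsto> p(u)(l)\<close> for a retraction \<open>p\<close>. Then \<open>e = st l0\<close> is an idempotent with
  Poisson transform \<open>along_orbit \<circ> p\<close>, and the average \<open>n\<close> of \<open>st l0\<close> and \<open>st l1\<close> satisfies \<open>n e = n\<close>.
  The envelope property makes \<open>e\<close> a minimal idempotent, so \<open>x n = e\<close> for some state \<open>x\<close>. Were the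
  conclusion false, \<open>n\<close> would map \<open>f\<close> to a function bounded by \<open>1/2\<close>, while \<open>e\<close> maps \<open>f\<close> to 1.\<close>

lemma proximality_of_undistinguished_points:
  assumes K: "K \<subseteq> carrier (alg I)" "\<And>s x. s \<in> carrier G \<Longrightarrow> x \<in> K \<Longrightarrow> act I s x \<in> K"
    and envelope: "\<And>S. K \<subseteq> S \<Longrightarrow> S \<subseteq> carrier (alg I) \<Longrightarrow> gamma_injective G (subsystem I S) \<Longrightarrow>
      S = carrier (alg I)"
    and l1: "l1 \<in> points L" "\<And>x. x \<in> K \<Longrightarrow> h x l1 = h x l0"
    and f: "f \<in> carrier (alg I)" "h f l0 = 1" "\<And>l. l \<in> points L \<Longrightarrow> h f l \<in> \<real>\<^sub>\<ge>\<^sub>0"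
  shows "\<exists>s\<in>carrier G. 1 < Re (h f (move L s l0) + h f (move L s l1))"
proof (rule ccontr)
  assume no: "\<not> ?thesis"
  let ?B = "bounded_functions G" and ?A = "alg I"
  obtain p where p: "retraction p" using retraction_exists by blast
  have pm: "p u \<in> carrier ?A" if "u \<in> ?B" for u using p that unfolding retraction_def by blast
  have padd: "p (\<lambda>g. u g + v g) = p u \<oplus>\<^bsub>?A\<^esub> p v" if "u \<in> ?B" "v \<in> ?B" for u v
    using p that unfolding retraction_def by blast
  have psmult: "p (\<lambda>g. c * u g) = c \<odot>\<^bsub>?A\<^esub> p u" if "u \<in> ?B" for c u
    using p that unfolding retraction_def by blast
  have pone: "p (indicator (carrier G)) = \<one>\<^bsub>?A\<^esub>" using p unfolding retraction_def by blast
  have ppos: "h (p u) l \<in> \<real>\<^sub>\<ge>\<^sub>0" if "u \<in> ?B" "\<And>g. u g \<in> \<real>\<^sub>\<ge>\<^sub>0" "l \<in> points L" for u l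
    using p that unfolding retraction_def by blast
  have pact: "p (left_translate G s u) = act I (inv s) (p u)" if "s \<in> carrier G" "u \<in> ?B" for s u
    using p that unfolding retraction_def by blast
  have pJ: "p (along_orbit x) = x" if "x \<in> carrier ?A" for x
    using p that unfolding retraction_def by blast
  note Jm = along_orbit_mem
  define st where "st l u = (if u \<in> ?B then h (p u) l else 0)" for l u
  have st: "st l \<in> states G" if l: "l \<in> points L" for l
  proof (rule statesI)
    show "st l u = 0" if "u \<notin> ?B" for u using that by (simp add: st_def)
    show "st l (\<lambda>g. u g + v g) = st l u + st l v" if "u \<in> ?B" "v \<in> ?B" for u v
      using that l by (simp add: st_def bounded_functions_add padd pm I.evs)
    show "st l (\<lambda>g. c * u g) = c * st l u" if "u \<in> ?B" for c u
      using that l by (simp add: st_def bounded_functions_smult psmult pm I.evs)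
    show "st l (indicator (carrier G)) = 1"
      using l bounded_functions_one[of G] by (simp add: st_def pone I.evs)
    show "st l u \<in> \<real>\<^sub>\<ge>\<^sub>0" if "u \<in> ?B" "\<And>g. u g \<in> \<real>\<^sub>\<ge>\<^sub>0" for u
      using ppos[OF that l] that(1) by (simp add: st_def)
  qed
  have padj: "p (\<lambda>g. cnj (u g)) = adj ?A (p u)" if u: "u \<in> ?B" for u
  proof (rule I.ev_eqI)
    have c: "(\<lambda>g. cnj (u g)) \<in> ?B" by (rule bounded_functions_map[OF u]) simp
    show "p (\<lambda>g. cnj (u g)) \<in> carrier ?A" by (rule pm[OF c])
    show "adj ?A (p u) \<in> carrier ?A" using pm[OF u] by (rule I.adj_mem)
    fix l assume l: "l \<in> points L"
    show "h (p (\<lambda>g. cnj (u g))) l = h (adj ?A (p u)) l"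
      using state_cnj[OF st[OF l] u] u c l pm[OF u] by (simp add: st_def I.evs)
  qed
  let ?e = "st l0"
  \<comment> \<open>The two states agree on \<open>Q\<close>, so \<open>n\<close> agrees with both there and lies in the semigroup.\<close>
  define n where "n u = (st l0 u + st l1 u) / 2" for u
  have e: "?e \<in> states G" by (rule st[OF l0])
  note E0 = statesD[OF st[OF l0]] and E1 = statesD[OF st[OF l1(1)]]
  have n: "n \<in> states G"
  proof (rule statesI)
    show "n u \<in> \<real>\<^sub>\<ge>\<^sub>0" if "u \<in> ?B" "\<And>g. u g \<in> \<real>\<^sub>\<ge>\<^sub>0" for u
      using E0(5)[OF that] E1(5)[OF that] by (simp add: n_def complex_nonneg_Reals_iff)
  qed (simp_all add: n_def E0 E1 field_simps)
  have Pe: "poisson G ?e u = along_orbit (p u)" if u: "u \<in> ?B" for u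
  proof
    fix s
    show "poisson G ?e u s = along_orbit (p u) s"
    proof (cases "s \<in> carrier G")
      case True
      then have "poisson G ?e u s = h (act I (inv s) (p u)) l0"
        using u left_translate_mem[OF u] by (simp add: poisson_def st_def pact)
      also have "\<dots> = h (p u) (move L s l0)"
        using h_act_eval[of "inv s" "p u" l0] True pm[OF u] l0 by simp
      finally show ?thesis using True by (simp add: along_orbit_def)
    qed (simp add: poisson_def along_orbit_def)
  qed
  have ee: "convolve G ?e ?e = ?e"
    by (intro ext) (simp add: convolve_def Pe st_def Jm pm pJ)
  have ne: "convolve G n ?e = n"
    by (intro ext) (simp add: convolve_def Pe n_def st_def Jm pm pJ)
  define Q where "Q = along_orbit ` K"
  have QB: "Q \<subseteq> ?B" unfolding Q_def using Jm K(1) by blast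
  have Qtrans: "left_translate G s u \<in> Q" if s: "s \<in> carrier G" and u: "u \<in> Q" for s u
  proof -
    from u obtain k where k: "k \<in> K" "u = along_orbit k" unfolding Q_def by blast
    have "left_translate G s u = along_orbit (act I (inv s) k)"
      using along_orbit_algebra(5)[of k "inv s"] k K(1) s by auto
    then show ?thesis unfolding Q_def using K(2)[of "inv s" k] k(1) s by simp
  qed
  have Qe: "?e u = u \<one>" "n u = u \<one>" if u: "u \<in> Q" for u
  proof -
    from u obtain k where k: "k \<in> K" "u = along_orbit k" unfolding Q_def by blast
    have kA: "k \<in> carrier ?A" using k K by blast
    have "move L \<one> l0 = l0" using fun_cong[OF L.id_eq_one, of l0] l0 by simp
    then have "u \<one> = h k l0" unfolding k(2) by (simp add: along_orbit_def)
    then show "?e u = u \<one>" "n u = u \<one>"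
      using l1(2)[OF k(1)] unfolding k(2) n_def by (simp_all add: st_def Jm[OF kA] pJ[OF kA])
  qed
  obtain x where x: "x \<in> states G" "convolve G x n = ?e"
  proof (rule state_left_invertible[OF QB Qtrans e Qe(1) ee n Qe(2) ne])
    fix q assume q: "q \<in> states G" "\<And>u. u \<in> Q \<Longrightarrow> q u = u \<one>" "convolve G q q = q"
      "convolve G ?e q = q" "convolve G q ?e = q"
    \<comment> \<open>The \<open>\<Gamma>\<close>-projection of the algebra that belongs to the idempotent \<open>q\<close>.\<close>
    define T where "T x = p (poisson G q (along_orbit x))" for x
    note P = poisson_algebra[OF q(1)] and Pm = poisson_mem[OF q(1)]
    have T1: "unital_linear ?A (carrier ?A) ?A (carrier ?A) T"
      unfolding unital_linear_def T_def
      by (auto simp: along_orbit_algebra[OF I.one_mem] along_orbit_algebra(1,2) Jm P Pm pm padd psmult pone)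
    have T2: "h (T x) l \<in> \<real>\<^sub>\<ge>\<^sub>0"
      if x: "x \<in> carrier ?A" and pos: "\<And>l. l \<in> points L \<Longrightarrow> h x l \<in> \<real>\<^sub>\<ge>\<^sub>0" and l: "l \<in> points L" for x l
    proof -
      have "along_orbit x g \<in> \<real>\<^sub>\<ge>\<^sub>0" for g using pos move_mem[OF _ l0] by (simp add: along_orbit_def)
      then show ?thesis unfolding T_def by (intro ppos Pm Jm x l P(4))
    qed
    have T3: "T (adj ?A x) = adj ?A (T x)" if x: "x \<in> carrier ?A" for x
    proof -
      have "poisson G q (\<lambda>g. cnj (u g)) = (\<lambda>s. cnj (poisson G q u s))" if u: "u \<in> ?B" for u
      proof
        fix s
        have "left_translate G s (\<lambda>g. cnj (u g)) = (\<lambda>g. cnj (left_translate G s u g))"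
          by (auto simp: left_translate_def)
        then show "poisson G q (\<lambda>g. cnj (u g)) s = cnj (poisson G q u s)"
          using state_cnj[OF q(1) left_translate_mem[OF u], of s] by (simp add: poisson_def)
      qed
      then show ?thesis
        unfolding T_def along_orbit_algebra(4)[OF x] using Jm[OF x] padj Pm by simp
    qed
    have T4: "T (act I s x) = act I s (T x)" if s: "s \<in> carrier G" and x: "x \<in> carrier ?A" for s x
      unfolding T_def along_orbit_algebra(5)[OF x s]
      using s Jm[OF x] by (simp add: poisson_left_translate pact Pm)
    have T5: "T (T x) = T x" if x: "x \<in> carrier ?A" for x
    proof -
      have u: "along_orbit x \<in> ?B" by (rule Jm[OF x])
      have "poisson G q (along_orbit (T x)) = poisson G q (poisson G ?e (poisson G q (along_orbit x)))"
        unfolding T_def using Pe[OF Pm[OF u]] by simp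
      also have "\<dots> = poisson G (convolve G q ?e) (poisson G q (along_orbit x))"
        using poisson_convolve[OF q(1) e Pm[OF u]] by simp
      also have "\<dots> = poisson G (convolve G q q) (along_orbit x)"
        unfolding q(5) using poisson_convolve[OF q(1) q(1) u] by simp
      finally show ?thesis unfolding q(3) by (simp add: T_def)
    qed
    have "gamma_injective G (subsystem I (T ` carrier ?A))"
      by (rule gamma_injective_range[OF T1 T2 T3 T4 T5])
    moreover have Tm: "T x \<in> carrier ?A" if "x \<in> carrier ?A" for x
      unfolding T_def by (intro pm Pm Jm that)
    moreover have "K \<subseteq> T ` carrier ?A"
    proof
      fix k assume k: "k \<in> K"
      then have "poisson G q (along_orbit k) = along_orbit k"
        by (intro poisson_fixes[OF QB]) (use Qtrans q(2) in \<open>auto simp: Q_def\<close>)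
      then have "T k = k" unfolding T_def using pJ k K(1) by auto
      then show "k \<in> T ` carrier ?A" using k K(1) by (intro image_eqI[of _ _ k]) auto
    qed
    ultimately have surj: "T ` carrier ?A = carrier ?A" using envelope by blast
    have Tid: "T x = x" if x: "x \<in> carrier ?A" for x
    proof -
      obtain y where y: "y \<in> carrier ?A" "x = T y" using surj x by blast
      then show ?thesis using T5 by simp
    qed
    show "q = ?e"
    proof
      fix u
      show "q u = ?e u"
      proof (cases "u \<in> ?B")
        case True
        have J: "along_orbit (p u) \<in> ?B" by (rule Jm[OF pm[OF True]])
        have "q u = convolve G ?e (convolve G q ?e) u" unfolding q(5) q(4) ..
        also have "\<dots> = ?e (poisson G q (along_orbit (p u)))"
          using True poisson_convolve[OF q(1) e True] Pe[OF True] by (simp add: convolve_def[of G ?e])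
        also have "\<dots> = h (T (p u)) l0" using Pm[OF J] by (simp add: st_def T_def)
        also have "\<dots> = ?e u" using Tid[OF pm[OF True]] True by (simp add: st_def)
        finally show ?thesis .
      qed (simp add: E0(1) statesD(1)[OF q(1)])
    qed
  qed
  let ?u = "along_orbit f"
  have uB: "?u \<in> ?B" by (rule Jm[OF f(1)])
  let ?one = "indicator (carrier G) :: 'g \<Rightarrow> complex"
  have half: "(1/2) * ?one s + (-1) * poisson G n ?u s \<in> \<real>\<^sub>\<ge>\<^sub>0" for s
  proof (cases "s \<in> carrier G")
    case True
    have "left_translate G s ?u = along_orbit (act I (inv s) f)"
      using along_orbit_algebra(5)[OF f(1), of "inv s"] True by simp
    then have "st l (left_translate G s ?u) = h f (move L s l)" if "l \<in> points L" for l
      using True that act_mem[of "inv s" f] f(1) h_act_eval[of "inv s" f l] by (simp add: st_def Jm pJ)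
    then have eq: "poisson G n ?u s = (h f (move L s l0) + h f (move L s l1)) / 2"
      using True l0 l1(1) by (simp add: poisson_def n_def)
    obtain a b where ab: "h f (move L s l0) = of_real a" "h f (move L s l1) = of_real b"
      using f(3)[OF move_mem[OF True l0]] f(3)[OF move_mem[OF True l1(1)]]
      by (meson nonneg_Reals_cases)
    have "\<not> 1 < Re (h f (move L s l0) + h f (move L s l1))" using no True by blast
    then have "0 \<le> (1 - (a + b)) / 2" unfolding ab by simp
    then have "(of_real ((1 - (a + b)) / 2) :: complex) \<in> \<real>\<^sub>\<ge>\<^sub>0" by (simp only: nonneg_Reals_of_real_iff)
    also have "of_real ((1 - (a + b)) / 2) = (1/2) * ?one s + (-1) * poisson G n ?u s"
      using True unfolding eq ab by (simp add: field_simps)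
    finally show ?thesis .
  next
    case False
    then show ?thesis by (simp add: poisson_def)
  qed
  note X = statesD[OF x(1)] and Pn = poisson_mem[OF n uB]
  have m: "(\<lambda>g. (1/2) * ?one g) \<in> ?B" "(\<lambda>g. (-1) * poisson G n ?u g) \<in> ?B"
    by (intro bounded_functions_smult bounded_functions_one Pn)+
  have "x (\<lambda>s. (1/2) * ?one s + (-1) * poisson G n ?u s) \<in> \<real>\<^sub>\<ge>\<^sub>0"
    by (rule X(5)[OF bounded_functions_add[OF m] half])
  also have "x (\<lambda>s. (1/2) * ?one s + (-1) * poisson G n ?u s) = 1/2 - x (poisson G n ?u)"
    unfolding X(2)[OF m] using X(3)[OF bounded_functions_one, of "1/2"] X(3)[OF Pn, of "-1"] X(4) by simp
  also have "x (poisson G n ?u) = convolve G x n ?u" using uB by (simp add: convolve_def)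
  also have "\<dots> = 1" unfolding x(2) using uB f by (simp add: st_def pJ)
  finally show False by (simp add: complex_nonneg_Reals_iff)
qed

end

section \<open>The map between the spaces that underlies an extension\<close>

lemma compact_space_finite_intersections:
  assumes X: "compact_space X" and closed: "\<And>j. j \<in> J \<Longrightarrow> closedin X (C j)"
    and fin: "\<And>K. finite K \<Longrightarrow> K \<subseteq> J \<Longrightarrow> \<exists>x\<in>topspace X. \<forall>j\<in>K. x \<in> C j"
  obtains x where "x \<in> topspace X" "\<And>j. j \<in> J \<Longrightarrow> x \<in> C j"
proof -
  let ?U = "insert (topspace X) (C ` J)"
  have "\<Inter>?U \<noteq> {}"
  proof (rule compact_space_fip[THEN iffD1, OF X, rule_format])
    have "\<Inter>\<F> \<noteq> {}" if F: "finite \<F>" "\<F> \<subseteq> ?U" for \<F>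
    proof -
      have "finite (\<F> - {topspace X})" "\<F> - {topspace X} \<subseteq> C ` J" using F by auto
      then obtain K where K: "K \<subseteq> J" "finite K" "\<F> - {topspace X} = C ` K"
        by (meson finite_subset_image)
      obtain x where "x \<in> topspace X" "\<And>j. j \<in> K \<Longrightarrow> x \<in> C j" using fin[OF K(2,1)] by blast
      then have "x \<in> \<Inter>\<F>" using K(3) by blast
      then show ?thesis by blast
    qed
    then show "(\<forall>C\<in>?U. closedin X C) \<and> (\<forall>\<F>. finite \<F> \<and> \<F> \<subseteq> ?U \<longrightarrow> \<Inter>\<F> \<noteq> {})"
      using closed by auto
  qed
  then show ?thesis using that by auto
qed

lemma cfun_comp_mem:
  assumes "f \<in> carrier (cfun_alg T)" "continuous_on UNIV g"
  shows "(\<lambda>x. if x \<in> topspace T then g (f x) else 0) \<in> carrier (cfun_alg T)"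
proof -
  have "continuous_map T euclidean (\<lambda>x. g (f x))"
    using continuous_map_compose[of T euclidean f euclidean g] assms by (simp add: o_def cfun_alg_def)
  then have "continuous_map T euclidean (\<lambda>x. if x \<in> topspace T then g (f x) else 0)"
    by (rule continuous_map_eq) simp
  then show ?thesis by (simp add: cfun_alg_def)
qed

lemma cfun_add_mem:
  "f \<in> carrier (cfun_alg T) \<Longrightarrow> g \<in> carrier (cfun_alg T) \<Longrightarrow> (\<lambda>x. f x + g x) \<in> carrier (cfun_alg T)"
  by (simp add: cfun_alg_def continuous_map_add)

lemma cfun_smult_mem:
  assumes "f \<in> carrier (cfun_alg T)"
  shows "(\<lambda>x. c * f x) \<in> carrier (cfun_alg T)"
proof -
  have "continuous_map T euclidean (\<lambda>x. c * f x)"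
    using continuous_map_compose[of T euclidean f euclidean "\<lambda>z. c * z"] assms
    by (simp add: o_def cfun_alg_def continuous_intros)
  then show ?thesis using assms by (simp add: cfun_alg_def)
qed

lemma cfun_one_mem: "(indicator (topspace T) :: _ \<Rightarrow> complex) \<in> carrier (cfun_alg T)"
proof -
  have "continuous_map T euclidean (indicator (topspace T) :: _ \<Rightarrow> complex)"
    by (rule continuous_map_eq[of _ _ "\<lambda>_. 1"]) simp_all
  then show ?thesis by (simp add: cfun_alg_def)
qed

text \<open>The states of \<open>C(T)\<close>, given by their values on \<open>C(T)\<close>.\<close>

definition cstate :: "'y topology \<Rightarrow> (('y \<Rightarrow> complex) \<Rightarrow> complex) \<Rightarrow> bool"
  where "cstate T \<tau> \<longleftrightarrow>
    (\<forall>f\<in>carrier (cfun_alg T). \<forall>g\<in>carrier (cfun_alg T). \<tau> (\<lambda>x. f x + g x) = \<tau> f + \<tau> g) \<and>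
    (\<forall>c. \<forall>f\<in>carrier (cfun_alg T). \<tau> (\<lambda>x. c * f x) = c * \<tau> f) \<and>
    \<tau> (indicator (topspace T)) = 1 \<and>
    (\<forall>f\<in>carrier (cfun_alg T). (\<forall>x\<in>topspace T. f x \<in> \<real>\<^sub>\<ge>\<^sub>0) \<longrightarrow> \<tau> f \<in> \<real>\<^sub>\<ge>\<^sub>0)"

lemma cstateD:
  assumes "cstate T \<tau>"
  shows "\<And>f g. f \<in> carrier (cfun_alg T) \<Longrightarrow> g \<in> carrier (cfun_alg T) \<Longrightarrow> \<tau> (\<lambda>x. f x + g x) = \<tau> f + \<tau> g"
    "\<And>c f. f \<in> carrier (cfun_alg T) \<Longrightarrow> \<tau> (\<lambda>x. c * f x) = c * \<tau> f"
    "\<tau> (indicator (topspace T)) = 1"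
    "\<And>f. f \<in> carrier (cfun_alg T) \<Longrightarrow> (\<And>x. x \<in> topspace T \<Longrightarrow> f x \<in> \<real>\<^sub>\<ge>\<^sub>0) \<Longrightarrow> \<tau> f \<in> \<real>\<^sub>\<ge>\<^sub>0"
  using assms unfolding cstate_def by blast+

context
  fixes T :: "'y topology" and \<tau>
  assumes \<tau>: "cstate T \<tau>"
begin

lemma cstate_mono:
  assumes f: "f \<in> carrier (cfun_alg T)" and g: "g \<in> carrier (cfun_alg T)"
    and le: "\<And>x. x \<in> topspace T \<Longrightarrow> g x - f x \<in> \<real>\<^sub>\<ge>\<^sub>0"
  shows "\<tau> g - \<tau> f \<in> \<real>\<^sub>\<ge>\<^sub>0"
proof -
  have m: "(\<lambda>x. (-1) * f x) \<in> carrier (cfun_alg T)" by (rule cfun_smult_mem[OF f])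
  have "\<tau> (\<lambda>x. g x + (-1) * f x) \<in> \<real>\<^sub>\<ge>\<^sub>0"
    using le by (intro cstateD(4)[OF \<tau> cfun_add_mem[OF g m]]) simp
  then show ?thesis using cstateD(1)[OF \<tau> g m] cstateD(2)[OF \<tau> f, of "-1"] by simp
qed

text \<open>The real and the imaginary part of \<open>f - c\<close> are dominated by \<open>\<bar>f - c\<bar>\<close>. If the state vanishes on this
  function, it is concentrated where \<open>f = c\<close>.\<close>

lemma cstate_value_if_distance_zero:
  assumes f: "f \<in> carrier (cfun_alg T)"
    and zero: "\<tau> (\<lambda>x. if x \<in> topspace T then of_real (cmod (f x - c)) else 0) = 0"
  shows "\<tau> f = c"
proof -
  let ?N = "\<lambda>x. if x \<in> topspace T then of_real (cmod (f x - c)) else 0 :: complex"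
  have N: "?N \<in> carrier (cfun_alg T)"
    by (rule cfun_comp_mem[OF f, of "\<lambda>z. of_real (cmod (z - c))"]) (intro continuous_intros)
  have part: "\<tau> (\<lambda>x. if x \<in> topspace T then of_real (r (f x - c)) else 0) = 0"
    if r: "continuous_on UNIV r" "\<And>z. \<bar>r z\<bar> \<le> cmod z" for r :: "complex \<Rightarrow> real"
  proof -
    let ?R = "\<lambda>x. if x \<in> topspace T then of_real (r (f x - c)) else 0 :: complex"
    have R: "?R \<in> carrier (cfun_alg T)"
    proof (rule cfun_comp_mem[OF f, of "\<lambda>z. of_real (r (z - c))"])
      have "continuous_on UNIV (\<lambda>z. r (z - c))"
        by (rule continuous_on_compose2[OF r(1)]) (auto intro!: continuous_intros)
      then show "continuous_on UNIV (\<lambda>z. of_real (r (z - c)) :: complex)" by (rule continuous_on_of_real)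
    qed
    have "?N x - \<theta> * ?R x \<in> \<real>\<^sub>\<ge>\<^sub>0" if "x \<in> topspace T" "\<theta> = 1 \<or> \<theta> = -1" for x \<theta>
      using that r(2)[of "f x - c"] by (auto simp: complex_nonneg_Reals_iff)
    then have "\<tau> ?N - \<theta> * \<tau> ?R \<in> \<real>\<^sub>\<ge>\<^sub>0" if "\<theta> = 1 \<or> \<theta> = -1" for \<theta>
      using cstate_mono[OF cfun_smult_mem[OF R] N, of \<theta>] that cstateD(2)[OF \<tau> R, of \<theta>] by simp
    from this[of 1] this[of "-1"] show ?thesis
      unfolding zero by (auto simp: complex_nonneg_Reals_iff complex_eq_iff)
  qed
  let ?R = "\<lambda>x. if x \<in> topspace T then of_real (Re (f x - c)) else 0 :: complex"
  let ?I = "\<lambda>x. if x \<in> topspace T then of_real (Im (f x - c)) else 0 :: complex"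
  have R: "?R \<in> carrier (cfun_alg T)" "?I \<in> carrier (cfun_alg T)"
    by (rule cfun_comp_mem[OF f, of "\<lambda>z. of_real (Re (z - c))"], intro continuous_intros)
       (rule cfun_comp_mem[OF f, of "\<lambda>z. of_real (Im (z - c))"], intro continuous_intros)
  have Z: "\<tau> ?R = 0" "\<tau> ?I = 0"
    by (rule part, intro continuous_intros, rule abs_Re_le_cmod)
       (rule part, intro continuous_intros, rule abs_Im_le_cmod)
  have f0: "f x = 0" if "x \<notin> topspace T" for x using f that by (simp add: cfun_alg_def)
  have "f = (\<lambda>x. (?R x + \<i> * ?I x) + c * indicator (topspace T) x)"
    using f0 by (auto simp: fun_eq_iff complex_eq_iff)
  then have "\<tau> f = \<tau> (\<lambda>x. (?R x + \<i> * ?I x) + c * indicator (topspace T) x)" by (rule arg_cong)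
  also have "\<dots> = \<tau> (\<lambda>x. ?R x + \<i> * ?I x) + \<tau> (\<lambda>x. c * indicator (topspace T) x)"
    by (rule cstateD(1)[OF \<tau> cfun_add_mem[OF R(1) cfun_smult_mem[OF R(2)]]
          cfun_smult_mem[OF cfun_one_mem]])
  also have "\<dots> = \<tau> ?R + \<i> * \<tau> ?I + c * 1"
    using cstateD(1)[OF \<tau> R(1) cfun_smult_mem[OF R(2)]] cstateD(2)[OF \<tau> R(2)]
      cstateD(2)[OF \<tau> cfun_one_mem] cstateD(3)[OF \<tau>] by simp
  finally show ?thesis using Z by simp
qed

end

lemma (in function_algebra) nrm_mat_singleton:
  assumes x: "x \<in> carrier A"
  shows "nrm (mat_cstar 1 A) (mat_of A 1 (\<lambda>_ _. x)) =
    Sup {sqrt (nrm A (adj A (x \<otimes> z) \<otimes> (x \<otimes> z))) | z. z \<in> carrier A \<and> sqrt (nrm A (adj A z \<otimes> z)) \<le> 1}"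
proof -
  interpret cring A by (rule is_cring)
  have fs: "(\<Oplus>i\<in>{..<1::nat}. f i) = f 0" if "f 0 \<in> carrier A" for f
  proof -
    have "{..<1::nat} = insert 0 {}" by auto
    then show ?thesis using that by (simp del: insert_iff)
  qed
  have col: "column_nrm A 1 y = sqrt (nrm A (adj A (y 0) \<otimes> y 0))" if "y 0 \<in> carrier A" for y
    unfolding column_nrm_def using fs[of "\<lambda>i. adj A (y i) \<otimes> y i"] that by (simp add: mem)
  have eq: "column_nrm A 1 (\<lambda>i. \<Oplus>j\<in>{..<1}. mat_of A 1 (\<lambda>_ _. x) i j \<otimes> y j)
      = sqrt (nrm A (adj A (x \<otimes> y 0) \<otimes> (x \<otimes> y 0)))" if y: "y 0 \<in> carrier A" for y
  proof -
    have 1: "(\<Oplus>j\<in>{..<1}. mat_of A 1 (\<lambda>_ _. x) 0 j \<otimes> y j) = x \<otimes> y 0"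
      using fs[of "\<lambda>j. mat_of A 1 (\<lambda>_ _. x) 0 j \<otimes> y j"] x y by (simp add: mat_of_def mem)
    show ?thesis
      using col[of "\<lambda>i. \<Oplus>j\<in>{..<1}. mat_of A 1 (\<lambda>_ _. x) i j \<otimes> y j"] x y unfolding 1 by (simp add: mem)
  qed
  have "{column_nrm A 1 (\<lambda>i. \<Oplus>j\<in>{..<1}. mat_of A 1 (\<lambda>_ _. x) i j \<otimes> y j) | y.
        (\<forall>j<1. y j \<in> carrier A) \<and> column_nrm A 1 y \<le> 1}
      = {sqrt (nrm A (adj A (x \<otimes> z) \<otimes> (x \<otimes> z))) | z. z \<in> carrier A \<and> sqrt (nrm A (adj A z \<otimes> z)) \<le> 1}"
    (is "?P = ?R")
  proof (intro equalityI subsetI)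
    fix t assume "t \<in> ?P"
    then obtain y where y: "y 0 \<in> carrier A" "column_nrm A 1 y \<le> 1"
      "t = column_nrm A 1 (\<lambda>i. \<Oplus>j\<in>{..<1}. mat_of A 1 (\<lambda>_ _. x) i j \<otimes> y j)" by auto
    show "t \<in> ?R" using y(1,2) unfolding y(3) eq[of y, OF y(1)] col[of y, OF y(1)] by blast
  next
    fix t assume "t \<in> ?R"
    then obtain z where z: "z \<in> carrier A" "sqrt (nrm A (adj A z \<otimes> z)) \<le> 1"
      "t = sqrt (nrm A (adj A (x \<otimes> z) \<otimes> (x \<otimes> z)))" by blast
    show "t \<in> ?P"
      using z eq[of "\<lambda>_. z"] col[of "\<lambda>_. z"] by (intro CollectI exI[of _ "\<lambda>_. z"]) simp
  qed
  then show ?thesis by (simp add: mat_cstar_def)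
qed

lemma (in unital_cstar_algebra) nrm_adj:
  assumes "x \<in> carrier A"
  shows "nrm A (adj A x) = nrm A x"
proof -
  have le: "nrm A y \<le> nrm A (adj A y)" if y: "y \<in> carrier A" for y
  proof (cases "nrm A y = 0")
    case False
    have "(nrm A y)\<^sup>2 \<le> nrm A (adj A y) * nrm A y"
      using nrm_mult[OF adj_closed[OF y] y] cstar_identity[OF y] by simp
    then show ?thesis using False nrm_nonneg[OF y] by (simp add: power2_eq_square)
  qed (use nrm_nonneg adj_closed y in simp)
  show ?thesis using le[OF assms] le[OF adj_closed[OF assms]] adj_adj[OF assms] by simp
qed

context injective_flow_algebra begin

sublocale IC: unital_cstar_algebra "alg I" by (rule cstar_I)

lemma h_surj:
  assumes "f \<in> carrier (cfun_alg (gtop L))"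
  obtains x where "x \<in> carrier (alg I)" "h x = f"
proof -
  have "bij_betw h (carrier (alg I)) (carrier (cfun_alg (gtop L)))"
    using iso by (simp add: ring_iso_def)
  then have "f \<in> h ` carrier (alg I)" using assms by (simp add: bij_betw_def)
  then show ?thesis using that by blast
qed

text \<open>Let \<open>a\<close> and \<open>b\<close> be the square roots of \<open>x\<close> and \<open>c - x\<close>. Then \<open>z = a + \<i> b\<close> has \<open>z\<^sup>* z = c\<close>, and \<open>a\<close>
  is the real part of \<open>z\<close>; so \<open>\<parallel>x\<parallel> \<le> \<parallel>a\<parallel>\<^sup>2 \<le> \<parallel>z\<parallel>\<^sup>2 \<le> c\<close>. This bounds the norm of the algebra by the
  supremum norm without spectral theory.\<close>

lemma nrm_le_if_range:
  assumes x: "x \<in> carrier (alg I)" and r: "\<And>l. l \<in> points L \<Longrightarrow> \<exists>t. h x l = of_real t \<and> 0 \<le> t \<and> t \<le> c"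
    and c: "0 \<le> c"
  shows "nrm (alg I) x \<le> c"
proof -
  let ?A = "alg I"
  have comp: "\<exists>y\<in>carrier ?A. \<forall>l\<in>points L. h y l = g (h x l)" if g: "continuous_on UNIV g" for g
  proof -
    obtain y where "y \<in> carrier ?A" "h y = (\<lambda>l. if l \<in> points L then g (h x l) else 0)"
      using h_surj[OF cfun_comp_mem[OF h_mem[OF x] g]] by blast
    then show ?thesis by (intro bexI[of _ y]) simp_all
  qed
  obtain a where a: "a \<in> carrier ?A" "\<And>l. l \<in> points L \<Longrightarrow> h a l = of_real (sqrt (Re (h x l)))"
  proof -
    have "continuous_on UNIV (\<lambda>z. of_real (sqrt (Re z)) :: complex)" by (intro continuous_intros)
    from comp[OF this] show ?thesis using that by blast
  qed
  obtain b where b: "b \<in> carrier ?A" "\<And>l. l \<in> points L \<Longrightarrow> h b l = of_real (sqrt (c - Re (h x l)))"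
  proof -
    have "continuous_on UNIV (\<lambda>z. of_real (sqrt (c - Re z)) :: complex)" by (intro continuous_intros)
    from comp[OF this] show ?thesis using that by blast
  qed
  let ?z = "a \<oplus>\<^bsub>?A\<^esub> (\<i> \<odot>\<^bsub>?A\<^esub> b)"
  have z: "?z \<in> carrier ?A" using a b by (simp add: I.mem)
  have zz: "adj ?A ?z \<otimes>\<^bsub>?A\<^esub> ?z = of_real c \<odot>\<^bsub>?A\<^esub> \<one>\<^bsub>?A\<^esub>"
  proof (rule I.ev_eqI)
    fix l assume l: "l \<in> points L"
    obtain t where t: "h x l = of_real t" "0 \<le> t" "t \<le> c" using r[OF l] by blast
    have "(of_real (sqrt t) - \<i> * of_real (sqrt (c - t))) * (of_real (sqrt t) + \<i> * of_real (sqrt (c - t)))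
        = of_real (sqrt t) * of_real (sqrt t) + of_real (sqrt (c - t)) * of_real (sqrt (c - t))"
      by (simp add: algebra_simps)
    also have "\<dots> = (of_real (sqrt t * sqrt t + sqrt (c - t) * sqrt (c - t)) :: complex)"
      by (simp only: of_real_mult of_real_add)
    also have "\<dots> = of_real c" using t by simp
    finally show "h (adj ?A ?z \<otimes>\<^bsub>?A\<^esub> ?z) l = h (of_real c \<odot>\<^bsub>?A\<^esub> \<one>\<^bsub>?A\<^esub>) l"
      using a b l t(1) by (simp add: I.mem I.evs)
  qed (use z in \<open>simp_all add: I.mem\<close>)
  have one: "nrm ?A \<one>\<^bsub>?A\<^esub> \<le> 1"
  proof -
    have "adj ?A \<one>\<^bsub>?A\<^esub> \<otimes>\<^bsub>?A\<^esub> \<one>\<^bsub>?A\<^esub> = \<one>\<^bsub>?A\<^esub>" by (rule I.ev_eqI) (simp_all add: I.mem I.evs)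
    then have "(nrm ?A \<one>\<^bsub>?A\<^esub>)\<^sup>2 = nrm ?A \<one>\<^bsub>?A\<^esub>" using IC.cstar_identity[OF I.one_mem] by simp
    then show ?thesis by (auto simp: power2_eq_square)
  qed
  have "(nrm ?A ?z)\<^sup>2 = c * nrm ?A \<one>\<^bsub>?A\<^esub>"
    using IC.cstar_identity[OF z] IC.nrm_smult[OF I.one_mem, of "of_real c"] c unfolding zz by simp
  also have "\<dots> \<le> c * 1" by (rule mult_left_mono[OF one c])
  finally have z2: "(nrm ?A ?z)\<^sup>2 \<le> c" by simp
  have "a = (1/2) \<odot>\<^bsub>?A\<^esub> (?z \<oplus>\<^bsub>?A\<^esub> adj ?A ?z)"
  proof (rule I.ev_eqI)
    fix l assume "l \<in> points L"
    then show "h a l = h ((1/2) \<odot>\<^bsub>?A\<^esub> (?z \<oplus>\<^bsub>?A\<^esub> adj ?A ?z)) l"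
      using a b by (simp add: I.mem I.evs)
  qed (use a z in \<open>simp_all add: I.mem\<close>)
  then have "nrm ?A a = 1/2 * nrm ?A (?z \<oplus>\<^bsub>?A\<^esub> adj ?A ?z)"
    using IC.nrm_smult[of "?z \<oplus>\<^bsub>?A\<^esub> adj ?A ?z" "1/2"] z by (simp add: I.mem)
  also have "\<dots> \<le> 1/2 * (nrm ?A ?z + nrm ?A (adj ?A ?z))"
    using IC.nrm_add[OF z I.adj_mem[OF z]] by simp
  also have "\<dots> = nrm ?A ?z" using IC.nrm_adj[OF z] by simp
  finally have az: "nrm ?A a \<le> nrm ?A ?z" .
  have "x = a \<otimes>\<^bsub>?A\<^esub> a"
  proof (rule I.ev_eqI[OF x I.mult_mem[OF a(1) a(1)]])
    fix l assume l: "l \<in> points L"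
    obtain t where t: "h x l = of_real t" "0 \<le> t" "t \<le> c" using r[OF l] by blast
    have "of_real (sqrt t) * of_real (sqrt t) = (of_real t :: complex)"
      unfolding of_real_mult[symmetric] using t by simp
    then show "h x l = h (a \<otimes>\<^bsub>?A\<^esub> a) l" using a l t(1) by (simp add: I.evs)
  qed
  then have "nrm ?A x \<le> nrm ?A a * nrm ?A a" using IC.nrm_mult[OF a(1) a(1)] by simp
  also have "\<dots> \<le> (nrm ?A ?z)\<^sup>2"
    unfolding power2_eq_square using az IC.nrm_nonneg[OF a(1)] IC.nrm_nonneg[OF z] by (intro mult_mono)
  finally show ?thesis using z2 by linarith
qed

end

text \<open>The extension \<open>\<kappa>\<close> of \<open>C(Y)\<close> turns points of \<open>L\<close> into states of \<open>C(Y)\<close>. The aim is to show that these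
  are point evaluations.\<close>

locale boundary_embedding = injective_flow_algebra G L I h l0
  for G :: "('g, 'm) monoid_scheme" (structure) and L :: "('g, 'l) gspace"
    and I :: "('g, 'i) gsystem" and h :: "'i \<Rightarrow> 'l \<Rightarrow> complex" and l0 :: 'l +
  fixes Y :: "('g, 'y) gspace" and \<kappa> :: "('y \<Rightarrow> complex) \<Rightarrow> 'i"
  assumes minimal_Y: "minimal_gamma_space G Y" and ext: "gamma_extension G (cfun G Y) I \<kappa>"
begin

sublocale Y: group_action G "points Y" "move Y"
  by (rule minimal_gamma_spaceD(3)[OF minimal_Y])

sublocale Y: function_algebra "cfun_alg (gtop Y)" "points Y" "\<lambda>f. f"
  by (rule function_algebra_cfun[OF minimal_gamma_spaceD(1)[OF minimal_Y]])

lemma cfun_Y: "alg (cfun G Y) = cfun_alg (gtop Y)" "sys (cfun G Y) = carrier (cfun_alg (gtop Y))"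
  by (simp_all add: cfun_def)

lemma kappa_map: "gamma_map G (cfun G Y) I \<kappa>" and kappa_isometric: "completely_isometric (cfun G Y) I \<kappa>"
  using ext unfolding gamma_extension_def by blast+

lemmas kappa_linear = unital_linearD[OF gamma_mapD(1)[OF kappa_map], unfolded cfun_Y full]

lemma act_Y_mem:
  assumes s: "s \<in> carrier G" and f: "f \<in> carrier (cfun_alg (gtop Y))"
  shows "act (cfun G Y) s f \<in> carrier (cfun_alg (gtop Y))"
proof -
  have "continuous_map (gtop Y) (gtop Y) (move Y (inv s))"
    using minimal_gamma_spaceD(4)[OF minimal_Y, of "inv s"] s homeomorphic_imp_continuous_map by blast
  then have "continuous_map (gtop Y) euclidean (f \<circ> move Y (inv s))"
    using continuous_map_compose[of "gtop Y" "gtop Y" _ euclidean f] f by (simp add: cfun_alg_def)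
  then have "continuous_map (gtop Y) euclidean (\<lambda>x. if x \<in> points Y then f (move Y (inv s) x) else 0)"
    by (rule continuous_map_eq) simp
  then show ?thesis using f by (simp add: cfun_def cfun_alg_def)
qed

lemma act_Y_eval:
  "f \<in> carrier (cfun_alg (gtop Y)) \<Longrightarrow> y \<in> points Y \<Longrightarrow> act (cfun G Y) s f y = f (move Y (inv s) y)"
  by (simp add: cfun_def)

lemma kappa_act:
  assumes "s \<in> carrier G" "f \<in> carrier (cfun_alg (gtop Y))"
  shows "\<kappa> (act (cfun G Y) s f) = act I s (\<kappa> f)"
  using gamma_mapD(3)[OF kappa_map assms(1)] assms(2) unfolding cfun_Y by blast

lemma kappa_state:
  assumes l: "l \<in> points L"
  shows "cstate (gtop Y) (\<lambda>f. h (\<kappa> f) l)"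
proof -
  have "h (\<kappa> f) l \<in> \<real>\<^sub>\<ge>\<^sub>0"
    if f: "f \<in> carrier (cfun_alg (gtop Y))" "\<And>y. y \<in> points Y \<Longrightarrow> f y \<in> \<real>\<^sub>\<ge>\<^sub>0" for f
    by (rule positive_if_completely_positive[of "cfun G Y" "points Y" "\<lambda>f. f" I "points L" h])
       (use f l kappa_linear(1) gamma_mapD(2)[OF kappa_map] Y.function_algebra_axioms
         I.function_algebra_axioms in \<open>simp_all add: cfun_Y\<close>)
  moreover have "h (\<kappa> (\<lambda>x. f x + g x)) l = h (\<kappa> f) l + h (\<kappa> g) l"
    if "f \<in> carrier (cfun_alg (gtop Y))" "g \<in> carrier (cfun_alg (gtop Y))" for f g
  proof -
    have "(\<lambda>x. f x + g x) = f \<oplus>\<^bsub>cfun_alg (gtop Y)\<^esub> g" by (simp add: cfun_alg_def)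
    then show ?thesis using kappa_linear(1,2) that l by (simp add: I.evs)
  qed
  moreover have "h (\<kappa> (\<lambda>x. c * f x)) l = c * h (\<kappa> f) l"
    if "f \<in> carrier (cfun_alg (gtop Y))" for c f
  proof -
    have "(\<lambda>x. c * f x) = c \<odot>\<^bsub>cfun_alg (gtop Y)\<^esub> f" by (simp add: cfun_alg_def)
    then show ?thesis using kappa_linear(1,3) that l by (simp add: I.evs)
  qed
  moreover have "h (\<kappa> (indicator (points Y))) l = 1"
  proof -
    have "indicator (points Y) = \<one>\<^bsub>cfun_alg (gtop Y)\<^esub>" by (simp add: cfun_alg_def)
    then show ?thesis using kappa_linear(4) l by (simp add: I.evs)
  qed
  ultimately show ?thesis unfolding cstate_def by blast
qed

lemmas compact_Y = minimal_gamma_spaceD(1)[OF minimal_Y]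

text \<open>Otherwise the values of \<open>\<kappa> f\<close> would lie in \<open>[0, c]\<close> for some \<open>c < 1\<close>, and its norm would be at most
  \<open>c\<close>, whereas \<open>f\<close> has norm 1.\<close>

lemma kappa_attains_one:
  assumes f: "f \<in> carrier (cfun_alg (gtop Y))"
    and r: "\<And>y. y \<in> points Y \<Longrightarrow> \<exists>t. f y = of_real t \<and> 0 \<le> t \<and> t \<le> 1"
    and y0: "y0 \<in> points Y" "f y0 = 1"
  shows "\<exists>l\<in>points L. h (\<kappa> f) l = 1"
proof (rule ccontr)
  assume no: "\<not> ?thesis"
  let ?C = "cfun_alg (gtop Y)"
  have x: "\<kappa> f \<in> carrier (alg I)" using kappa_linear(1) f by blast
  have one: "(indicator (points Y) :: 'y \<Rightarrow> complex) \<in> carrier ?C"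
    using Y.one_mem by (simp add: cfun_alg_def)
  have val: "\<exists>t. h (\<kappa> f) l = of_real t \<and> 0 \<le> t \<and> t \<le> 1" if l: "l \<in> points L" for l
  proof -
    note \<tau> = kappa_state[OF l]
    have fpos: "f y \<in> \<real>\<^sub>\<ge>\<^sub>0" "indicator (points Y) y - f y \<in> \<real>\<^sub>\<ge>\<^sub>0" if y: "y \<in> points Y" for y
    proof -
      obtain t where t: "f y = of_real t" "0 \<le> t" "t \<le> 1" using r[OF y] by blast
      then show "f y \<in> \<real>\<^sub>\<ge>\<^sub>0" by simp
      have "indicator (points Y) y - f y = of_real (1 - t)" using y t by simp
      moreover have "0 \<le> 1 - t" using t by simp
      ultimately show "indicator (points Y) y - f y \<in> \<real>\<^sub>\<ge>\<^sub>0" by (simp only: nonneg_Reals_of_real_iff)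
    qed
    have "h (\<kappa> f) l \<in> \<real>\<^sub>\<ge>\<^sub>0" using cstateD(4)[OF \<tau> f fpos(1)] .
    moreover have "1 - h (\<kappa> f) l \<in> \<real>\<^sub>\<ge>\<^sub>0"
      using cstate_mono[OF \<tau> f one fpos(2)] cstateD(3)[OF \<tau>] by simp
    ultimately show ?thesis
      by (intro exI[of _ "Re (h (\<kappa> f) l)"]) (simp add: complex_nonneg_Reals_iff complex_eq_iff)
  qed
  have "compactin euclideanreal ((\<lambda>l. Re (h (\<kappa> f) l)) ` points L)"
  proof (rule image_compactin)
    show "compactin (gtop L) (points L)"
      using minimal_gamma_spaceD(1)[OF minimal_L] by (simp add: compact_space_def)
    show "continuous_map (gtop L) euclideanreal (\<lambda>l. Re (h (\<kappa> f) l))"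
      using continuous_map_compose[OF h_cont[OF x], of euclideanreal Re]
      by (simp add: o_def continuous_intros)
  qed
  then have "compact ((\<lambda>l. Re (h (\<kappa> f) l)) ` points L)" by simp
  moreover have "(\<lambda>l. Re (h (\<kappa> f) l)) ` points L \<noteq> {}" using l0 by blast
  ultimately obtain c where c: "c \<in> (\<lambda>l. Re (h (\<kappa> f) l)) ` points L"
    "\<And>t. t \<in> (\<lambda>l. Re (h (\<kappa> f) l)) ` points L \<Longrightarrow> t \<le> c"
    by (meson compact_attains_sup)
  then obtain l1 where l1: "l1 \<in> points L" "c = Re (h (\<kappa> f) l1)" by blast
  have c0: "0 \<le> c" and c1: "c < 1"
    using val[OF l1(1)] no l1 by (force simp: less_le)+
  have nx: "nrm (alg I) (\<kappa> f) \<le> c"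
  proof (rule nrm_le_if_range[OF x _ c0])
    fix l assume l: "l \<in> points L"
    then show "\<exists>t. h (\<kappa> f) l = of_real t \<and> 0 \<le> t \<and> t \<le> c"
      using val[OF l] c(2)[of "Re (h (\<kappa> f) l)"] by fastforce
  qed
  let ?SI = "{sqrt (nrm (alg I) (adj (alg I) (\<kappa> f \<otimes>\<^bsub>alg I\<^esub> z) \<otimes>\<^bsub>alg I\<^esub> (\<kappa> f \<otimes>\<^bsub>alg I\<^esub> z))) | z.
      z \<in> carrier (alg I) \<and> sqrt (nrm (alg I) (adj (alg I) z \<otimes>\<^bsub>alg I\<^esub> z)) \<le> 1}"
  let ?SY = "{sqrt (nrm ?C (adj ?C (f \<otimes>\<^bsub>?C\<^esub> z) \<otimes>\<^bsub>?C\<^esub> (f \<otimes>\<^bsub>?C\<^esub> z))) | z.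
      z \<in> carrier ?C \<and> sqrt (nrm ?C (adj ?C z \<otimes>\<^bsub>?C\<^esub> z)) \<le> 1}"
  have nI: "sqrt (nrm (alg I) (adj (alg I) z \<otimes>\<^bsub>alg I\<^esub> z)) = nrm (alg I) z" if "z \<in> carrier (alg I)" for z
    using IC.cstar_identity[OF that] IC.nrm_nonneg[OF that] by simp
  have "Sup ?SI \<le> c"
  proof (rule cSup_least)
    have "nrm (alg I) \<zero>\<^bsub>alg I\<^esub> = 0" using IC.nrm_eq_0[OF I.zero_mem] by simp
    then have "sqrt (nrm (alg I) (adj (alg I) \<zero>\<^bsub>alg I\<^esub> \<otimes>\<^bsub>alg I\<^esub> \<zero>\<^bsub>alg I\<^esub>)) \<le> 1"
      using nI[OF I.zero_mem] by simp
    then show "?SI \<noteq> {}" using I.zero_mem by blast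
    fix t assume "t \<in> ?SI"
    then obtain z where z0: "z \<in> carrier (alg I)"
      "sqrt (nrm (alg I) (adj (alg I) z \<otimes>\<^bsub>alg I\<^esub> z)) \<le> 1"
      "t = sqrt (nrm (alg I) (adj (alg I) (\<kappa> f \<otimes>\<^bsub>alg I\<^esub> z) \<otimes>\<^bsub>alg I\<^esub> (\<kappa> f \<otimes>\<^bsub>alg I\<^esub> z)))" by blast
    note z = z0(1) z0(2)[unfolded nI[OF z0(1)]] z0(3)[unfolded nI[OF I.mult_mem[OF x z0(1)]]]
    have "t \<le> nrm (alg I) (\<kappa> f) * nrm (alg I) z" unfolding z(3) by (rule IC.nrm_mult[OF x z(1)])
    also have "\<dots> \<le> c * 1"
      using nx z(2) IC.nrm_nonneg[OF z(1)] c0 by (intro mult_mono) simp_all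
    finally show "t \<le> c" by simp
  qed
  moreover have "nrm (mat_cstar 1 (alg I)) (mat_of (alg I) 1 (\<lambda>i j. \<kappa> (mat_of ?C 1 (\<lambda>_ _. f) i j)))
      = nrm (mat_cstar 1 ?C) (mat_of ?C 1 (\<lambda>_ _. f))"
  proof -
    have "mat_of ?C 1 (\<lambda>_ _. f) \<in> mat_sys 1 (cfun G Y)"
      using Y.mat_carrierI[of 1 "\<lambda>_ _. f"] f by (simp add: mat_sys_def cfun_Y mat_of_def)
    then show ?thesis using kappa_isometric unfolding completely_isometric_def cfun_Y by blast
  qed
  moreover have "mat_of (alg I) 1 (\<lambda>i j. \<kappa> (mat_of ?C 1 (\<lambda>_ _. f) i j)) = mat_of (alg I) 1 (\<lambda>_ _. \<kappa> f)"
    by (simp add: mat_of_def fun_eq_iff)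
  ultimately have SY: "Sup ?SY \<le> c"
    using I.nrm_mat_singleton[OF x] Y.nrm_mat_singleton[OF f] by simp
  have nC: "nrm ?C g = Sup (insert 0 ((\<lambda>x. cmod (g x)) ` points Y))" for g
    by (simp add: cfun_alg_def)
  have bdd: "bdd_above (insert 0 ((\<lambda>x. cmod (g x)) ` points Y))" if g: "g \<in> carrier ?C" for g
  proof -
    obtain B where "\<And>y. y \<in> points Y \<Longrightarrow> cmod (g y) \<le> B" using Y.ev_bounded[OF g] by blast
    then show ?thesis by (intro bdd_aboveI[of _ "max 0 B"]) (auto simp: le_max_iff_disj)
  qed
  have up: "cmod (g y) \<le> nrm ?C g" if "g \<in> carrier ?C" "y \<in> points Y" for g y
    unfolding nC using that by (intro cSup_upper bdd) simp_all
  have least: "nrm ?C g \<le> b" if "\<And>y. y \<in> points Y \<Longrightarrow> cmod (g y) \<le> b" "0 \<le> b" for g b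
    unfolding nC using that by (intro cSup_least) auto
  have fz: "cmod (f y) \<le> 1" if "y \<in> points Y" for y using r[OF that] by auto
  have "1 \<le> Sup ?SY"
  proof (rule order_trans)
    let ?z = "\<one>\<^bsub>?C\<^esub>"
    let ?q = "adj ?C (f \<otimes>\<^bsub>?C\<^esub> ?z) \<otimes>\<^bsub>?C\<^esub> (f \<otimes>\<^bsub>?C\<^esub> ?z)"
    have "?q \<in> carrier ?C" using f by (simp add: Y.mem)
    from up[OF this y0(1)] show "1 \<le> sqrt (nrm ?C ?q)"
      using f y0 by (simp add: Y.mem Y.evs)
    show "sqrt (nrm ?C ?q) \<le> Sup ?SY"
    proof (rule cSup_upper)
      have "nrm ?C (adj ?C ?z \<otimes>\<^bsub>?C\<^esub> ?z) \<le> 1" by (rule least) (simp_all add: Y.mem Y.evs)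
      then show "sqrt (nrm ?C ?q) \<in> ?SY" using Y.one_mem by auto
      show "bdd_above ?SY"
      proof (rule bdd_aboveI)
        fix t assume "t \<in> ?SY"
        then obtain z where z: "z \<in> carrier ?C" "nrm ?C (adj ?C z \<otimes>\<^bsub>?C\<^esub> z) \<le> 1"
          "t = sqrt (nrm ?C (adj ?C (f \<otimes>\<^bsub>?C\<^esub> z) \<otimes>\<^bsub>?C\<^esub> (f \<otimes>\<^bsub>?C\<^esub> z)))" by auto
        have "nrm ?C (adj ?C (f \<otimes>\<^bsub>?C\<^esub> z) \<otimes>\<^bsub>?C\<^esub> (f \<otimes>\<^bsub>?C\<^esub> z)) \<le> 1"
        proof (rule least)
          fix y assume y: "y \<in> points Y"
          have zy: "cmod (z y) * cmod (z y) \<le> 1"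
            using up[of "adj ?C z \<otimes>\<^bsub>?C\<^esub> z" y] z(1,2) y by (simp add: Y.mem Y.evs norm_mult)
          have "(cmod (f y) * cmod (f y)) * (cmod (z y) * cmod (z y)) \<le> (1 * 1) * 1"
            using fz[OF y] zy by (intro mult_mono) simp_all
          then show "cmod ((adj ?C (f \<otimes>\<^bsub>?C\<^esub> z) \<otimes>\<^bsub>?C\<^esub> (f \<otimes>\<^bsub>?C\<^esub> z)) y) \<le> 1"
            using f z(1) y by (simp add: Y.mem Y.evs norm_mult mult_ac)
        qed simp
        then show "t \<le> 1" unfolding z(3) by simp
      qed
    qed
  qed
  then show False using SY c1 by linarith
qed

text \<open>The functions with values in \<open>[0, 1]\<close> and value 1 at \<open>y0\<close> are closed under products, and a product lies
  below its factors. So, by compactness of \<open>L\<close>, the images under \<open>\<kappa>\<close> of all these functions take the value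
  1 at a common point, whose state is concentrated at \<open>y0\<close>.\<close>

lemma kappa_is_evaluation_somewhere:
  assumes y0: "y0 \<in> points Y"
  shows "\<exists>l\<in>points L. \<forall>f\<in>carrier (cfun_alg (gtop Y)). h (\<kappa> f) l = f y0"
proof -
  let ?C = "carrier (cfun_alg (gtop Y))"
  define J where "J = {f \<in> ?C. f y0 = 1 \<and> (\<forall>y\<in>points Y. \<exists>t. f y = of_real t \<and> 0 \<le> t \<and> t \<le> 1)}"
  have JD: "f \<in> ?C" "f y0 = 1" "\<And>y. y \<in> points Y \<Longrightarrow> \<exists>t. f y = of_real t \<and> 0 \<le> t \<and> t \<le> 1"
    if "f \<in> J" for f using that unfolding J_def by blast+
  have Jmult: "(\<lambda>y. f y * g y) \<in> J" if fg: "f \<in> J" "g \<in> J" for f g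
  proof -
    have "(\<lambda>y. f y * g y) \<in> ?C"
      using Y.mult_mem[OF JD(1)[OF fg(1)] JD(1)[OF fg(2)]] by (simp add: cfun_alg_def)
    moreover have "\<exists>t. f y * g y = of_real t \<and> 0 \<le> t \<and> t \<le> 1" if y: "y \<in> points Y" for y
    proof -
      obtain s t where "f y = of_real s" "0 \<le> s" "s \<le> 1" "g y = of_real t" "0 \<le> t" "t \<le> 1"
        using JD(3)[OF fg(1) y] JD(3)[OF fg(2) y] by blast
      then show ?thesis by (intro exI[of _ "s * t"]) (simp add: mult_le_one)
    qed
    ultimately show ?thesis using JD(2) fg unfolding J_def by simp
  qed
  have Jone: "indicator (points Y) \<in> J"
    using Y.one_mem y0 unfolding J_def
    by (auto simp: cfun_alg_def intro: exI[of _ 1])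
  have J1: "h (\<kappa> f) l = 1"
    if f: "f \<in> J" and g: "g \<in> J" "h (\<kappa> g) l = 1" and le: "\<And>y. y \<in> points Y \<Longrightarrow> f y - g y \<in> \<real>\<^sub>\<ge>\<^sub>0"
      and l: "l \<in> points L" for f g l
  proof -
    have "1 - h (\<kappa> f) l \<in> \<real>\<^sub>\<ge>\<^sub>0"
    proof -
      have "indicator (points Y) y - f y \<in> \<real>\<^sub>\<ge>\<^sub>0" if y: "y \<in> points Y" for y
      proof -
        obtain t where t: "f y = of_real t" "0 \<le> t" "t \<le> 1" using JD(3)[OF f y] by blast
        have "indicator (points Y) y - f y = of_real (1 - t)" using y t by simp
        moreover have "0 \<le> 1 - t" using t by simp
        ultimately show ?thesis by (simp only: nonneg_Reals_of_real_iff)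
      qed
      from cstate_mono[OF kappa_state[OF l] JD(1)[OF f] JD(1)[OF Jone] this]
      show ?thesis using cstateD(3)[OF kappa_state[OF l]] by simp
    qed
    moreover have "h (\<kappa> f) l - 1 \<in> \<real>\<^sub>\<ge>\<^sub>0"
      using cstate_mono[OF kappa_state[OF l] JD(1)[OF g(1)] JD(1)[OF f] le] g(2) by simp
    ultimately show ?thesis by (simp add: complex_nonneg_Reals_iff complex_eq_iff)
  qed
  obtain l where l: "l \<in> points L" "\<And>f. f \<in> J \<Longrightarrow> l \<in> {l \<in> points L. h (\<kappa> f) l \<in> {1}}"
  proof (rule compact_space_finite_intersections[OF minimal_gamma_spaceD(1)[OF minimal_L],
        of J "\<lambda>f. {l \<in> points L. h (\<kappa> f) l \<in> {1}}"])
    fix f assume "f \<in> J"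
    then have "\<kappa> f \<in> carrier (alg I)" using kappa_linear(1) JD(1) by blast
    from closedin_continuous_map_preimage[OF h_cont[OF this], of "{1}"]
    show "closedin (gtop L) {l \<in> points L. h (\<kappa> f) l \<in> {1}}" by simp
  next
    fix K assume K: "finite K" "K \<subseteq> J"
    have "\<exists>g\<in>J. \<forall>f\<in>K. \<forall>y\<in>points Y. f y - g y \<in> \<real>\<^sub>\<ge>\<^sub>0"
      using K
    proof (induction K rule: finite_induct)
      case empty
      then show ?case using Jone by blast
    next
      case (insert f K)
      then obtain g where g: "g \<in> J" "\<And>f y. f \<in> K \<Longrightarrow> y \<in> points Y \<Longrightarrow> f y - g y \<in> \<real>\<^sub>\<ge>\<^sub>0" by auto
      have f: "f \<in> J" using insert by simp
      have dec: "f y - f y * g y \<in> \<real>\<^sub>\<ge>\<^sub>0" "g y - f y * g y \<in> \<real>\<^sub>\<ge>\<^sub>0" if y: "y \<in> points Y" for y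
      proof -
        obtain s t where st: "f y = of_real s" "0 \<le> s" "s \<le> 1" "g y = of_real t" "0 \<le> t" "t \<le> 1"
          using JD(3)[OF f y] JD(3)[OF g(1) y] by blast
        have "f y - f y * g y = of_real (s - s * t)" "g y - f y * g y = of_real (t - s * t)"
          using st by simp_all
        moreover have "0 \<le> s - s * t" "0 \<le> t - s * t"
          using mult_left_le[of t s] mult_left_le[of s t] st by (simp_all add: mult.commute)
        ultimately show "f y - f y * g y \<in> \<real>\<^sub>\<ge>\<^sub>0" "g y - f y * g y \<in> \<real>\<^sub>\<ge>\<^sub>0"
          by (simp_all only: nonneg_Reals_of_real_iff)
      qed
      have "k y - f y * g y \<in> \<real>\<^sub>\<ge>\<^sub>0" if k: "k \<in> insert f K" and y: "y \<in> points Y" for k y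
      proof (cases "k = f")
        case True
        then show ?thesis using dec(1)[OF y] by simp
      next
        case False
        then have "k \<in> K" using k by simp
        from nonneg_Reals_add_I[OF g(2)[OF this y] dec(2)[OF y]] show ?thesis by simp
      qed
      then have "\<forall>k\<in>insert f K. \<forall>y\<in>points Y. k y - f y * g y \<in> \<real>\<^sub>\<ge>\<^sub>0" by blast
      then show ?case by (rule bexI[OF _ Jmult[OF f g(1)]])
    qed
    then obtain g where g: "g \<in> J" "\<And>f y. f \<in> K \<Longrightarrow> y \<in> points Y \<Longrightarrow> f y - g y \<in> \<real>\<^sub>\<ge>\<^sub>0" by blast
    obtain l where l: "l \<in> points L" "h (\<kappa> g) l = 1"
      using kappa_attains_one[OF JD(1)[OF g(1)] JD(3)[OF g(1)] y0 JD(2)[OF g(1)]] by blast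
    have "h (\<kappa> f) l = 1" if f: "f \<in> K" for f
    proof -
      have "f \<in> J" using f K(2) by blast
      then show ?thesis using g(1) l(2) g(2)[OF f] l(1) by (rule J1)
    qed
    then show "\<exists>l\<in>points L. \<forall>f\<in>K. l \<in> {l \<in> points L. h (\<kappa> f) l \<in> {1}}"
      using l(1) by (intro bexI[of _ l]) simp_all
  qed blast
  have "h (\<kappa> f) l = f y0" if f: "f \<in> ?C" for f
  proof (rule cstate_value_if_distance_zero[OF kappa_state[OF l(1)] f])
    let ?N = "\<lambda>x. if x \<in> points Y then of_real (cmod (f x - f y0)) else 0 :: complex"
    obtain B where B: "\<And>y. y \<in> points Y \<Longrightarrow> cmod (f y) \<le> B" using Y.ev_bounded[OF f] by blast
    define M where "M = \<bar>2 * B\<bar> + 1"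
    have M: "0 < M" "cmod (f y - f y0) \<le> M" if "y \<in> points Y" for y
      using B[OF that] B[OF y0] norm_triangle_ineq4[of "f y" "f y0"] unfolding M_def by linarith+
    have M0: "0 < M" by (simp add: M_def)
    have N: "?N \<in> ?C"
      by (rule cfun_comp_mem[OF f, of "\<lambda>z. of_real (cmod (z - f y0))"]) (intro continuous_intros)
    let ?g = "\<lambda>x. indicator (points Y) x + of_real (- 1 / M) * ?N x :: complex"
    have m: "(\<lambda>x. of_real (- 1 / M) * ?N x) \<in> ?C"
      by (rule cfun_smult_mem[OF N])
    have g: "?g \<in> ?C" by (rule cfun_add_mem[OF JD(1)[OF Jone] m])
    have "?g \<in> J"
      unfolding J_def
    proof (intro CollectI conjI ballI g)
      show "?g y0 = 1" using y0 by simp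
      fix y assume y: "y \<in> points Y"
      have "?g y = of_real (1 - cmod (f y - f y0) / M)" using y by simp
      moreover have "0 \<le> 1 - cmod (f y - f y0) / M" "1 - cmod (f y - f y0) / M \<le> 1"
        using M[OF y] by simp_all
      ultimately show "\<exists>t. ?g y = of_real t \<and> 0 \<le> t \<and> t \<le> 1" by blast
    qed
    then have "h (\<kappa> ?g) l = 1" using l(2) by blast
    moreover have "h (\<kappa> ?g) l = 1 + of_real (- 1 / M) * h (\<kappa> ?N) l"
      using cstateD(1)[OF kappa_state[OF l(1)] JD(1)[OF Jone] m] cstateD(2)[OF kappa_state[OF l(1)] N, of "of_real (- 1 / M)"]
        cstateD(3)[OF kappa_state[OF l(1)]] by simp
    ultimately show "h (\<kappa> ?N) l = 0" using M0 by simp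
  qed
  then show ?thesis using l(1) by blast
qed

lemma kappa_move:
  assumes s: "s \<in> carrier G" and l: "l \<in> points L" and y: "y \<in> points Y"
    and eval: "\<And>f. f \<in> carrier (cfun_alg (gtop Y)) \<Longrightarrow> h (\<kappa> f) l = f y"
    and f: "f \<in> carrier (cfun_alg (gtop Y))"
  shows "h (\<kappa> f) (move L s l) = f (move Y s y)"
proof -
  have si: "inv s \<in> carrier G" using s by simp
  have "h (\<kappa> f) (move L s l) = h (act I (inv s) (\<kappa> f)) l"
    using h_act_eval[OF si kappa_linear(1)[OF f] l] s by simp
  also have "\<dots> = h (\<kappa> (act (cfun G Y) (inv s) f)) l" using kappa_act[OF si f] by simp
  also have "\<dots> = act (cfun G Y) (inv s) f y" by (rule eval[OF act_Y_mem[OF si f]])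
  also have "\<dots> = f (move Y s y)" using act_Y_eval[OF f y, of "inv s"] s by simp
  finally show ?thesis .
qed

text \<open>By equivariance, the points where \<open>\<kappa>\<close> is an evaluation contain an orbit, which is dense, and limits
  of evaluations are evaluations since \<open>Y\<close> is compact.\<close>

lemma kappa_is_evaluation:
  assumes l: "l \<in> points L"
  shows "\<exists>y\<in>points Y. \<forall>f\<in>carrier (cfun_alg (gtop Y)). h (\<kappa> f) l = f y"
proof -
  let ?C = "carrier (cfun_alg (gtop Y))"
  obtain y0 where y0: "y0 \<in> points Y" using minimal_gamma_spaceD(5)[OF minimal_Y] by blast
  obtain k where k: "k \<in> points L" "\<And>f. f \<in> ?C \<Longrightarrow> h (\<kappa> f) k = f y0"
    using kappa_is_evaluation_somewhere[OF y0] by blast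
  let ?S = "\<lambda>(f, e). {y \<in> points Y. f y \<in> cball (h (\<kappa> f) l) e}"
  obtain y where y: "y \<in> points Y" "\<And>j. j \<in> ?C \<times> {0<..} \<Longrightarrow> y \<in> ?S j"
  proof (rule compact_space_finite_intersections[OF compact_Y, of "?C \<times> {0<..}" ?S])
    fix j :: "('y \<Rightarrow> complex) \<times> real" assume "j \<in> ?C \<times> {0<..}"
    then obtain f e where f: "j = (f, e)" "f \<in> ?C" by blast
    then have "continuous_map (gtop Y) euclidean f" by (simp add: cfun_alg_def)
    from closedin_continuous_map_preimage[OF this, of "cball (h (\<kappa> f) l) e"]
    show "closedin (gtop Y) (?S j)" unfolding f(1) by simp
  next
    fix K assume K: "finite K" "K \<subseteq> ?C \<times> {0 :: real<..}"
    let ?U = "\<lambda>(f, e). {x \<in> points L. h (\<kappa> f) x \<in> ball (h (\<kappa> f) l) e}"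
    have "openin (gtop L) (points L \<inter> (\<Inter>j\<in>K. ?U j))"
    proof -
      have "openin (gtop L) (?U j)" if j: "j \<in> K" for j
      proof -
        obtain f e where f: "j = (f, e)" "f \<in> ?C" using j K(2) by blast
        have "\<kappa> f \<in> carrier (alg I)" using f(2) kappa_linear(1) by blast
        from openin_continuous_map_preimage[OF h_cont[OF this], of "ball (h (\<kappa> f) l) e"]
        show ?thesis unfolding f(1) by simp
      qed
      from openin_INT[OF K(1) this] show ?thesis by (simp only: Int_commute)
    qed
    moreover have "l \<in> points L \<inter> (\<Inter>j\<in>K. ?U j)" using l K(2) by auto
    moreover have "l \<in> gtop L closure_of orbit G (move L) k"
      using minimal_gamma_spaceD(6)[OF minimal_L k(1)] l by simp
    ultimately obtain x where x: "x \<in> orbit G (move L) k" "x \<in> (\<Inter>j\<in>K. ?U j)"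
      unfolding in_closure_of by blast
    then obtain s where s: "s \<in> carrier G" "x = move L s k" unfolding orbit_def by blast
    have sy: "move Y s y0 \<in> points Y" using Y.element_image[OF s(1) y0] by blast
    have "move Y s y0 \<in> ?S j" if j: "j \<in> K" for j
    proof -
      obtain f e where f: "j = (f, e)" "f \<in> ?C" using j K(2) by blast
      have "h (\<kappa> f) x \<in> ball (h (\<kappa> f) l) e" using x(2) j f(1) by blast
      then show ?thesis
        using kappa_move[OF s(1) k(1) y0 k(2) f(2)] sy unfolding f(1) s(2) by simp
    qed
    then show "\<exists>y\<in>points Y. \<forall>j\<in>K. y \<in> ?S j" using sy by blast
  qed blast
  have "h (\<kappa> f) l = f y" if f: "f \<in> ?C" for f
  proof (rule ccontr)
    assume "h (\<kappa> f) l \<noteq> f y"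
    then have "0 < dist (h (\<kappa> f) l) (f y)" by simp
    then have "y \<in> ?S (f, dist (h (\<kappa> f) l) (f y) / 2)" using f by (intro y(2)) simp
    then show False using \<open>0 < dist (h (\<kappa> f) l) (f y)\<close> by simp
  qed
  then show ?thesis using y(1) by blast
qed

end

section \<open>Contraction of pairs in boundaries\<close>

lemma space_borel_of: "space (borel_of T) = topspace T"
  unfolding borel_of_def by (rule space_measure_of) (auto dest: openin_subset)

lemma sets_borel_of: "sets (borel_of T) = sigma_sets (topspace T) {U. openin T U}"
  unfolding borel_of_def by (rule sets_measure_of) (auto dest: openin_subset)

lemma open_in_borel_of: "openin T U \<Longrightarrow> U \<in> sets (borel_of T)"
  unfolding sets_borel_of by blast

lemma closed_in_borel_of:
  assumes "closedin T K"
  shows "K \<in> sets (borel_of T)"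
proof -
  have "space (borel_of T) - (topspace T - K) \<in> sets (borel_of T)"
    using assms by (intro sets.compl_sets open_in_borel_of) blast
  moreover have "space (borel_of T) - (topspace T - K) = K"
    using closedin_subset[OF assms] by (auto simp: space_borel_of)
  ultimately show ?thesis by simp
qed

lemma continuous_map_borel_measurable:
  fixes f :: "'x \<Rightarrow> 'b::topological_space"
  assumes "continuous_map T euclidean f"
  shows "f \<in> borel_measurable (borel_of T)"
proof (rule borel_measurableI)
  fix S :: "'b set" assume "open S"
  then have "openin T {x \<in> topspace T. f x \<in> S}"
    using openin_continuous_map_preimage[OF assms, of S] by simp
  moreover have "f -` S \<inter> space (borel_of T) = {x \<in> topspace T. f x \<in> S}"
    by (auto simp: space_borel_of)
  ultimately show "f -` S \<inter> space (borel_of T) \<in> sets (borel_of T)" using open_in_borel_of by simp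
qed

lemma continuous_map_measurable_borel_of:
  assumes "continuous_map T T' f"
  shows "f \<in> measurable (borel_of T) (borel_of T')"
proof (rule measurable_sigma_sets[OF sets_borel_of])
  show "f \<in> space (borel_of T) \<rightarrow> topspace T'"
    using assms by (auto simp: space_borel_of continuous_map_def)
  fix U assume "U \<in> {U. openin T' U}"
  then have "openin T {x \<in> topspace T. f x \<in> U}"
    using openin_continuous_map_preimage[OF assms] by simp
  moreover have "f -` U \<inter> space (borel_of T) = {x \<in> topspace T. f x \<in> U}"
    by (auto simp: space_borel_of)
  ultimately show "f -` U \<inter> space (borel_of T) \<in> sets (borel_of T)" using open_in_borel_of by simp
qed (auto dest: openin_subset)

definition two_point_measure :: "'x topology \<Rightarrow> 'x \<Rightarrow> 'x \<Rightarrow> 'x measure"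
  where "two_point_measure T a b =
    distr (measure_pmf (pmf_of_set {True, False})) (borel_of T) (\<lambda>c. if c then a else b)"

context
  fixes T :: "'x topology" and a b :: 'x
  assumes ab: "a \<in> topspace T" "b \<in> topspace T"
begin

lemma two_point_measurable:
  "(\<lambda>c. if c then a else b) \<in> measurable (measure_pmf (pmf_of_set {True, False})) (borel_of T)"
  using ab by (simp add: measurable_def space_borel_of)

lemma integral_two_point_measure:
  fixes f :: "'x \<Rightarrow> complex"
  assumes "continuous_map T euclidean f"
  shows "(\<integral>x. f x \<partial>two_point_measure T a b) = (f a + f b) / 2"
proof -
  have "(\<integral>x. f x \<partial>two_point_measure T a b)
      = (\<integral>c. f (if c then a else b) \<partial>measure_pmf (pmf_of_set {True, False}))"
    unfolding two_point_measure_def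
    by (rule integral_distr[OF two_point_measurable continuous_map_borel_measurable[OF assms]])
  also have "\<dots> = (\<Sum>c\<in>{True, False}. pmf (pmf_of_set {True, False}) c *\<^sub>R f (if c then a else b))"
    by (rule integral_measure_pmf) auto
  also have "\<dots> = (f a + f b) / 2"
    by (simp add: scaleR_conv_of_real field_simps)
  finally show ?thesis .
qed

lemma two_point_measure_Prob:
  assumes "Hausdorff_space T"
  shows "two_point_measure T a b \<in> Prob T"
  unfolding Prob_def
proof (intro CollectI conjI ballI)
  let ?\<nu> = "two_point_measure T a b" and ?g = "\<lambda>c. if c then a else b"
  show "prob_space ?\<nu>"
    unfolding two_point_measure_def
    by (rule prob_space.prob_space_distr[OF prob_space_measure_pmf two_point_measurable])
  show sets: "sets ?\<nu> = sets (borel_of T)" by (simp add: two_point_measure_def)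
  fix E assume E: "E \<in> sets ?\<nu>"
  let ?K = "E \<inter> {a, b}"
  have sub: "?K \<subseteq> topspace T" using ab by blast
  have comp: "compactin T ?K" using sub by (intro finite_imp_compactin) auto
  have em: "emeasure ?\<nu> A = emeasure (measure_pmf (pmf_of_set {True, False})) (?g -` A)"
    if "A \<in> sets (borel_of T)" for A
    unfolding two_point_measure_def using emeasure_distr[OF two_point_measurable that] by simp
  have "?K \<in> sets (borel_of T)"
    using compactin_imp_closedin[OF assms comp] by (rule closed_in_borel_of)
  moreover have "?g -` E = ?g -` ?K" by auto
  ultimately have eq: "emeasure ?\<nu> E = emeasure ?\<nu> ?K" using em E sets by simp
  show "emeasure ?\<nu> E = (SUP K\<in>{K. compactin T K \<and> K \<subseteq> E}. emeasure ?\<nu> K)"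
  proof (rule antisym)
    show "emeasure ?\<nu> E \<le> (SUP K\<in>{K. compactin T K \<and> K \<subseteq> E}. emeasure ?\<nu> K)"
      unfolding eq by (rule SUP_upper) (use comp in simp)
    show "(SUP K\<in>{K. compactin T K \<and> K \<subseteq> E}. emeasure ?\<nu> K) \<le> emeasure ?\<nu> E"
      by (rule SUP_least) (use E in \<open>auto intro: emeasure_mono\<close>)
  qed
qed

lemma two_point_measure_null:
  assumes "openin T U" "a \<notin> U" "b \<notin> U"
  shows "emeasure (two_point_measure T a b) U = 0"
proof -
  have "emeasure (two_point_measure T a b) U
      = emeasure (measure_pmf (pmf_of_set {True, False})) ((\<lambda>c. if c then a else b) -` U)"
    unfolding two_point_measure_def
    using emeasure_distr[OF two_point_measurable open_in_borel_of[OF assms(1)]] by simp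
  also have "(\<lambda>c. if c then a else b) -` U = {}" using assms by (auto split: if_splits)
  finally show ?thesis by simp
qed

end

text \<open>The average of the point masses at \<open>a\<close> and \<open>b\<close> is supported in one fibre, so its translates
  accumulate at a point mass \<open>\<delta>\<^sub>y\<close>.\<close>

lemma boundary_contracts_pairs:
  assumes bd: "gamma_boundary G X Y \<phi>" and X: "Hausdorff_space (gtop X)"
    and ab: "a \<in> points Y" "b \<in> points Y" and fibre: "\<phi> a = \<phi> b"
  obtains y where "y \<in> points Y"
    "\<And>F e. finite F \<Longrightarrow> F \<subseteq> carrier (cfun_alg (gtop Y)) \<Longrightarrow> 0 < e \<Longrightarrow>
      \<exists>s\<in>carrier G. \<forall>f\<in>F. dist ((f (move Y s a) + f (move Y s b)) / 2) (f y) < e"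
proof -
  let ?T = "gtop Y" and ?\<nu> = "two_point_measure (gtop Y) a b"
  have mY: "minimal_gamma_space G Y" and fac: "factor_map G Y X \<phi>"
    using bd unfolding gamma_boundary_def by blast+
  have \<phi>: "continuous_map ?T (gtop X) \<phi>" "\<phi> ` points Y = points X"
    using fac unfolding factor_map_def by blast+
  have \<phi>a: "\<phi> a \<in> points X" using \<phi>(2) ab by blast
  have "?\<nu> \<in> Prob ?T"
    by (rule two_point_measure_Prob[OF ab minimal_gamma_spaceD(2)[OF mY]])
  moreover have "supp ?T ?\<nu> \<subseteq> {y \<in> points Y. \<phi> y = \<phi> a}"
  proof
    fix y assume y: "y \<in> supp ?T ?\<nu>"
    have "openin (gtop X) (points X - {\<phi> a})"
      using closedin_Hausdorff_singleton[OF X \<phi>a] by (simp add: openin_diff)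
    from openin_continuous_map_preimage[OF \<phi>(1) this]
    have U: "openin ?T {y \<in> points Y. \<phi> y \<in> points X - {\<phi> a}}" .
    have "emeasure ?\<nu> {y \<in> points Y. \<phi> y \<in> points X - {\<phi> a}} = 0"
      by (rule two_point_measure_null[OF ab U]) (use fibre in auto)
    then have "y \<notin> {y \<in> points Y. \<phi> y \<in> points X - {\<phi> a}}"
      using y U unfolding supp_def by force
    moreover have "y \<in> points Y" using y unfolding supp_def by blast
    ultimately show "y \<in> {y \<in> points Y. \<phi> y = \<phi> a}" using \<phi>(2) by blast
  qed
  ultimately obtain y where y: "y \<in> points Y"
    and cl: "return (borel_of ?T) y \<in> weak_star ?T closure_of {translate Y s ?\<nu> | s. s \<in> carrier G}"
    using bd \<phi>a unfolding gamma_boundary_def by blast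
  show ?thesis
  proof (rule that[OF y])
    fix F and e :: real assume F: "finite F" "F \<subseteq> carrier (cfun_alg ?T)" and e: "0 < e"
    let ?N = "\<lambda>f. {\<nu> \<in> Prob ?T. (\<integral>x. f x \<partial>\<nu>) \<in> ball (f y) e}"
    have open_N: "openin (weak_star ?T) (?N f)" if f: "f \<in> F" for f
    proof -
      have "f \<in> carrier (cfun_alg ?T)" using f F(2) by blast
      moreover have "open (ball (f y) e)" by simp
      ultimately show ?thesis unfolding weak_star_def by (intro topology_generated_by_Basis) blast
    qed
    have "openin (weak_star ?T) ((\<Inter>f\<in>F. ?N f) \<inter> topspace (weak_star ?T))"
      by (rule openin_INT[OF F(1) open_N])
    moreover have "return (borel_of ?T) y \<in> (\<Inter>f\<in>F. ?N f) \<inter> topspace (weak_star ?T)"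
    proof -
      have top: "return (borel_of ?T) y \<in> topspace (weak_star ?T)"
        using cl unfolding in_closure_of by blast
      then have "return (borel_of ?T) y \<in> Prob ?T" unfolding weak_star_def by auto
      moreover have "(\<integral>x. f x \<partial>return (borel_of ?T) y) = f y" if "f \<in> F" for f
      proof -
        have "continuous_map ?T euclidean f" using that F(2) by (auto simp: cfun_alg_def)
        then show ?thesis
          using y by (intro integral_return continuous_map_borel_measurable) (simp add: space_borel_of)
      qed
      ultimately show ?thesis using top e by simp
    qed
    ultimately obtain s where s: "s \<in> carrier G" "translate Y s ?\<nu> \<in> (\<Inter>f\<in>F. ?N f)"
      using cl unfolding in_closure_of by blast
    have ms: "continuous_map ?T ?T (move Y s)"
      using minimal_gamma_spaceD(4)[OF mY s(1)] by (rule homeomorphic_imp_continuous_map)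
    have "translate Y s ?\<nu> = two_point_measure ?T (move Y s a) (move Y s b)"
      unfolding translate_def two_point_measure_def
      by (subst distr_distr[OF continuous_map_measurable_borel_of[OF ms] two_point_measurable[OF ab]])
         (simp add: o_def if_distrib cong: if_cong)
    moreover have "move Y s a \<in> points Y" "move Y s b \<in> points Y"
      using ms ab unfolding continuous_map_def by blast+
    ultimately have int: "(\<integral>x. f x \<partial>translate Y s ?\<nu>) = (f (move Y s a) + f (move Y s b)) / 2"
      if "continuous_map ?T euclidean f" for f :: "_ \<Rightarrow> complex"
      using integral_two_point_measure[OF _ _ that] by simp
    have "dist ((f (move Y s a) + f (move Y s b)) / 2) (f y) < e" if f: "f \<in> F" for f
    proof -
      have "continuous_map ?T euclidean f" using f F(2) by (auto simp: cfun_alg_def)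
      then have "(\<integral>x. f x \<partial>translate Y s ?\<nu>) = (f (move Y s a) + f (move Y s b)) / 2" by (rule int)
      moreover have "(\<integral>x. f x \<partial>translate Y s ?\<nu>) \<in> ball (f y) e" using s(2) f by blast
      ultimately show ?thesis by (metis dist_commute mem_ball)
    qed
    then show "\<exists>s\<in>carrier G. \<forall>f\<in>F. dist ((f (move Y s a) + f (move Y s b)) / 2) (f y) < e"
      using s(1) by blast
  qed
qed

theorem theoremC:
  fixes \<Gamma> :: "('g, 'm) monoid_scheme"
    and L :: "('g, 'l) gspace"
    and X :: "('g, 'x) gspace"
    and Y :: "('g, 'y) gspace"
    and \<phi> :: "'y \<Rightarrow> 'x"
    and I :: "('g, 'i) gsystem"
    and \<kappa> :: "('y \<Rightarrow> complex) \<Rightarrow> 'i"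
  assumes "group \<Gamma>" and "countable (carrier \<Gamma>)" and "infinite (carrier \<Gamma>)"
    and "universal_minimal_gamma_space \<Gamma> L"
    and "minimal_gamma_space \<Gamma> X" and "finite (points X)"
    and "gamma_boundary \<Gamma> X Y \<phi>"
    and "gamma_injective_envelope \<Gamma> (cfun \<Gamma> Y) I \<kappa>"
    and "sys I = carrier (alg I)"
  shows "\<not> gamma_star_isomorphic \<Gamma> I (cfun \<Gamma> L)"
proof
  assume iso: "gamma_star_isomorphic \<Gamma> I (cfun \<Gamma> L)"
  interpret group \<Gamma> by (rule assms(1))
  have mL: "minimal_gamma_space \<Gamma> L"
    using assms(4) unfolding universal_minimal_gamma_space_def by blast
  have mY: "minimal_gamma_space \<Gamma> Y"
    and fac: "factor_map \<Gamma> Y X \<phi>" using assms(7) unfolding gamma_boundary_def by blast+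
  have inj: "gamma_injective \<Gamma> I" and ext: "gamma_extension \<Gamma> (cfun \<Gamma> Y) I \<kappa>"
    and minimal: "\<And>S. \<kappa> ` sys (cfun \<Gamma> Y) \<subseteq> S \<Longrightarrow> S \<subseteq> sys I \<Longrightarrow>
      gamma_injective \<Gamma> (subsystem I S) \<Longrightarrow> S = sys I"
    using assms(8) unfolding gamma_injective_envelope_def by blast+
  obtain h where h: "h \<in> ring_iso (alg I) (cfun_alg (gtop L))"
    "\<And>c x. x \<in> carrier (alg I) \<Longrightarrow> h (c \<odot>\<^bsub>alg I\<^esub> x) = c \<odot>\<^bsub>cfun_alg (gtop L)\<^esub> h x"
    "\<And>x. x \<in> carrier (alg I) \<Longrightarrow> h (adj (alg I) x) = adj (cfun_alg (gtop L)) (h x)"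
    "\<And>s x. s \<in> carrier \<Gamma> \<Longrightarrow> x \<in> carrier (alg I) \<Longrightarrow> h (act I s x) = act (cfun \<Gamma> L) s (h x)"
  proof -
    have "alg (cfun \<Gamma> L) = cfun_alg (gtop L)" by (simp add: cfun_def)
    then show ?thesis using iso that unfolding gamma_star_isomorphic_def by metis
  qed
  have emb: "boundary_embedding \<Gamma> L I h l Y \<kappa>" if "l \<in> points L" for l
    by unfold_locales (fact mL inj assms(9) h that mY ext)+
  let ?m = "Suc (card (points X))"
  obtain Z :: "('g, 'g set set) gspace" and col :: "'g set set \<Rightarrow> nat" and c where Z: "minimal_gamma_space \<Gamma> Z"
    and col: "continuous_map (gtop Z) euclidean col" and c: "\<And>a. a < ?m \<Longrightarrow> c a \<in> points Z"
    and sep: "\<And>s a b. s \<in> carrier \<Gamma> \<Longrightarrow> a < ?m \<Longrightarrow> b < ?m \<Longrightarrow> a \<noteq> b \<Longrightarrow>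
      col (move Z s (c a)) \<noteq> col (move Z s (c b))"
  proof (rule minimal_space_with_separated_points[OF assms(2,3) zero_less_Suc[of "card (points X)"]])
    fix Z :: "('g, 'g set set) gspace" and col :: "'g set set \<Rightarrow> nat" and c
    assume *: "minimal_gamma_space \<Gamma> Z" "continuous_map (gtop Z) euclidean col"
      "\<And>a. a < ?m \<Longrightarrow> c a \<in> points Z"
      "\<And>s a b. s \<in> carrier \<Gamma> \<Longrightarrow> a < ?m \<Longrightarrow> b < ?m \<Longrightarrow> a \<noteq> b \<Longrightarrow>
        col (move Z s (c a)) \<noteq> col (move Z s (c b))"
    show thesis by (rule that[OF *])
  qed
  obtain r where "factor_map \<Gamma> L Z r"
    using assms(4) Z unfolding universal_minimal_gamma_space_def by blast
  then have r: "continuous_map (gtop L) (gtop Z) r" "r ` points L = points Z"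
    "\<And>s l. s \<in> carrier \<Gamma> \<Longrightarrow> l \<in> points L \<Longrightarrow> r (move L s l) = move Z s (r l)"
    unfolding factor_map_def by blast+
  define q where "q s l = col (r (move L s l))" for s l
  obtain l where l: "l \<in> points L" using minimal_gamma_spaceD(5)[OF mL] by blast
  interpret E: boundary_embedding \<Gamma> L I h l Y \<kappa> by (rule emb[OF l])
  let ?C = "carrier (cfun_alg (gtop Y))"
  have "\<exists>k. k \<in> points L \<and> r k = c a" if "a < ?m" for a
    using c[OF that] r(2) by (metis imageE)
  then obtain k where k: "\<And>a. a < ?m \<Longrightarrow> k a \<in> points L" "\<And>a. a < ?m \<Longrightarrow> r (k a) = c a" by metis
  have "\<exists>y. y \<in> points Y \<and> (\<forall>f\<in>?C. h (\<kappa> f) (k a) = f y)" if "a < ?m" for a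
    using E.kappa_is_evaluation[OF k(1)[OF that]] by blast
  then obtain p where p: "\<And>a. a < ?m \<Longrightarrow> p a \<in> points Y"
    "\<And>a f. a < ?m \<Longrightarrow> f \<in> ?C \<Longrightarrow> h (\<kappa> f) (k a) = f (p a)" by metis
  \<comment> \<open>There are more rotations than points of \<open>X\<close>.\<close>
  have "\<not> inj_on (\<lambda>a. \<phi> (p a)) {..<?m}"
  proof
    assume "inj_on (\<lambda>a. \<phi> (p a)) {..<?m}"
    moreover have "(\<lambda>a. \<phi> (p a)) ` {..<?m} \<subseteq> points X"
      using p(1) fac unfolding factor_map_def by blast
    ultimately have "card {..<?m} \<le> card (points X)" using assms(6) by (rule card_inj_on_le)
    then show False by simp
  qed
  then obtain a b where ab: "a < ?m" "b < ?m" "a \<noteq> b" "\<phi> (p a) = \<phi> (p b)"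
    unfolding inj_on_def by auto
  obtain y where y: "y \<in> points Y"
    and contract: "\<And>F e. finite F \<Longrightarrow> F \<subseteq> ?C \<Longrightarrow> 0 < e \<Longrightarrow>
      \<exists>s\<in>carrier \<Gamma>. \<forall>f\<in>F. dist ((f (move Y s (p a)) + f (move Y s (p b))) / 2) (f y) < e"
    using boundary_contracts_pairs[OF assms(7) minimal_gamma_spaceD(2)[OF assms(5)]
        p(1)[OF ab(1)] p(1)[OF ab(2)] ab(4)] by blast
  let ?P = "prod_topology (gtop L) (gtop L)"
  let ?S = "\<lambda>j. case j of Inl s \<Rightarrow> {w \<in> topspace ?P. q s (fst w) \<noteq> q s (snd w)}
    | Inr (f, e) \<Rightarrow> {w \<in> topspace ?P. (h (\<kappa> f) (fst w) + h (\<kappa> f) (snd w)) / 2 \<in> cball (f y) e}"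
  let ?J = "Inl ` carrier \<Gamma> \<union> Inr ` (?C \<times> {0 :: real<..})"
  have q_cont: "continuous_map (gtop L) euclidean (q s)" if s: "s \<in> carrier \<Gamma>" for s
  proof -
    have "continuous_map (gtop L) (gtop L) (move L s)"
      using minimal_gamma_spaceD(4)[OF mL s] by (rule homeomorphic_imp_continuous_map)
    from continuous_map_compose[OF continuous_map_compose[OF this r(1)] col]
    show ?thesis unfolding q_def[abs_def] o_def .
  qed
  \<comment> \<open>A cluster point in \<open>L \<times> L\<close> of the pairs \<open>(s k\<^sub>a, s k\<^sub>b)\<close> with \<open>s\<close> from the contraction: the colours of its
      coordinates differ along the orbit, and the average of the two states of \<open>C(Y)\<close> is evaluation at \<open>y\<close>.\<close>
  obtain w where w: "w \<in> topspace ?P" "\<And>j. j \<in> ?J \<Longrightarrow> w \<in> ?S j"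
  proof (rule compact_space_finite_intersections[of ?P ?J ?S])
    show "compact_space ?P"
      using minimal_gamma_spaceD(1)[OF mL] by (simp add: compact_space_prod_topology)
  next
    fix j assume "j \<in> ?J"
    then consider s where "s \<in> carrier \<Gamma>" "j = Inl s" | f e where "f \<in> ?C" "j = Inr (f, e)" by blast
    then show "closedin ?P (?S j)"
    proof cases
      case (1 s)
      have o: "openin ?P {w \<in> topspace ?P. q s (fst w) = i \<and> q s (snd w) = i}" for i :: nat
      proof -
        have "continuous_map ?P euclidean (q s \<circ> fst)" "continuous_map ?P euclidean (q s \<circ> snd)"
          using continuous_map_compose[OF continuous_map_fst q_cont[OF 1(1)]]
            continuous_map_compose[OF continuous_map_snd q_cont[OF 1(1)]] by blast+
        then have "openin ?P {w \<in> topspace ?P. (q s \<circ> fst) w \<in> {i}}"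
          "openin ?P {w \<in> topspace ?P. (q s \<circ> snd) w \<in> {i}}"
          using discrete_topology_class.open_discrete[of "{i}"]
          by (simp_all only: openin_continuous_map_preimage open_openin[symmetric])
        from openin_Int[OF this] show ?thesis by (rule back_subst[of "openin ?P"]) auto
      qed
      let ?D = "\<Union>i. {w \<in> topspace ?P. q s (fst w) = i \<and> q s (snd w) = i}"
      have "openin ?P ?D"
        using o by blast
      then have "closedin ?P (topspace ?P - ?D)" by (rule closedin_diff[OF closedin_topspace])
      moreover have "?S j = topspace ?P - ?D"
        unfolding 1(2) by auto
      ultimately show ?thesis by (simp only:)
    next
      case (2 f e)
      have hf: "continuous_map (gtop L) euclidean (h (\<kappa> f))"
        by (rule E.h_cont[OF E.kappa_linear(1)[OF 2(1)]])
      have "continuous_map ?P euclidean (h (\<kappa> f) \<circ> fst)" "continuous_map ?P euclidean (h (\<kappa> f) \<circ> snd)"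
        using continuous_map_compose[OF continuous_map_fst hf]
          continuous_map_compose[OF continuous_map_snd hf] by blast+
      then have "continuous_map ?P euclidean (\<lambda>w. h (\<kappa> f) (fst w) + h (\<kappa> f) (snd w))"
        unfolding o_def by (rule continuous_map_add)
      from continuous_map_compose[OF this, of euclidean "\<lambda>z. z / 2"]
      have "continuous_map ?P euclidean (\<lambda>w. (h (\<kappa> f) (fst w) + h (\<kappa> f) (snd w)) / 2)"
        by (simp add: o_def continuous_intros)
      from closedin_continuous_map_preimage[OF this, of "cball (f y) e"]
      show ?thesis unfolding 2(2) by simp
    qed
  next
    fix K assume K: "finite K" "K \<subseteq> ?J"
    let ?F = "{(f, e). Inr (f, e) \<in> K}"
    have finF: "finite ?F"
    proof -
      have "?F = Inr -` K" by auto
      then show ?thesis using K(1) by (simp add: finite_vimageI)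
    qed
    define e where "e = Min (insert 1 (snd ` ?F))"
    have e: "0 < e" "\<And>f d. Inr (f, d) \<in> K \<Longrightarrow> e \<le> d"
    proof -
      have "0 < d" if "d \<in> insert 1 (snd ` ?F)" for d using that K(2) by auto
      then show "0 < e" unfolding e_def using finF by (subst Min_gr_iff) auto
      fix f d assume "Inr (f, d) \<in> K"
      then have "d \<in> snd ` ?F" by force
      then show "e \<le> d" unfolding e_def using finF by (intro Min_le) auto
    qed
    have "fst ` ?F \<subseteq> ?C" using K(2) by auto
    from contract[OF finite_imageI[OF finF] this e(1)] obtain s where s: "s \<in> carrier \<Gamma>"
      "\<And>f d. Inr (f, d) \<in> K \<Longrightarrow> dist ((f (move Y s (p a)) + f (move Y s (p b))) / 2) (f y) < e"
      by force
    let ?w = "(move L s (k a), move L s (k b))"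
    have wP: "?w \<in> topspace ?P" using E.move_mem[OF s(1)] k(1) ab by simp
    have "?w \<in> ?S j" if j: "j \<in> K" for j
    proof -
      from j K(2) consider t where "t \<in> carrier \<Gamma>" "j = Inl t" | f d where "f \<in> ?C" "j = Inr (f, d)" by blast
      then show ?thesis
      proof cases
        case (1 t)
        have "q t (move L s (k i)) = col (move Z (t \<otimes>\<^bsub>\<Gamma>\<^esub> s) (c i))" if "i < ?m" for i
          using E.L.composition_rule[OF k(1)[OF that] 1(1) s(1)] r(3)[of "t \<otimes>\<^bsub>\<Gamma>\<^esub> s" "k i"] k[OF that] 1(1) s(1)
          by (simp add: q_def)
        then show ?thesis using sep[of "t \<otimes>\<^bsub>\<Gamma>\<^esub> s" a b] ab 1 s(1) wP by simp
      next
        case (2 f d)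
        have mv: "h (\<kappa> f) (move L s (k i)) = f (move Y s (p i))" if "i < ?m" for i
          by (rule E.kappa_move[OF s(1) k(1)[OF that] p(1)[OF that] p(2)[OF that] 2(1)])
        have "dist ((f (move Y s (p a)) + f (move Y s (p b))) / 2) (f y) \<le> d"
          using s(2)[of f d] e(2)[of f d] j 2(2) by force
        then show ?thesis using wP 2(2) mv ab by (simp add: dist_commute)
      qed
    qed
    then show "\<exists>w\<in>topspace ?P. \<forall>j\<in>K. w \<in> ?S j" using wP by blast
  qed blast
  obtain l0 l1 where w_eq: "w = (l0, l1)" by (cases w)
  have L01: "l0 \<in> points L" "l1 \<in> points L" using w(1) unfolding w_eq by simp_all
  have q01: "q s l0 \<noteq> q s l1" if "s \<in> carrier \<Gamma>" for s
    using w(2)[of "Inl s"] that unfolding w_eq by simp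
  have avg: "(h (\<kappa> f) l0 + h (\<kappa> f) l1) / 2 = f y" if f: "f \<in> ?C" for f
  proof (rule ccontr)
    let ?d = "dist (f y) ((h (\<kappa> f) l0 + h (\<kappa> f) l1) / 2)"
    assume "(h (\<kappa> f) l0 + h (\<kappa> f) l1) / 2 \<noteq> f y"
    then have d: "0 < ?d" by simp
    then have "w \<in> ?S (Inr (f, ?d / 2))" using f by (intro w(2)) simp
    then show False using d unfolding w_eq by simp
  qed
  obtain y0 where y0: "y0 \<in> points Y" "\<And>f. f \<in> ?C \<Longrightarrow> h (\<kappa> f) l0 = f y0"
    using E.kappa_is_evaluation[OF L01(1)] by blast
  obtain y1 where y1: "y1 \<in> points Y" "\<And>f. f \<in> ?C \<Longrightarrow> h (\<kappa> f) l1 = f y1"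
    using E.kappa_is_evaluation[OF L01(2)] by blast
  have same: "h (\<kappa> f) l1 = h (\<kappa> f) l0" if f: "f \<in> ?C" for f
  proof -
    \<comment> \<open>A function that vanishes only where \<open>f\<close> has the value \<open>f y\<close>, so its average can vanish only if both
        points evaluate \<open>f\<close> like \<open>y\<close>.\<close>
    let ?N = "\<lambda>x. if x \<in> points Y then of_real (cmod (f x - f y)) else 0 :: complex"
    have N: "?N \<in> ?C"
      by (rule cfun_comp_mem[OF f, of "\<lambda>z. of_real (cmod (z - f y))"]) (intro continuous_intros)
    have "of_real (cmod (f y0 - f y) + cmod (f y1 - f y)) = (0 :: complex)"
      using avg[OF N] y0(2)[OF N] y1(2)[OF N] y y0(1) y1(1) by simp
    then have "cmod (f y0 - f y) + cmod (f y1 - f y) = 0" by (simp only: of_real_eq_0_iff)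
    then have "f y0 = f y" "f y1 = f y" by (simp_all add: add_nonneg_eq_0_iff)
    then show ?thesis using y0(2)[OF f] y1(2)[OF f] by simp
  qed
  interpret E0: boundary_embedding \<Gamma> L I h l0 Y \<kappa> by (rule emb[OF L01(1)])
  \<comment> \<open>The indicator function of the colour of \<open>l0\<close> at the identity.\<close>
  let ?u = "\<lambda>l. if l \<in> points L then (if q \<one>\<^bsub>\<Gamma>\<^esub> l = q \<one>\<^bsub>\<Gamma>\<^esub> l0 then 1 else 0) else 0 :: complex"
  have "continuous_map (gtop L) euclidean (\<lambda>l. if q \<one>\<^bsub>\<Gamma>\<^esub> l = q \<one>\<^bsub>\<Gamma>\<^esub> l0 then 1 else 0 :: complex)"
  proof -
    have "continuous_map euclidean euclidean (\<lambda>i. if i = q \<one>\<^bsub>\<Gamma>\<^esub> l0 then 1 else 0 :: complex)"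
      by (simp add: Topological_Spaces.continuous_on_discrete)
    from continuous_map_compose[OF q_cont[OF one_closed] this] show ?thesis by (simp add: o_def)
  qed
  then have "continuous_map (gtop L) euclidean ?u" by (rule continuous_map_eq) simp
  then have "?u \<in> carrier (cfun_alg (gtop L))" by (simp add: cfun_alg_def)
  then obtain f where f: "f \<in> carrier (alg I)" "h f = ?u" using E0.h_surj by blast
  have "\<exists>s\<in>carrier \<Gamma>. 1 < Re (h f (move L s l0) + h f (move L s l1))"
  proof (rule E0.proximality_of_undistinguished_points[of "\<kappa> ` ?C" l1 f])
    show "\<kappa> ` ?C \<subseteq> carrier (alg I)" using E0.kappa_linear(1) by blast
    show "act I s x \<in> \<kappa> ` ?C" if s: "s \<in> carrier \<Gamma>" and x: "x \<in> \<kappa> ` ?C" for s x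
    proof -
      from x obtain g where g: "g \<in> ?C" "x = \<kappa> g" by blast
      then show ?thesis
        using E0.kappa_act[OF s g(1)] E0.act_Y_mem[OF s g(1)] by (metis imageI)
    qed
    show "S = carrier (alg I)"
      if "\<kappa> ` ?C \<subseteq> S" "S \<subseteq> carrier (alg I)" "gamma_injective \<Gamma> (subsystem I S)" for S
      using minimal[of S] that unfolding E0.cfun_Y assms(9) by blast
    show "h x l1 = h x l0" if "x \<in> \<kappa> ` ?C" for x using same that by blast
    show "h f l0 = 1" using L01 f by simp
    show "h f l \<in> \<real>\<^sub>\<ge>\<^sub>0" for l using f by simp
  qed (use L01 f in simp_all)
  then obtain s where s: "s \<in> carrier \<Gamma>" "1 < Re (h f (move L s l0) + h f (move L s l1))" by blast
  have "q \<one>\<^bsub>\<Gamma>\<^esub> (move L s x) = q s x" if "x \<in> points L" for x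
    using E.L.composition_rule[OF that one_closed s(1)] s(1) by (simp add: q_def)
  then have "q \<one>\<^bsub>\<Gamma>\<^esub> (move L s l0) \<noteq> q \<one>\<^bsub>\<Gamma>\<^esub> (move L s l1)" using q01[OF s(1)] L01 by simp
  then have "Re (h f (move L s l0) + h f (move L s l1)) \<le> 1" unfolding f(2) by auto
  then show False using s(2) by simp
qed

end
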